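(* Let $I$ be the monomial ideal in $k[x_1,\dots,x_8]$ given by \begin{align*} I=(&x_3x_8,\ x_4x_5,\ x_6x_7,\ x_7x_8,\ x_1x_2x_4,\ x_1x_3x_4,\ x_2x_3x_4,\ x_1x_2x_5,\ x_2x_3x_5,\ x_1x_4x_6,\ x_1x_5x_6,\\ &x_2x_5x_6,\ x_1x_2x_7,\ x_1x_3x_7,\ x_2x_4x_7,\ x_3x_5x_7,\ x_1x_2x_8,\ x_1x_5x_8,\ x_2x_6x_8,\ x_1x_3x_6,\\ &x_2x_3x_6,\ x_4x_6x_8), \end{align*} which is the Stanley-Reisner ideal of an $8$-vertex triangulation of the Klein bottle. Then the Betti numbers of $I^h$ depend on the field for every $h\ge 1$; that is, for every $h\geq 1$ there exist an integer $i\ge 0$ and fields $k,k'$ such that $\beta_i^{k}(I^h)\neq\beta_i^{k'}(I^h)$.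
   Context: A monomial ideal $I$ has a unique minimal system $G(I)$ of monic monomial generators, which makes sense over every coefficient field. For a field $k$, $\beta_i^k(I)=\dim_k \mathrm{Tor}_i^R(I,k)$, with $R=k[x_1,\dots,x_8]$, denotes the $i$-th (total) Betti number of the ideal generated by $G(I)$ in $R$ (of $I$ as a module, not of $R/I$); powers $I^h$ are treated in the same way. The triangulation in question has vertices $1,\dots,8$ and the $16$ facets $\{3,4,7\}$, $\{3,4,6\}$, $\{3,5,6\}$, $\{5,6,8\}$, $\{2,5,8\}$, $\{2,5,7\}$, $\{2,4,6\}$, $\{1,2,6\}$, $\{1,6,8\}$, $\{1,4,8\}$, $\{2,4,8\}$, $\{1,2,3\}$, $\{2,3,7\}$, $\{1,3,5\}$, $\{1,5,7\}$, $\{1,4,7\}$. The Stanley-Reisner ideal of a simplicial complex is generated by the squarefree monomials $\prod_{j\in F}x_j$ for $F$ a non-face. *)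

theory Defs
  imports
    Complex_Main
    "HOL-Library.Multiset"
    "Jordan_Normal_Form.Missing_VectorSpace"
    "HOL-Algebra.Ideal_Product"
begin

hide_const (open) Multiset.mult

section \<open>Polynomial rings over a field given as a record\<close>

text \<open>A monomial is the multiset of its variables: \<open>{#3, 8#}\<close> stands for $x_3 x_8$, the product
  of monomials is the sum of multisets, and divisibility is \<open>\<subseteq>#\<close>. A polynomial is its coefficient
  function; \<open>V\<close> is the set of (indices of) variables.\<close>

definition mpoly_ring :: "('a, 'b) ring_scheme \<Rightarrow> 'v set \<Rightarrow> ('v multiset \<Rightarrow> 'a) ring" where
  "mpoly_ring K V =
    \<lparr>carrier = {p. (\<forall>m. p m \<in> carrier K) \<and> finite {m. p m \<noteq> \<zero>\<^bsub>K\<^esub>} \<and>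
                   (\<forall>m. p m \<noteq> \<zero>\<^bsub>K\<^esub> \<longrightarrow> set_mset m \<subseteq> V)},
     mult = (\<lambda>p q m. \<Oplus>\<^bsub>K\<^esub>a\<in>{a. a \<subseteq># m}. p a \<otimes>\<^bsub>K\<^esub> q (m - a)),
     one = (\<lambda>m. if m = {#} then \<one>\<^bsub>K\<^esub> else \<zero>\<^bsub>K\<^esub>),
     zero = (\<lambda>m. \<zero>\<^bsub>K\<^esub>),
     add = (\<lambda>p q m. p m \<oplus>\<^bsub>K\<^esub> q m)\<rparr>"

definition mpoly_term :: "('a, 'b) ring_scheme \<Rightarrow> 'a \<Rightarrow> 'v multiset \<Rightarrow> 'v multiset \<Rightarrow> 'a" where
  "mpoly_term K c m = (\<lambda>m'. if m' = m then c else \<zero>\<^bsub>K\<^esub>)"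

definition monomial_ideal ::
    "('a, 'b) ring_scheme \<Rightarrow> 'v set \<Rightarrow> 'v multiset set \<Rightarrow> ('v multiset \<Rightarrow> 'a) set" where
  "monomial_ideal K V G = Idl\<^bsub>mpoly_ring K V\<^esub> (mpoly_term K \<one>\<^bsub>K\<^esub> ` G)"

definition ideal_power ::
    "('r, 'b) ring_scheme \<Rightarrow> 'r set \<Rightarrow> nat \<Rightarrow> 'r set" where
  "ideal_power R I h = I [^]\<^bsub>ideals_set R\<^esub> h"


section \<open>Modules\<close>

definition ideal_module :: "('r, 'b) ring_scheme \<Rightarrow> 'r set \<Rightarrow> ('r, 'r) module" where
  "ideal_module R I =
    \<lparr>carrier = I, mult = mult R, one = \<one>\<^bsub>R\<^esub>, zero = \<zero>\<^bsub>R\<^esub>, add = add R, smult = mult R\<rparr>"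

text \<open>The field \<open>K\<close> as a module over the polynomial ring, that is, the quotient by the ideal generated
  by the variables: a polynomial acts through its constant coefficient.\<close>

definition residue_module :: "('a, 'b) ring_scheme \<Rightarrow> ('v multiset \<Rightarrow> 'a, 'a) module" where
  "residue_module K =
    \<lparr>carrier = carrier K, mult = mult K, one = \<one>\<^bsub>K\<^esub>, zero = \<zero>\<^bsub>K\<^esub>, add = add K,
     smult = (\<lambda>p c. p {#} \<otimes>\<^bsub>K\<^esub> c)\<rparr>"

text \<open>The direct sum of \<open>n\<close> copies of \<open>M\<close>. In this and the next two records the ring
  multiplication fields, which modules do not use, are left unspecified.\<close>

definition power_module :: "('r, 'm, 'c) module_scheme \<Rightarrow> nat \<Rightarrow> ('r, nat \<Rightarrow> 'm) module" where
  "power_module M n =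
    \<lparr>carrier = {..<n} \<rightarrow>\<^sub>E carrier M, mult = undefined, one = undefined,
     zero = (\<lambda>j\<in>{..<n}. \<zero>\<^bsub>M\<^esub>),
     add = (\<lambda>u v. \<lambda>j\<in>{..<n}. u j \<oplus>\<^bsub>M\<^esub> v j),
     smult = (\<lambda>r v. \<lambda>j\<in>{..<n}. r \<odot>\<^bsub>M\<^esub> v j)\<rparr>"

text \<open>The quotient \<open>Z / B\<close> for submodules \<open>B \<subseteq> Z\<close> of \<open>M\<close>. Its zero is the coset \<open>B\<close>.\<close>

definition quotient_module ::
    "('r, 'm, 'c) module_scheme \<Rightarrow> 'm set \<Rightarrow> 'm set \<Rightarrow> ('r, 'm set) module" where
  "quotient_module M Z B =
    \<lparr>carrier = (\<lambda>z. B +>\<^bsub>M\<^esub> z) ` Z, mult = undefined, one = undefined,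
     zero = B, add = set_add M,
     smult = (\<lambda>r X. \<Union>x\<in>X. B +>\<^bsub>M\<^esub> (r \<odot>\<^bsub>M\<^esub> x))\<rparr>"

definition restrict_scalars ::
    "('a \<Rightarrow> 'r) \<Rightarrow> ('r, 'm, 'c) module_scheme \<Rightarrow> ('a, 'm) module" where
  "restrict_scalars f M =
    \<lparr>carrier = carrier M, mult = undefined, one = undefined, zero = \<zero>\<^bsub>M\<^esub>, add = add M,
     smult = (\<lambda>c. smult M (f c))\<rparr>"


section \<open>Free resolutions and Tor\<close>

text \<open>The map from \<open>M^n\<close> to \<open>M^l\<close> given by an \<open>l\<close> by \<open>n\<close> matrix over the ring.\<close>

definition mat_map ::
    "('r, 'm, 'c) module_scheme \<Rightarrow> nat \<Rightarrow> nat \<Rightarrow> (nat \<Rightarrow> nat \<Rightarrow> 'r) \<Rightarrow> (nat \<Rightarrow> 'm) \<Rightarrow> nat \<Rightarrow> 'm" where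
  "mat_map M l n A v = (\<lambda>a\<in>{..<l}. \<Oplus>\<^bsub>M\<^esub>j\<in>{..<n}. A a j \<odot>\<^bsub>M\<^esub> v j)"

text \<open>A complex of finitely generated free modules \<open>\<dots> \<rightarrow> R^(n 1) \<rightarrow> R^(n 0) \<rightarrow> N\<close> in coordinates:
  \<open>res_diff F i\<close> is the matrix of the map from \<open>R^(n (i + 1))\<close> to \<open>R^(n i)\<close>, and \<open>res_aug F j\<close> is
  the image in \<open>N\<close> of the \<open>j\<close>-th basis vector of \<open>R^(n 0)\<close>. It need not be of finite length.\<close>

record ('r, 'n) free_complex =
  res_rank :: "nat \<Rightarrow> nat"
  res_diff :: "nat \<Rightarrow> nat \<Rightarrow> nat \<Rightarrow> 'r"
  res_aug :: "nat \<Rightarrow> 'n"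

definition free_resolution ::
    "('r, 'b) ring_scheme \<Rightarrow> ('r, 'n, 'c) module_scheme \<Rightarrow> ('r, 'n) free_complex \<Rightarrow> bool" where
  "free_resolution R N F \<longleftrightarrow>
    (let n = res_rank F; D = res_diff F; e = res_aug F;
         S = ideal_module R (carrier R);
         \<epsilon> = (\<lambda>v. \<Oplus>\<^bsub>N\<^esub>j\<in>{..<n 0}. v j \<odot>\<^bsub>N\<^esub> e j);
         d = (\<lambda>i. mat_map S (n i) (n (Suc i)) (D i))
     in (\<forall>j<n 0. e j \<in> carrier N) \<and>
        (\<forall>i. \<forall>a<n i. \<forall>b<n (Suc i). D i a b \<in> carrier R) \<and>
        \<epsilon> ` carrier (power_module S (n 0)) = carrier N \<and>
        d 0 ` carrier (power_module S (n 1)) =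
          {v \<in> carrier (power_module S (n 0)). \<epsilon> v = \<zero>\<^bsub>N\<^esub>} \<and>
        (\<forall>i. d (Suc i) ` carrier (power_module S (n (Suc (Suc i)))) =
          {v \<in> carrier (power_module S (n (Suc i))). d i v = \<zero>\<^bsub>power_module S (n i)\<^esub>}))"

text \<open>The \<open>i\<close>-th homology of the complex obtained by tensoring \<open>M\<close> with \<open>F\<close> (without the
  augmentation), where the tensor product of \<open>M\<close> with \<open>R^n\<close> is identified with \<open>M^n\<close>.\<close>

definition tensor_cycles ::
    "('r, 'm, 'c) module_scheme \<Rightarrow> ('r, 'n) free_complex \<Rightarrow> nat \<Rightarrow> (nat \<Rightarrow> 'm) set" where
  "tensor_cycles M F i =
    (let n = res_rank F in
     case i of
       0 \<Rightarrow> carrier (power_module M (n 0))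
     | Suc j \<Rightarrow> {v \<in> carrier (power_module M (n (Suc j))).
                  mat_map M (n j) (n (Suc j)) (res_diff F j) v = \<zero>\<^bsub>power_module M (n j)\<^esub>})"

definition tensor_boundaries ::
    "('r, 'm, 'c) module_scheme \<Rightarrow> ('r, 'n) free_complex \<Rightarrow> nat \<Rightarrow> (nat \<Rightarrow> 'm) set" where
  "tensor_boundaries M F i =
    (let n = res_rank F in
     mat_map M (n i) (n (Suc i)) (res_diff F i) ` carrier (power_module M (n (Suc i))))"

definition tensor_homology ::
    "('r, 'm, 'c) module_scheme \<Rightarrow> ('r, 'n) free_complex \<Rightarrow> nat \<Rightarrow> ('r, (nat \<Rightarrow> 'm) set) module" where
  "tensor_homology M F i =
    quotient_module (power_module M (res_rank F i)) (tensor_cycles M F i) (tensor_boundaries M F i)"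

text \<open>Tor of \<open>M\<close> and \<open>N\<close>, computed from a chosen free resolution of the second argument. The result
  does not depend on the choice up to isomorphism. Resolutions by free modules of finite rank exist
  for a finitely generated \<open>N\<close> over a Noetherian ring, the only case needed here.\<close>

definition Tor ::
    "('r, 'b) ring_scheme \<Rightarrow> nat \<Rightarrow> ('r, 'm, 'c) module_scheme \<Rightarrow> ('r, 'n, 'd) module_scheme \<Rightarrow>
      ('r, (nat \<Rightarrow> 'm) set) module" where
  "Tor R i M N = tensor_homology M (SOME F. free_resolution R N F) i"

definition betti ::
    "('a, 'b) ring_scheme \<Rightarrow> 'v set \<Rightarrow> nat \<Rightarrow> ('v multiset \<Rightarrow> 'a) set \<Rightarrow> nat" where
  "betti K V i I =
    vectorspace.dim K
      (restrict_scalars (\<lambda>c. mpoly_term K c {#})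
        (Tor (mpoly_ring K V) i (ideal_module (mpoly_ring K V) I) (residue_module K)))"


section \<open>The ideal and the triangulation\<close>

definition complex_of_facets :: "'v set set \<Rightarrow> 'v set set" where
  "complex_of_facets \<F> = {A. \<exists>T\<in>\<F>. A \<subseteq> T}"

definition stanley_reisner_ideal ::
    "('a, 'b) ring_scheme \<Rightarrow> 'v set \<Rightarrow> 'v set set \<Rightarrow> ('v multiset \<Rightarrow> 'a) set" where
  "stanley_reisner_ideal K V \<Delta> = monomial_ideal K V {mset_set A | A. A \<subseteq> V \<and> A \<notin> \<Delta>}"

definition klein_vertices :: "nat set" where
  "klein_vertices = {1..8}"

definition klein_facets :: "nat set set" where
  "klein_facets =
    {{3, 4, 7}, {3, 4, 6}, {3, 5, 6}, {5, 6, 8}, {2, 5, 8}, {2, 5, 7}, {2, 4, 6}, {1, 2, 6},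
     {1, 6, 8}, {1, 4, 8}, {2, 4, 8}, {1, 2, 3}, {2, 3, 7}, {1, 3, 5}, {1, 5, 7}, {1, 4, 7}}"

definition klein_generators :: "nat multiset set" where
  "klein_generators =
    {{#3, 8#}, {#4, 5#}, {#6, 7#}, {#7, 8#}, {#1, 2, 4#}, {#1, 3, 4#},
     {#2, 3, 4#}, {#1, 2, 5#}, {#2, 3, 5#}, {#1, 4, 6#}, {#1, 5, 6#}, {#2, 5, 6#},
     {#1, 2, 7#}, {#1, 3, 7#}, {#2, 4, 7#}, {#3, 5, 7#}, {#1, 2, 8#}, {#1, 5, 8#},
     {#2, 6, 8#}, {#1, 3, 6#}, {#2, 3, 6#}, {#4, 6, 8#}}"

definition klein_ideal :: "('a, 'b) ring_scheme \<Rightarrow> (nat multiset \<Rightarrow> 'a) set" where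
  "klein_ideal K = monomial_ideal K klein_vertices klein_generators"

definition klein_ideal_power :: "('a, 'b) ring_scheme \<Rightarrow> nat \<Rightarrow> (nat multiset \<Rightarrow> 'a) set" where
  "klein_ideal_power K h = ideal_power (mpoly_ring K klein_vertices) (klein_ideal K) h"

end

theory Submission
  imports Defs "HOL-Library.Function_Algebras" "HOL-Library.Z2"
begin

text \<open>The Betti numbers of a monomial ideal \<open>J\<close> are the dimensions of the homology of the tensor
  product of \<open>J\<close> with the Koszul complex, which is a free resolution of the field (the interpretation
  \<open>koszul\<close>); any other resolution gives the same homology (\<open>homology_comparison\<close>). This
  complex is graded by exponent vectors. Dividing by a variable whose exponent exceeds \<open>h\<close>
  contracts it in all degrees with such a variable if \<open>J = I\<^sup>h\<close> for a squarefree monomial ideal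
  \<open>I\<close> (\<open>koszul_contraction\<close>), so only finitely many degrees contribute. What remains is a
  finite complex of vector spaces with bases that do not depend on the field and matrices with entries
  in \<open>{0, 1, -1}\<close>, and the \<open>i\<close>-th Betti number is the number of basis vectors minus two ranks
  (\<open>betti_klein_ideal_power\<close>). A rank modulo two is at most the rational rank
  (\<open>rank_bit_le_rank_rat\<close>), and it is smaller if some integer vector lies in the rational image
  but not in the image modulo two (\<open>rank_bit_less_rank_rat\<close>). Hence it suffices to find such a
  vector.

  It is found in the degree of $x_1 \cdots x_8 (x_4 x_5)^{h-1}$. For a set \<open>A\<close> of vertices the
  product of $(x_4 x_5)^{h-1}$ and the variables in \<open>A\<close> lies in $I^h$ if and only if \<open>A\<close> is
  not a face of the triangulation (\<open>kmonomial_in_kmon_iff\<close>): if \<open>A\<close> is contained in a facet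
  \<open>T\<close>, the variables have weights for which every generator of \<open>I\<close> has weight at least 4,
  while $x_4 x_5$ has weight 4 and \<open>T\<close> has weight less than 4. So for every \<open>h\<close> the complex in
  this degree is that of the Alexander dual of the Klein bottle. In terms of the complements \<open>A\<close> it
  consists of the cochains of the full simplex that vanish on the faces of the triangulation, and its
  torsion comes from the second cohomology of the Klein bottle: twice a facet is the coboundary of a
  cochain on the edges along a Moebius band (\<open>torsion_chain_bd\<close>), but a single facet is not a
  coboundary modulo two, since every edge lies in exactly two facets (\<open>torsion_cycle_bit\<close>).

  Most of the argument takes place in types: polynomials over a field that is a type, and chains as
  functions on sets of basis vectors. It is transferred to records by maps from types onto the carriers
  of the records.\<close>

section \<open>Free resolutions over a commutative ring\<close>

text \<open>Vectors are functions with pointwise operations. They are evaluated at a point only on request.\<close>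

declare plus_fun_apply [simp del] zero_fun_apply [simp del] minus_apply [simp del]

text \<open>The functions that vanish outside of \<open>X\<close>: the free module on \<open>X\<close>, if \<open>X\<close> is finite.\<close>

definition fvec :: "'x set \<Rightarrow> ('x \<Rightarrow> 'r::zero) set" where
  "fvec X = {v. \<forall>x. x \<notin> X \<longrightarrow> v x = 0}"

definition scl :: "'r::times \<Rightarrow> ('x \<Rightarrow> 'r) \<Rightarrow> 'x \<Rightarrow> 'r" where
  "scl r v = (\<lambda>x. r * v x)"

definition unit_vec :: "'x \<Rightarrow> 'x \<Rightarrow> 'r::zero_neq_one" where
  "unit_vec x = (\<lambda>y. if y = x then 1 else 0)"

text \<open>Maps are required to be linear on all functions, including those that do not vanish outside of the
  set in question.\<close>

definition rlinear :: "(('x \<Rightarrow> 'r::comm_ring_1) \<Rightarrow> ('y \<Rightarrow> 'r)) \<Rightarrow> bool" where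
  "rlinear T \<longleftrightarrow> (\<forall>v w. T (v + w) = T v + T w) \<and> (\<forall>r v. T (scl r v) = scl r (T v))"

lemma scl_apply: "scl r v x = r * v x"
  by (simp add: scl_def)

lemma sum_fun_apply: "(\<Sum>x\<in>A. f x) y = (\<Sum>x\<in>A. f x y)"
  by (induction A rule: infinite_finite_induct) (auto simp: zero_fun_apply plus_fun_apply)

lemmas fun_ops_apply = plus_fun_apply zero_fun_apply minus_apply sum_fun_apply scl_apply

lemma fvecD: "v \<in> fvec X \<Longrightarrow> x \<notin> X \<Longrightarrow> v x = 0"
  by (simp add: fvec_def)

lemma fvec_0 [simp]: "0 \<in> fvec X"
  and fvec_add: "v \<in> fvec X \<Longrightarrow> w \<in> fvec X \<Longrightarrow> v + w \<in> fvec X"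
  and fvec_diff: "v' \<in> fvec X \<Longrightarrow> w' \<in> fvec X \<Longrightarrow> v' - w' \<in> fvec X"
  and fvec_scl: "u \<in> fvec X \<Longrightarrow> scl r u \<in> fvec X"
  for v w :: "'x \<Rightarrow> 'r::comm_monoid_add" and v' w' :: "'x \<Rightarrow> 'r'::ab_group_add"
    and u :: "'x \<Rightarrow> 'r''::mult_zero"
  by (auto simp: fvec_def fun_ops_apply)

lemma fvec_sum: "(\<And>x. x \<in> A \<Longrightarrow> f x \<in> fvec X) \<Longrightarrow> (\<Sum>x\<in>A. f x) \<in> fvec X"
  by (induction A rule: infinite_finite_induct) (auto intro!: fvec_add)

lemma unit_vec_in_fvec: "x \<in> X \<Longrightarrow> unit_vec x \<in> fvec X"
  by (auto simp: fvec_def unit_vec_def)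

lemma fvec_expand:
  fixes v :: "'x \<Rightarrow> 'r::comm_ring_1"
  assumes "finite X" "v \<in> fvec X"
  shows "v = (\<Sum>x\<in>X. scl (v x) (unit_vec x))"
proof
  fix y
  show "v y = (\<Sum>x\<in>X. scl (v x) (unit_vec x)) y"
    using assms by (cases "y \<in> X")
      (auto simp: fun_ops_apply unit_vec_def fvec_def if_distrib[of "\<lambda>t. _ * t"] cong: if_cong)
qed

lemma rlinearI:
  assumes "\<And>v w. T (v + w) = T v + T w" "\<And>r v. T (scl r v) = scl r (T v)"
  shows "rlinear T"
  using assms by (simp add: rlinear_def)

lemma rlinear_add: "rlinear T \<Longrightarrow> T (v + w) = T v + T w"
  and rlinear_scl: "rlinear T \<Longrightarrow> T (scl r v) = scl r (T v)"
  by (auto simp: rlinear_def)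

lemma rlinear_0: "rlinear T \<Longrightarrow> T 0 = 0"
  using rlinear_add[of T 0 0] by simp

lemma rlinear_diff: "rlinear T \<Longrightarrow> T (v - w) = T v - T w"
  using rlinear_add[of T "v - w" w] by (simp add: algebra_simps)

lemma rlinear_sum: "rlinear T \<Longrightarrow> T (\<Sum>x\<in>A. f x) = (\<Sum>x\<in>A. T (f x))"
  by (induction A rule: infinite_finite_induct) (auto simp: rlinear_0 rlinear_add)

lemma rlinear_expand:
  assumes "rlinear T" "finite X" "v \<in> fvec X"
  shows "T v = (\<Sum>x\<in>X. scl (v x) (T (unit_vec x)))"
proof -
  have "T v = T (\<Sum>x\<in>X. scl (v x) (unit_vec x))"
    by (rule arg_cong[OF fvec_expand[OF assms(2,3)]])
  then show ?thesis
    by (simp add: rlinear_sum[OF assms(1)] rlinear_scl[OF assms(1)])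
qed

lemma rlinear_id: "rlinear (\<lambda>v. v)"
  and rlinear_minus: "rlinear S' \<Longrightarrow> rlinear T' \<Longrightarrow> rlinear (\<lambda>v. S' v - T' v)"
  by (auto simp: rlinear_def fun_eq_iff fun_ops_apply algebra_simps)

lemma rlinear_comp: "rlinear S \<Longrightarrow> rlinear T \<Longrightarrow> rlinear (\<lambda>v. S (T v))"
  by (simp add: rlinear_def)

lemma rlinear_columns:
  fixes c :: "'x \<Rightarrow> 'y \<Rightarrow> 'r::comm_ring_1"
  shows "rlinear (\<lambda>v. \<Sum>x\<in>X. scl (v x) (c x))"
  by (rule rlinearI)
    (auto simp: fun_eq_iff fun_ops_apply algebra_simps sum.distrib sum_distrib_left)

text \<open>Free modules are projective.\<close>

lemma rlinear_lift:
  fixes T :: "('x \<Rightarrow> 'r::comm_ring_1) \<Rightarrow> 'z \<Rightarrow> 'r" and D :: "('y \<Rightarrow> 'r) \<Rightarrow> 'z \<Rightarrow> 'r"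
  assumes "finite X" "rlinear T" "rlinear D" and im: "\<And>v. v \<in> fvec X \<Longrightarrow> T v \<in> D ` fvec Y"
  obtains S where "rlinear S" "\<And>v. S v \<in> fvec Y" "\<And>v. v \<in> fvec X \<Longrightarrow> D (S v) = T v"
proof -
  have "\<forall>x\<in>X. \<exists>c. c \<in> fvec Y \<and> D c = T (unit_vec x)"
    using im unit_vec_in_fvec by fastforce
  then obtain c where c: "\<And>x. x \<in> X \<Longrightarrow> c x \<in> fvec Y" "\<And>x. x \<in> X \<Longrightarrow> D (c x) = T (unit_vec x)"
    by metis
  let ?S = "\<lambda>v. \<Sum>x\<in>X. scl (v x) (c x)"
  have "D (?S v) = T v" if "v \<in> fvec X" for v
  proof -
    have "D (?S v) = (\<Sum>x\<in>X. scl (v x) (D (c x)))"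
      by (simp add: rlinear_sum[OF assms(3)] rlinear_scl[OF assms(3)])
    also have "\<dots> = T v"
      by (simp add: c rlinear_expand[OF assms(2,1) that])
    finally show ?thesis .
  qed
  moreover have "?S v \<in> fvec Y" for v
    by (intro fvec_sum fvec_scl c(1))
  ultimately show ?thesis
    by (intro that[OF rlinear_columns[of c X]])
qed

text \<open>A resolution of a module \<open>N\<close> by free modules \<open>R\<^sup>X\<close> of finite rank. The ring acts on
  the values of the augmentation through \<open>act\<close>, and \<open>d i\<close> goes from degree \<open>i + 1\<close> to degree \<open>i\<close>.\<close>

locale resolution =
  fixes act :: "'r::comm_ring_1 \<Rightarrow> 'n::ab_group_add \<Rightarrow> 'n"
    and X :: "nat \<Rightarrow> 'x set"
    and d :: "nat \<Rightarrow> ('x \<Rightarrow> 'r) \<Rightarrow> 'x \<Rightarrow> 'r"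
    and \<epsilon> :: "('x \<Rightarrow> 'r) \<Rightarrow> 'n"
  assumes finite_X [simp]: "finite (X i)"
    and d_linear: "rlinear (d i)"
    and d_in: "v \<in> fvec (X (Suc i)) \<Longrightarrow> d i v \<in> fvec (X i)"
    and aug_add: "\<epsilon> (v + w) = \<epsilon> v + \<epsilon> w"
    and aug_scl: "\<epsilon> (scl r v) = act r (\<epsilon> v)"
    and aug_surj: "\<exists>v\<in>fvec (X 0). \<epsilon> v = c"
    and exact_0: "v \<in> fvec (X 0) \<Longrightarrow> \<epsilon> v = 0 \<longleftrightarrow> v \<in> d 0 ` fvec (X 1)"
    and exact_Suc: "v \<in> fvec (X (Suc i)) \<Longrightarrow> d i v = 0 \<longleftrightarrow> v \<in> d (Suc i) ` fvec (X (Suc (Suc i)))"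
begin

lemma aug_0: "\<epsilon> 0 = 0"
  using aug_add[of 0 0] by simp

lemma aug_diff: "\<epsilon> (v - w) = \<epsilon> v - \<epsilon> w"
  using aug_add[of "v - w" w] by (simp add: algebra_simps)

lemma aug_sum: "\<epsilon> (\<Sum>x\<in>A. f x) = (\<Sum>x\<in>A. \<epsilon> (f x))"
  by (induction A rule: infinite_finite_induct) (auto simp: aug_0 aug_add)

lemma d_d: "v \<in> fvec (X (Suc (Suc i))) \<Longrightarrow> d i (d (Suc i) v) = 0"
  using exact_Suc[OF d_in, of v i] by simp

text \<open>Cycles and boundaries of the complex tensored with an ideal \<open>J\<close>: chains with entries in \<open>J\<close>.\<close>

definition cycles :: "'r set \<Rightarrow> nat \<Rightarrow> ('x \<Rightarrow> 'r) set" where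
  "cycles J i = {v \<in> fvec (X i). range v \<subseteq> J \<and> (\<forall>j. i = Suc j \<longrightarrow> d j v = 0)}"

definition boundaries :: "'r set \<Rightarrow> nat \<Rightarrow> ('x \<Rightarrow> 'r) set" where
  "boundaries J i = d i ` {v \<in> fvec (X (Suc i)). range v \<subseteq> J}"

end

text \<open>Ideals of a ring that is given as a type.\<close>

definition is_ideal :: "'r::comm_ring_1 set \<Rightarrow> bool" where
  "is_ideal J \<longleftrightarrow> 0 \<in> J \<and> (\<forall>a\<in>J. \<forall>b\<in>J. a + b \<in> J) \<and> (\<forall>r. \<forall>a\<in>J. r * a \<in> J)"

lemma is_ideal_sum: "is_ideal J \<Longrightarrow> (\<And>x. x \<in> A \<Longrightarrow> f x \<in> J) \<Longrightarrow> (\<Sum>x\<in>A. f x) \<in> J"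
  by (induction A rule: infinite_finite_induct) (auto simp: is_ideal_def)

lemma is_ideal_minus: "is_ideal J \<Longrightarrow> a \<in> J \<Longrightarrow> b \<in> J \<Longrightarrow> a - b \<in> J"
proof -
  assume J: "is_ideal J" "a \<in> J" "b \<in> J"
  then have "a + (- 1) * b \<in> J" unfolding is_ideal_def by blast
  then show ?thesis by simp
qed

text \<open>A linear map has a matrix with entries in the ring, so it preserves the vectors with entries in an
  ideal.\<close>

lemma rlinear_ideal:
  assumes "rlinear T" "finite X" "is_ideal J" "v \<in> fvec X" "range v \<subseteq> J"
  shows "range (T v) \<subseteq> J"
proof -
  have "T v y \<in> J" for y
    unfolding rlinear_expand[OF assms(1,2,4)] sum_fun_apply scl_apply
  proof (rule is_ideal_sum[OF assms(3)])
    fix x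
    have "v x \<in> J" using assms(5) by auto
    then show "v x * T (unit_vec x) y \<in> J"
      using assms(3) by (metis is_ideal_def mult.commute)
  qed
  then show ?thesis by auto
qed

locale resolution_pair = G: resolution act X d \<epsilon> + F: resolution act Y d' \<epsilon>'
  for act :: "'r::comm_ring_1 \<Rightarrow> 'n::ab_group_add \<Rightarrow> 'n"
    and X :: "nat \<Rightarrow> 'x set" and d \<epsilon>
    and Y :: "nat \<Rightarrow> 'y set" and d' \<epsilon>'
begin

text \<open>A chain map that lifts the identity of the resolved module, built degree by degree.\<close>

lemma chain_map_exists:
  obtains f where "\<And>i. rlinear (f i)" "\<And>i v. f i v \<in> fvec (Y i)"
    "\<And>i v. v \<in> fvec (X (Suc i)) \<Longrightarrow> f i (d i v) = d' i (f (Suc i) v)"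
    "\<And>v. v \<in> fvec (X 0) \<Longrightarrow> \<epsilon>' (f 0 v) = \<epsilon> v"
proof -
  define P where "P i f \<longleftrightarrow> rlinear f \<and> (\<forall>v. f v \<in> fvec (Y i)) \<and>
      (\<forall>v \<in> fvec (X (Suc i)). f (d i v) \<in> d' i ` fvec (Y (Suc i))) \<and>
      (i = 0 \<longrightarrow> (\<forall>v\<in>fvec (X 0). \<epsilon>' (f v) = \<epsilon> v))" for i and f :: "('x \<Rightarrow> 'r) \<Rightarrow> 'y \<Rightarrow> 'r"
  define Q where "Q i f f' \<longleftrightarrow> (\<forall>v \<in> fvec (X (Suc i)). f (d i v) = d' i (f' v))"
    for i and f f' :: "('x \<Rightarrow> 'r) \<Rightarrow> 'y \<Rightarrow> 'r"
  have "\<exists>f. \<forall>i. P i (f i) \<and> Q i (f i) (f (Suc i))"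
  proof (rule dependent_nat_choice)
    have "\<forall>x. \<exists>c. c \<in> fvec (Y 0) \<and> \<epsilon>' c = \<epsilon> (unit_vec x)"
      using F.aug_surj by blast
    then obtain c where c: "\<And>x. c x \<in> fvec (Y 0)" "\<And>x. \<epsilon>' (c x) = \<epsilon> (unit_vec x)"
      by metis
    let ?f = "\<lambda>v. \<Sum>x\<in>X 0. scl (v x) (c x)"
    have f: "?f v \<in> fvec (Y 0)" for v
      by (intro fvec_sum fvec_scl c)
    have aug: "\<epsilon>' (?f v) = \<epsilon> v" if "v \<in> fvec (X 0)" for v
    proof -
      have "\<epsilon>' (?f v) = \<epsilon> (\<Sum>x\<in>X 0. scl (v x) (unit_vec x))"
        by (simp add: F.aug_sum G.aug_sum F.aug_scl G.aug_scl c)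
      also have "\<dots> = \<epsilon> v"
        using fvec_expand[OF G.finite_X that] by simp
      finally show ?thesis .
    qed
    have "?f (d 0 v) \<in> d' 0 ` fvec (Y (Suc 0))" if "v \<in> fvec (X (Suc 0))" for v
    proof -
      have dv: "d 0 v \<in> fvec (X 0)" by (rule G.d_in[OF that])
      have "\<epsilon> (d 0 v) = 0" using G.exact_0[OF dv] that by auto
      then show ?thesis using F.exact_0[OF f] aug[OF dv] by simp
    qed
    then show "\<exists>f. P 0 f"
      unfolding P_def using f aug rlinear_columns[of c "X 0"] by (intro exI[of _ ?f]) simp
  next
    fix f i assume Pf: "P i f"
    then have f: "rlinear f" "\<And>v. f v \<in> fvec (Y i)" by (auto simp: P_def)
    have "rlinear (\<lambda>v. f (d i v))" by (rule rlinear_comp[OF f(1) G.d_linear])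
    then obtain f' where f': "rlinear f'" "\<And>v. f' v \<in> fvec (Y (Suc i))"
      "\<And>v. v \<in> fvec (X (Suc i)) \<Longrightarrow> d' i (f' v) = f (d i v)"
      using rlinear_lift[of "X (Suc i)" "\<lambda>v. f (d i v)" "d' i" "Y (Suc i)"] Pf F.d_linear
      unfolding P_def by (metis G.finite_X)
    have "f' (d (Suc i) v) \<in> d' (Suc i) ` fvec (Y (Suc (Suc i)))"
      if "v \<in> fvec (X (Suc (Suc i)))" for v
      using that f' by (simp add: G.d_d G.d_in rlinear_0[OF f(1)] flip: F.exact_Suc)
    then show "\<exists>f'. P (Suc i) f' \<and> Q i f f'"
      unfolding P_def Q_def using f' by (intro exI[of _ f']) auto
  qed
  then obtain f where "\<And>i. P i (f i)" "\<And>i. Q i (f i) (f (Suc i))" by blast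
  then show ?thesis
    by (intro that[of f]) (auto simp: P_def Q_def)
qed

text \<open>A chain map that lifts zero is null-homotopic.\<close>

lemma chain_homotopy_exists:
  assumes u: "\<And>i. rlinear (u i)" "\<And>i v. v \<in> fvec (X i) \<Longrightarrow> u i v \<in> fvec (Y i)"
    and ud: "\<And>i v. v \<in> fvec (X (Suc i)) \<Longrightarrow> u i (d i v) = d' i (u (Suc i) v)"
    and u0: "\<And>v. v \<in> fvec (X 0) \<Longrightarrow> \<epsilon>' (u 0 v) = 0"
  obtains s where "\<And>i. rlinear (s i)" "\<And>i v. s i v \<in> fvec (Y (Suc i))"
    "\<And>v. v \<in> fvec (X 0) \<Longrightarrow> u 0 v = d' 0 (s 0 v)"
    "\<And>i v. v \<in> fvec (X (Suc i)) \<Longrightarrow> u (Suc i) v = d' (Suc i) (s (Suc i) v) + s i (d i v)"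
proof -
  define P where "P i s \<longleftrightarrow> rlinear s \<and> (\<forall>v. s v \<in> fvec (Y (Suc i))) \<and>
      (\<forall>v \<in> fvec (X (Suc i)). d' i (s (d i v)) = u i (d i v)) \<and>
      (i = 0 \<longrightarrow> (\<forall>v\<in>fvec (X 0). u 0 v = d' 0 (s v)))" for i and s :: "('x \<Rightarrow> 'r) \<Rightarrow> 'y \<Rightarrow> 'r"
  define Q where "Q i s s' \<longleftrightarrow> (\<forall>v \<in> fvec (X (Suc i)). u (Suc i) v = d' (Suc i) (s' v) + s (d i v))"
    for i and s s' :: "('x \<Rightarrow> 'r) \<Rightarrow> 'y \<Rightarrow> 'r"
  have "\<exists>s. \<forall>i. P i (s i) \<and> Q i (s i) (s (Suc i))"
  proof (rule dependent_nat_choice)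
    have im: "u 0 v \<in> d' 0 ` fvec (Y (Suc 0))" if "v \<in> fvec (X 0)" for v
      using F.exact_0[OF u(2)[OF that]] u0[OF that] by simp
    obtain s where "rlinear s" "\<And>v. s v \<in> fvec (Y (Suc 0))"
      "\<And>v. v \<in> fvec (X 0) \<Longrightarrow> d' 0 (s v) = u 0 v"
      by (rule rlinear_lift[OF G.finite_X u(1) F.d_linear im]) blast+
    then show "\<exists>s. P 0 s"
      unfolding P_def using G.d_in by (intro exI[of _ s]) simp
  next
    fix s i assume Ps: "P i s"
    then have s: "rlinear s" "\<And>v. s v \<in> fvec (Y (Suc i))" by (auto simp: P_def)
    let ?T = "\<lambda>v. u (Suc i) v - s (d i v)"
    have T: "rlinear ?T" by (rule rlinear_minus[OF u(1) rlinear_comp[OF s(1) G.d_linear]])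
    have "?T v \<in> d' (Suc i) ` fvec (Y (Suc (Suc i)))" if v: "v \<in> fvec (X (Suc i))" for v
    proof -
      have "?T v \<in> fvec (Y (Suc i))" by (intro fvec_diff u s v)
      moreover have "d' i (?T v) = 0"
        using Ps v by (simp add: rlinear_diff[OF F.d_linear] P_def ud)
      ultimately show ?thesis using F.exact_Suc by blast
    qed
    then obtain s' where s': "rlinear s'" "\<And>v. s' v \<in> fvec (Y (Suc (Suc i)))"
      "\<And>v. v \<in> fvec (X (Suc i)) \<Longrightarrow> d' (Suc i) (s' v) = ?T v"
      by (rule rlinear_lift[OF G.finite_X T F.d_linear]) blast+
    have "d' (Suc i) (s' (d (Suc i) v)) = u (Suc i) (d (Suc i) v)"
      if "v \<in> fvec (X (Suc (Suc i)))" for v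
      using s'(3)[OF G.d_in[OF that]] by (simp add: G.d_d that rlinear_0[OF s(1)])
    then show "\<exists>s'. P (Suc i) s' \<and> Q i s s'"
      unfolding P_def Q_def using s' by (intro exI[of _ s']) simp
  qed
  then obtain s where "\<And>i. P i (s i)" "\<And>i. Q i (s i) (s (Suc i))" by blast
  then show ?thesis
    by (intro that[of s]) (simp_all add: P_def Q_def)
qed

end

context resolution begin

text \<open>A chain endomorphism that lifts the identity acts on the homology with entries in \<open>J\<close> as the
  identity.\<close>

lemma endomorphism_homology:
  assumes J: "is_ideal J" and z: "z \<in> cycles J i"
    and h: "\<And>i. rlinear (h i)" "\<And>i v. v \<in> fvec (X i) \<Longrightarrow> h i v \<in> fvec (X i)"
    and hd: "\<And>i v. v \<in> fvec (X (Suc i)) \<Longrightarrow> h i (d i v) = d i (h (Suc i) v)"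
    and h0: "\<And>v. v \<in> fvec (X 0) \<Longrightarrow> \<epsilon> (h 0 v) = \<epsilon> v"
  shows "z - h i z \<in> boundaries J i"
proof -
  interpret resolution_pair act X d \<epsilon> X d \<epsilon> ..
  obtain s where s: "\<And>i. rlinear (s i)" "\<And>i v. s i v \<in> fvec (X (Suc i))"
    and s0: "\<And>v. v \<in> fvec (X 0) \<Longrightarrow> v - h 0 v = d 0 (s 0 v)"
    and sS: "\<And>i v. v \<in> fvec (X (Suc i)) \<Longrightarrow> v - h (Suc i) v = d (Suc i) (s (Suc i) v) + s i (d i v)"
  proof (rule chain_homotopy_exists[of "\<lambda>i v. v - h i v"])
    show "rlinear (\<lambda>v. v - h i v)" for i by (rule rlinear_minus[OF rlinear_id h(1)])
    show "v - h i v \<in> fvec (X i)" if "v \<in> fvec (X i)" for i v using that by (intro fvec_diff h)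
    show "d i v - h i (d i v) = d i (v - h (Suc i) v)" if "v \<in> fvec (X (Suc i))" for i v
      using that by (simp add: hd rlinear_diff[OF d_linear])
    show "\<epsilon> (v - h 0 v) = 0" if "v \<in> fvec (X 0)" for v
      using that by (simp add: aug_diff h0)
  qed auto
  have zX: "z \<in> fvec (X i)" and zJ: "range z \<subseteq> J" using z by (auto simp: cycles_def)
  have "z - h i z = d i (s i z)"
  proof (cases i)
    case 0
    then show ?thesis using s0 zX by simp
  next
    case (Suc j)
    then show ?thesis using sS[of z j] z by (simp add: cycles_def rlinear_0[OF s(1)])
  qed
  then show ?thesis
    unfolding boundaries_def using s(2) rlinear_ideal[OF s(1) finite_X J zX zJ] by blast
qed

end

text \<open>Submodules of the functions with pointwise operations; over a field, subspaces.\<close>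

definition is_submodule :: "('x \<Rightarrow> 'r::comm_ring_1) set \<Rightarrow> bool" where
  "is_submodule U \<longleftrightarrow> 0 \<in> U \<and> (\<forall>v\<in>U. \<forall>w\<in>U. v + w \<in> U) \<and> (\<forall>r. \<forall>v\<in>U. scl r v \<in> U)"

lemma scl_add_left: "scl (a + b) v = scl a v + scl b v"
  and scl_add_right: "scl a (v + w) = scl a v + scl a w"
  and scl_scl: "scl a (scl b v) = scl (a * b) v"
  and scl_one: "scl 1 v = v"
  and scl_zero: "scl a 0 = 0"
  for a b :: "'r::comm_ring_1"
  by (simp_all add: fun_eq_iff fun_ops_apply algebra_simps)

lemma is_submodule_uminus: "is_submodule U \<Longrightarrow> v \<in> U \<Longrightarrow> - v \<in> U"
proof -
  assume "is_submodule U" "v \<in> U"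
  then have "scl (- 1) v \<in> U" unfolding is_submodule_def by blast
  then show ?thesis by (simp add: scl_def fun_Compl_def)
qed

lemma is_submodule_diff: "is_submodule U \<Longrightarrow> v \<in> U \<Longrightarrow> w \<in> U \<Longrightarrow> v - w \<in> U"
proof -
  assume U: "is_submodule U" "v \<in> U" "w \<in> U"
  then have "v + - w \<in> U" using is_submodule_uminus[OF U(1,3)] unfolding is_submodule_def by blast
  then show ?thesis by simp
qed

lemma is_submodule_sum: "is_submodule U \<Longrightarrow> (\<And>x. x \<in> A \<Longrightarrow> f x \<in> U) \<Longrightarrow> (\<Sum>x\<in>A. f x) \<in> U"
  by (induction A rule: infinite_finite_induct) (auto simp: is_submodule_def)

lemma is_submodule_image: "rlinear T \<Longrightarrow> is_submodule U \<Longrightarrow> is_submodule (T ` U)"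
  unfolding is_submodule_def
  by (auto simp: image_iff rlinear_0 simp flip: rlinear_add rlinear_scl)
    (metis rlinear_0)

lemma is_submodule_ideal_vecs: "is_ideal J \<Longrightarrow> is_submodule {v \<in> fvec X. range v \<subseteq> J}"
  by (auto simp: is_submodule_def is_ideal_def fvec_add fvec_scl fun_ops_apply image_subset_iff)

lemma is_submodule_fvec: "is_submodule (fvec X)"
  by (simp add: is_submodule_def fvec_add fvec_scl)

lemma is_submodule_kernel: "rlinear T \<Longrightarrow> is_submodule U \<Longrightarrow> is_submodule {v \<in> U. T v = 0}"
  by (simp add: is_submodule_def rlinear_0 rlinear_add rlinear_scl scl_zero)

context resolution begin

lemma is_submodule_cycles:
  assumes "is_ideal J"
  shows "is_submodule (cycles J i)"
proof (cases i)
  case 0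
  have "cycles J i = {v \<in> fvec (X i). range v \<subseteq> J}" by (auto simp: cycles_def 0)
  then show ?thesis using is_submodule_ideal_vecs[OF assms] by simp
next
  case (Suc j)
  have "cycles J i = {v \<in> {v \<in> fvec (X i). range v \<subseteq> J}. d j v = 0}" by (auto simp: cycles_def Suc)
  then show ?thesis
    using is_submodule_kernel[OF d_linear is_submodule_ideal_vecs[OF assms]] by simp
qed

lemma is_submodule_boundaries: "is_ideal J \<Longrightarrow> is_submodule (boundaries J i)"
  unfolding boundaries_def by (rule is_submodule_image[OF d_linear is_submodule_ideal_vecs])

lemma boundaries_subset_cycles:
  assumes "is_ideal J"
  shows "boundaries J i \<subseteq> cycles J i"
proof
  fix b assume "b \<in> boundaries J i"
  then obtain v where v: "v \<in> fvec (X (Suc i))" "range v \<subseteq> J" "b = d i v"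
    unfolding boundaries_def by blast
  have "range b \<subseteq> J"
    unfolding v(3) by (rule rlinear_ideal[OF d_linear finite_X assms v(1,2)])
  moreover have "d j b = 0" if "i = Suc j" for j
    using d_d v that by simp
  ultimately show "b \<in> cycles J i"
    using v d_in by (simp add: cycles_def)
qed

end

context resolution_pair begin

lemma chain_map_cycles:
  assumes J: "is_ideal J" and f: "\<And>i. rlinear (f i)" "\<And>i v. f i v \<in> fvec (Y i)"
    and fd: "\<And>i v. v \<in> fvec (X (Suc i)) \<Longrightarrow> f i (d i v) = d' i (f (Suc i) v)"
    and z: "z \<in> G.cycles J i"
  shows "f i z \<in> F.cycles J i"
proof -
  have z: "z \<in> fvec (X i)" "range z \<subseteq> J" "\<And>j. i = Suc j \<Longrightarrow> d j z = 0"
    using z by (auto simp: G.cycles_def)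
  have "d' j (f i z) = 0" if j: "i = Suc j" for j
  proof -
    have "d' j (f (Suc j) z) = f j (d j z)"
      by (rule fd[symmetric]) (use z(1) j in simp)
    then show ?thesis
      unfolding j z(3)[OF j] rlinear_0[OF f(1)] .
  qed
  then show ?thesis
    unfolding F.cycles_def using f(2) rlinear_ideal[OF f(1)[of i] G.finite_X J z(1,2)] by blast
qed

lemma chain_map_boundaries:
  assumes J: "is_ideal J" and f: "\<And>i. rlinear (f i)" "\<And>i v. f i v \<in> fvec (Y i)"
    and fd: "\<And>i v. v \<in> fvec (X (Suc i)) \<Longrightarrow> f i (d i v) = d' i (f (Suc i) v)"
    and b: "b \<in> G.boundaries J i"
  shows "f i b \<in> F.boundaries J i"
proof -
  obtain v where v: "v \<in> fvec (X (Suc i))" "range v \<subseteq> J" "b = d i v"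
    using b unfolding G.boundaries_def by blast
  have "f i b = d' i (f (Suc i) v)"
    unfolding v(3) by (rule fd[OF v(1)])
  moreover have "range (f (Suc i) v) \<subseteq> J"
    by (rule rlinear_ideal[OF f(1) G.finite_X J v(1,2)])
  ultimately show ?thesis
    unfolding F.boundaries_def using f(2) by blast
qed

text \<open>The homology with entries in \<open>J\<close> does not depend on the resolution: the chain map \<open>\<theta>\<close>
  induces an isomorphism.\<close>

lemma homology_comparison:
  assumes J: "is_ideal J"
  obtains \<theta> where "rlinear \<theta>"
    "\<And>z. z \<in> G.cycles J i \<Longrightarrow> \<theta> z \<in> F.cycles J i"
    "\<And>z. z \<in> G.cycles J i \<Longrightarrow> \<theta> z \<in> F.boundaries J i \<longleftrightarrow> z \<in> G.boundaries J i"
    "\<And>y. y \<in> F.cycles J i \<Longrightarrow> \<exists>z \<in> G.cycles J i. y - \<theta> z \<in> F.boundaries J i"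
proof -
  interpret rev: resolution_pair act Y d' \<epsilon>' X d \<epsilon> ..
  obtain f where f: "\<And>i. rlinear (f i)" "\<And>i v. f i v \<in> fvec (Y i)"
    and fd: "\<And>i v. v \<in> fvec (X (Suc i)) \<Longrightarrow> f i (d i v) = d' i (f (Suc i) v)"
    and f0: "\<And>v. v \<in> fvec (X 0) \<Longrightarrow> \<epsilon>' (f 0 v) = \<epsilon> v"
    using chain_map_exists by blast
  obtain g where g: "\<And>i. rlinear (g i)" "\<And>i v. g i v \<in> fvec (X i)"
    and gd: "\<And>i v. v \<in> fvec (Y (Suc i)) \<Longrightarrow> g i (d' i v) = d i (g (Suc i) v)"
    and g0: "\<And>v. v \<in> fvec (Y 0) \<Longrightarrow> \<epsilon> (g 0 v) = \<epsilon>' v"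
    using rev.chain_map_exists by blast
  have fc: "f i z \<in> F.cycles J i" if "z \<in> G.cycles J i" for z
    by (rule chain_map_cycles[OF J f fd that])
  have fb: "f i b \<in> F.boundaries J i" if "b \<in> G.boundaries J i" for b
    by (rule chain_map_boundaries[OF J f fd that])
  have gc: "g i z \<in> G.cycles J i" if "z \<in> F.cycles J i" for z
    by (rule rev.chain_map_cycles[OF J g gd that])
  have gb: "g i b \<in> G.boundaries J i" if "b \<in> F.boundaries J i" for b
    by (rule rev.chain_map_boundaries[OF J g gd that])
  have gf: "z - g i (f i z) \<in> G.boundaries J i" if "z \<in> G.cycles J i" for z
    by (rule G.endomorphism_homology[OF J that, where h = "\<lambda>i v. g i (f i v)"])
      (simp_all add: rlinear_comp[OF g(1) f(1)] f(2) g(2) fd gd f0 g0)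
  have fg: "z - f i (g i z) \<in> F.boundaries J i" if "z \<in> F.cycles J i" for z
    by (rule F.endomorphism_homology[OF J that, where h = "\<lambda>i v. f i (g i v)"])
      (simp_all add: rlinear_comp[OF f(1) g(1)] f(2) g(2) fd gd f0 g0)
  have "z \<in> G.boundaries J i" if "z \<in> G.cycles J i" "f i z \<in> F.boundaries J i" for z
  proof -
    have "(z - g i (f i z)) + g i (f i z) \<in> G.boundaries J i"
      using G.is_submodule_boundaries[OF J, of i] gf[OF that(1)] gb[OF that(2)]
      unfolding is_submodule_def by blast
    then show ?thesis by simp
  qed
  then have eq: "f i z \<in> F.boundaries J i \<longleftrightarrow> z \<in> G.boundaries J i" if "z \<in> G.cycles J i" for z
    using that fb by blast
  show ?thesis
  proof (rule that[OF f(1) fc eq])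
    show "\<exists>z\<in>G.cycles J i. y - f i z \<in> F.boundaries J i" if "y \<in> F.cycles J i" for y
      using gc[OF that] fg[OF that] by blast
  qed
qed

end

section \<open>The polynomial ring in eight variables\<close>

text \<open>Polynomials over a type of coefficients, with the variables indexed by the vertices of the
  triangulation. This is a type in order to have the ring operations and finite sums of the type
  classes; it is related to the record of polynomials over an isomorphic coefficient field below.\<close>

typedef (overloaded) 'f kpoly =
  "{p :: nat multiset \<Rightarrow> 'f::zero. finite {m. p m \<noteq> 0} \<and> (\<forall>m. p m \<noteq> 0 \<longrightarrow> set_mset m \<subseteq> klein_vertices)}"
  morphisms kcoeff Abs_kpoly
  by (rule exI[of _ "\<lambda>_. 0"]) simp

setup_lifting type_definition_kpoly

lemma kpoly_eqI: "(\<And>m. kcoeff p m = kcoeff q m) \<Longrightarrow> p = q"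
  by (simp add: fun_eq_iff flip: kcoeff_inject)

lemma kcoeff_finite: "finite {m. kcoeff p m \<noteq> 0}"
  and kcoeff_vars: "kcoeff p m \<noteq> 0 \<Longrightarrow> set_mset m \<subseteq> klein_vertices"
  using kcoeff[of p] by auto

lemma finite_submultisets [simp]: "finite {a. a \<subseteq># m}"
proof (induction m)
  case (add x m)
  have "{a. a \<subseteq># add_mset x m} \<subseteq> {a. a \<subseteq># m} \<union> add_mset x ` {a. a \<subseteq># m}"
  proof
    fix a assume "a \<in> {a. a \<subseteq># add_mset x m}"
    then have a: "a \<subseteq># add_mset x m" by simp
    show "a \<in> {a. a \<subseteq># m} \<union> add_mset x ` {a. a \<subseteq># m}"
    proof (cases "x \<in># a")
      case True
      then have "a = add_mset x (a - {#x#})" "a - {#x#} \<subseteq># m"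
        using a by (simp_all add: subset_eq_diff_conv)
      then show ?thesis by blast
    next
      case False
      then have "count a y \<le> count m y" for y
        using mset_subset_eq_count[OF a, of y]
        by (cases "y = x") (auto simp: not_in_iff)
      then show ?thesis by (simp add: subseteq_mset_def)
    qed
  qed
  then show ?case using add finite_subset by blast
qed simp

lemma diff_diff_submultiset: "a \<subseteq># m \<Longrightarrow> m - (m - a) = a"
  by (rule multiset_eqI) (simp add: subseteq_mset_def)

lemma diff_mono_mset: "a \<subseteq># m \<Longrightarrow> a - b \<subseteq># m - b"
  by (simp add: subseteq_mset_def diff_le_mono)

lemma add_submultiset:
  assumes "b \<subseteq># m" "c \<subseteq># m - b"
  shows "b + c \<subseteq># m"
  unfolding subseteq_mset_def
proof
  fix x
  show "count (b + c) x \<le> count m x"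
    using mset_subset_eq_count[OF assms(1), of x] mset_subset_eq_count[OF assms(2), of x] by simp
qed

lemma diff_diff_submultiset2: "b \<subseteq># a \<Longrightarrow> m - b - (a - b) = m - a"
  by (rule multiset_eqI) (simp add: subseteq_mset_def)

instantiation kpoly :: (comm_ring_1) comm_ring_1
begin

lift_definition zero_kpoly :: "'a kpoly" is "\<lambda>_. 0" by simp

lift_definition one_kpoly :: "'a kpoly" is "\<lambda>m. if m = {#} then 1 else 0" by simp

lift_definition plus_kpoly :: "'a kpoly \<Rightarrow> 'a kpoly \<Rightarrow> 'a kpoly" is "\<lambda>p q m. p m + q m"
proof -
  fix p q :: "nat multiset \<Rightarrow> 'a"
  assume pq: "finite {m. p m \<noteq> 0} \<and> (\<forall>m. p m \<noteq> 0 \<longrightarrow> set_mset m \<subseteq> klein_vertices)"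
    "finite {m. q m \<noteq> 0} \<and> (\<forall>m. q m \<noteq> 0 \<longrightarrow> set_mset m \<subseteq> klein_vertices)"
  have "{m. p m + q m \<noteq> 0} \<subseteq> {m. p m \<noteq> 0} \<union> {m. q m \<noteq> 0}" by auto
  then have "finite {m. p m + q m \<noteq> 0}"
    by (rule finite_subset) (use pq in simp)
  moreover have "set_mset m \<subseteq> klein_vertices" if "p m + q m \<noteq> 0" for m
    using pq that by (cases "p m = 0") simp_all
  ultimately show "finite {m. p m + q m \<noteq> 0} \<and>
      (\<forall>m. p m + q m \<noteq> 0 \<longrightarrow> set_mset m \<subseteq> klein_vertices)" by simp
qed

lift_definition uminus_kpoly :: "'a kpoly \<Rightarrow> 'a kpoly" is "\<lambda>p m. - p m" by simp

definition minus_kpoly :: "'a kpoly \<Rightarrow> 'a kpoly \<Rightarrow> 'a kpoly" where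
  "minus_kpoly p q = p + - q"

lift_definition times_kpoly :: "'a kpoly \<Rightarrow> 'a kpoly \<Rightarrow> 'a kpoly" is
  "\<lambda>p q m. \<Sum>a\<in>{a. a \<subseteq># m}. p a * q (m - a)"
proof -
  fix p q :: "nat multiset \<Rightarrow> 'a"
  assume p: "finite {m. p m \<noteq> 0} \<and> (\<forall>m. p m \<noteq> 0 \<longrightarrow> set_mset m \<subseteq> klein_vertices)"
    and q: "finite {m. q m \<noteq> 0} \<and> (\<forall>m. q m \<noteq> 0 \<longrightarrow> set_mset m \<subseteq> klein_vertices)"
  let ?r = "\<lambda>m. \<Sum>a\<in>{a. a \<subseteq># m}. p a * q (m - a)"
  have *: "\<exists>a b. p a \<noteq> 0 \<and> q b \<noteq> 0 \<and> m = a + b" if r: "?r m \<noteq> 0" for m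
  proof -
    have "\<exists>a\<in>{a. a \<subseteq># m}. p a * q (m - a) \<noteq> 0"
    proof (rule ccontr)
      assume "\<not> ?thesis"
      then have "?r m = 0" by (intro sum.neutral) auto
      with r show False by simp
    qed
    then obtain a where "a \<subseteq># m" "p a * q (m - a) \<noteq> 0" by auto
    then show ?thesis
      by (intro exI[of _ a] exI[of _ "m - a"]) auto
  qed
  then have "{m. ?r m \<noteq> 0} \<subseteq> (\<lambda>(a, b). a + b) ` ({m. p m \<noteq> 0} \<times> {m. q m \<noteq> 0})"
    by force
  then have "finite {m. ?r m \<noteq> 0}"
    by (rule finite_subset) (use p q in simp)
  moreover have "set_mset m \<subseteq> klein_vertices" if "?r m \<noteq> 0" for m
    using *[OF that] p q by fastforce
  ultimately show "finite {m. ?r m \<noteq> 0} \<and> (\<forall>m. ?r m \<noteq> 0 \<longrightarrow> set_mset m \<subseteq> klein_vertices)"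
    by simp
qed

instance
proof
  fix p q r :: "'a kpoly"
  show "p + q + r = p + (q + r)" by transfer (simp add: add.assoc)
  show "p + q = q + p" by transfer (simp add: add.commute)
  show "0 + p = p" by transfer simp
  show "- p + p = 0" by transfer simp
  show "p - q = p + - q" by (rule minus_kpoly_def)
  show "(p + q) * r = p * r + q * r"
    by transfer (simp add: algebra_simps sum.distrib)
  show "p * q = q * p"
  proof (transfer, rule ext)
    fix p q :: "nat multiset \<Rightarrow> 'a" and m
    show "(\<Sum>a\<in>{a. a \<subseteq># m}. p a * q (m - a)) = (\<Sum>a\<in>{a. a \<subseteq># m}. q a * p (m - a))"
      by (rule sum.reindex_bij_witness[of _ "\<lambda>a. m - a" "\<lambda>a. m - a"])
        (auto simp: mult.commute diff_diff_submultiset)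
  qed
  show "p * q * r = p * (q * r)"
  proof (transfer, rule ext)
    fix p q r :: "nat multiset \<Rightarrow> 'a" and m
    have "(\<Sum>a\<in>{a. a \<subseteq># m}. (\<Sum>b\<in>{b. b \<subseteq># a}. p b * q (a - b)) * r (m - a)) =
        (\<Sum>(a, b)\<in>Sigma {a. a \<subseteq># m} (\<lambda>a. {b. b \<subseteq># a}). p b * q (a - b) * r (m - a))"
      by (simp add: sum_distrib_right sum.Sigma)
    also have "\<dots> = (\<Sum>(b, c)\<in>Sigma {b. b \<subseteq># m} (\<lambda>b. {c. c \<subseteq># m - b}). p b * (q c * r (m - b - c)))"
      by (rule sum.reindex_bij_witness[of _ "\<lambda>(b, c). (b + c, b)" "\<lambda>(a, b). (b, a - b)"])
        (auto simp: mult.assoc diff_mono_mset add_submultiset diff_diff_submultiset2)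
    also have "\<dots> = (\<Sum>b\<in>{b. b \<subseteq># m}. p b * (\<Sum>c\<in>{c. c \<subseteq># m - b}. q c * r (m - b - c)))"
      by (simp add: sum_distrib_left sum.Sigma)
    finally show "(\<Sum>a\<in>{a. a \<subseteq># m}. (\<Sum>b\<in>{b. b \<subseteq># a}. p b * q (a - b)) * r (m - a)) =
      (\<Sum>b\<in>{b. b \<subseteq># m}. p b * (\<Sum>c\<in>{c. c \<subseteq># m - b}. q c * r (m - b - c)))" .
  qed
  show "1 * p = p"
  proof (transfer, rule ext)
    fix p :: "nat multiset \<Rightarrow> 'a" and m
    show "(\<Sum>a\<in>{a. a \<subseteq># m}. (if a = {#} then 1 else 0) * p (m - a)) = p m"
      by (simp add: if_distrib[of "\<lambda>t. t * _"] cong: if_cong)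
  qed
  show "(0 :: 'a kpoly) \<noteq> 1"
    by transfer (auto simp: fun_eq_iff)
qed

end

text \<open>The polynomial with the single term \<open>c\<close> times \<open>m\<close>, if \<open>m\<close> is a monomial in the given
  variables, and 0 otherwise.\<close>

lift_definition kterm :: "'f::zero \<Rightarrow> nat multiset \<Rightarrow> 'f kpoly" is
  "\<lambda>c m m'. if m' = m \<and> set_mset m \<subseteq> klein_vertices then c else 0"
  by auto

lemma kcoeff_add [simp]: "kcoeff (p + q) m = kcoeff p m + kcoeff q m"
  by transfer simp

lemma kcoeff_0 [simp]: "kcoeff 0 m = 0"
  by transfer simp

lemma kcoeff_uminus [simp]: "kcoeff (- p) m = - kcoeff p m"
  by transfer simp

lemma kcoeff_diff [simp]: "kcoeff (p - q) m = kcoeff p m - kcoeff q m"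
  unfolding minus_kpoly_def kcoeff_add kcoeff_uminus by simp

lemma kcoeff_1: "kcoeff 1 m = (if m = {#} then 1 else 0)"
  by transfer simp

lemma kcoeff_mult: "kcoeff (p * q) m = (\<Sum>a\<in>{a. a \<subseteq># m}. kcoeff p a * kcoeff q (m - a))"
  by transfer simp

lemma kcoeff_term: "kcoeff (kterm c m) m' = (if m' = m \<and> set_mset m \<subseteq> klein_vertices then c else 0)"
  by transfer simp

lemma kcoeff_sum: "kcoeff (\<Sum>x\<in>A. f x) m = (\<Sum>x\<in>A. kcoeff (f x) m)"
  by (induction A rule: infinite_finite_induct) auto

lemma kcoeff_term_mult:
  fixes p :: "'f::comm_ring_1 kpoly"
  assumes "set_mset m \<subseteq> klein_vertices"
  shows "kcoeff (kterm c m * p) m' = (if m \<subseteq># m' then c * kcoeff p (m' - m) else 0)"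
proof -
  have "kcoeff (kterm c m * p) m' =
      (\<Sum>a\<in>{a. a \<subseteq># m'}. if a = m then c * kcoeff p (m' - m) else 0)"
    unfolding kcoeff_mult by (rule sum.cong) (use assms in \<open>simp_all add: kcoeff_term\<close>)
  then show ?thesis by simp
qed

lemma kcoeff_const_mult:
  fixes p :: "'f::comm_ring_1 kpoly"
  shows "kcoeff (kterm c {#} * p) m = c * kcoeff p m"
  by (simp add: kcoeff_term_mult)

lemma kcoeff_mult_0:
  fixes p :: "'f::comm_ring_1 kpoly"
  shows "kcoeff (p * q) {#} = kcoeff p {#} * kcoeff q {#}"
  by (simp add: kcoeff_mult)

lemma kpoly_expand:
  fixes p :: "'f::comm_ring_1 kpoly"
  shows "p = (\<Sum>m\<in>{m. kcoeff p m \<noteq> 0}. kterm (kcoeff p m) m)"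
proof (rule kpoly_eqI)
  fix m
  have "kcoeff (\<Sum>m\<in>{m. kcoeff p m \<noteq> 0}. kterm (kcoeff p m) m) m =
      (\<Sum>m'\<in>{m. kcoeff p m \<noteq> 0}. if m' = m then kcoeff p m else 0)"
    unfolding kcoeff_sum by (rule sum.cong) (simp_all add: kcoeff_term kcoeff_vars)
  also have "\<dots> = kcoeff p m"
    by (simp add: sum.delta[OF kcoeff_finite])
  finally show "kcoeff p m = kcoeff (\<Sum>m\<in>{m. kcoeff p m \<noteq> 0}. kterm (kcoeff p m) m) m" ..
qed

lemma kterm_mult:
  "set_mset m \<subseteq> klein_vertices \<Longrightarrow> set_mset m' \<subseteq> klein_vertices \<Longrightarrow>
    kterm c m * kterm c' m' = kterm (c * c' :: 'f::comm_ring_1) (m + m')"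
  by (rule kpoly_eqI) (auto simp: kcoeff_term_mult kcoeff_term)

text \<open>The polynomials whose monomials all lie in \<open>M\<close>; an ideal if \<open>M\<close> is closed under multiples.\<close>

definition monomial_span :: "nat multiset set \<Rightarrow> 'f::comm_ring_1 kpoly set" where
  "monomial_span M = {p. \<forall>m. kcoeff p m \<noteq> 0 \<longrightarrow> m \<in> M}"

definition multiples_closed :: "nat multiset set \<Rightarrow> bool" where
  "multiples_closed M \<longleftrightarrow> (\<forall>m\<in>M. \<forall>m'. m + m' \<in> M)"

lemma kcoeff_mult_nonzeroE:
  assumes "kcoeff (p * q) m \<noteq> 0"
  obtains a b where "m = a + b" "kcoeff p a \<noteq> 0" "kcoeff q b \<noteq> 0"
proof -
  have "\<exists>a\<in>{a. a \<subseteq># m}. kcoeff p a * kcoeff q (m - a) \<noteq> 0"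
  proof (rule ccontr)
    assume "\<not> ?thesis"
    then have "kcoeff (p * q) m = 0"
      unfolding kcoeff_mult by (intro sum.neutral) auto
    with assms show False by simp
  qed
  then obtain a where "a \<subseteq># m" "kcoeff p a * kcoeff q (m - a) \<noteq> 0" by auto
  then show ?thesis by (intro that[of a "m - a"]) auto
qed

lemma is_ideal_monomial_span:
  assumes "multiples_closed M"
  shows "is_ideal (monomial_span M)"
  unfolding is_ideal_def
proof (intro conjI ballI allI)
  show "0 \<in> monomial_span M" by (simp add: monomial_span_def)
  fix p q :: "'a kpoly"
  assume pq: "p \<in> monomial_span M" "q \<in> monomial_span M"
  have "kcoeff p m \<noteq> 0 \<or> kcoeff q m \<noteq> 0" if "kcoeff (p + q) m \<noteq> 0" for m
    using that by auto
  then show "p + q \<in> monomial_span M"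
    using pq unfolding monomial_span_def by blast
next
  fix r p :: "'a kpoly"
  assume p: "p \<in> monomial_span M"
  have "m \<in> M" if nz: "kcoeff (r * p) m \<noteq> 0" for m
  proof -
    obtain a b where "m = a + b" "kcoeff p b \<noteq> 0"
      by (rule kcoeff_mult_nonzeroE[OF nz])
    then have "b + a \<in> M"
      using p assms by (simp add: monomial_span_def multiples_closed_def)
    then show ?thesis using \<open>m = a + b\<close> by (simp add: add.commute)
  qed
  then show "r * p \<in> monomial_span M"
    by (simp add: monomial_span_def)
qed

text \<open>A set that is closed under addition contains the span of \<open>M\<close> as soon as it contains the terms.\<close>

lemma monomial_span_subset:
  assumes "0 \<in> J" "\<And>p q. p \<in> J \<Longrightarrow> q \<in> J \<Longrightarrow> p + q \<in> J"
    and terms: "\<And>c m. m \<in> M \<Longrightarrow> set_mset m \<subseteq> klein_vertices \<Longrightarrow> kterm c m \<in> J"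
  shows "monomial_span M \<subseteq> J"
proof
  fix p :: "'a kpoly" assume p: "p \<in> monomial_span M"
  have "(\<Sum>m\<in>A. kterm (kcoeff p m) m) \<in> J" if "A \<subseteq> {m. kcoeff p m \<noteq> 0}" for A
    using that
  proof (induction A rule: infinite_finite_induct)
    case (insert m A)
    then have "kterm (kcoeff p m) m \<in> J"
      using p kcoeff_vars by (intro terms) (auto simp: monomial_span_def)
    then show ?case using insert assms(2) by simp
  qed (use assms(1) in auto)
  from this[OF order_refl] show "p \<in> J"
    by (subst kpoly_expand)
qed

section \<open>The Koszul complex\<close>

text \<open>The sign with which the basis vector of \<open>insert j \<sigma>\<close> maps to that of \<open>\<sigma>\<close>.\<close>

definition ksign :: "nat \<Rightarrow> nat set \<Rightarrow> 'a::comm_ring_1" where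
  "ksign j \<sigma> = (- 1) ^ card {t \<in> \<sigma>. t < j}"

lemma ksign_cases: "(ksign j \<sigma> = (1::'a::comm_ring_1) \<and> ksign j \<sigma> = (1::'b::comm_ring_1)) \<or>
    (ksign j \<sigma> = (- 1::'a) \<and> ksign j \<sigma> = (- 1::'b))"
  by (cases "even (card {t \<in> \<sigma>. t < j})") (simp_all add: ksign_def)

lemma ksign_sq [simp]: "ksign j \<sigma> * ksign j \<sigma> = 1"
  by (simp add: ksign_def flip: power_mult_distrib)

lemma ksign_sq_left [simp]: "ksign j \<sigma> * (ksign j \<sigma> * x) = x"
  by (simp flip: mult.assoc)

lemma ksign_insert:
  assumes "finite \<sigma>" "j \<notin> \<sigma>"
  shows "ksign i (insert j \<sigma>) = (if j < i then - ksign i \<sigma> else ksign i \<sigma>)"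
proof -
  have "{t \<in> insert j \<sigma>. t < i} = (if j < i then insert j {t \<in> \<sigma>. t < i} else {t \<in> \<sigma>. t < i})"
    by auto
  then show ?thesis using assms by (simp add: ksign_def)
qed

lemma ksign_swap:
  assumes "finite \<sigma>" "i \<notin> \<sigma>" "j \<notin> \<sigma>" "i \<noteq> j"
  shows "ksign i \<sigma> * ksign j (insert i \<sigma>) = - (ksign j \<sigma> * ksign i (insert j \<sigma>))"
    and "ksign i (insert j \<sigma>) * ksign j (insert i \<sigma>) = - (ksign j \<sigma> * ksign i \<sigma>)"
  using assms by (cases "i < j"; simp add: ksign_insert mult.commute)+

text \<open>The basis of the \<open>i\<close>-th module of the Koszul complex.\<close>

definition klevel :: "nat \<Rightarrow> nat set set" where
  "klevel i = {\<sigma>. \<sigma> \<subseteq> klein_vertices \<and> card \<sigma> = i}"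

text \<open>The basis vector of \<open>\<tau>\<close> is sent to the signed sum over \<open>j \<in> \<tau>\<close> of the \<open>j\<close>-th variable
  times the basis vector of \<open>\<tau> - {j}\<close>. Written for the coordinate of \<open>\<sigma>\<close>, this is a sum over
  the \<open>j\<close> outside of \<open>\<sigma>\<close>; it is the same formula in all degrees of the complex.\<close>

definition koszul_d :: "(nat set \<Rightarrow> 'f::comm_ring_1 kpoly) \<Rightarrow> nat set \<Rightarrow> 'f kpoly" where
  "koszul_d v \<sigma> = (\<Sum>j\<in>klein_vertices - \<sigma>. ksign j \<sigma> * kterm 1 {#j#} * v (insert j \<sigma>))"

text \<open>The constant coefficient of the coordinate of the empty set.\<close>

definition koszul_aug :: "(nat set \<Rightarrow> 'f::comm_ring_1 kpoly) \<Rightarrow> 'f" where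
  "koszul_aug v = kcoeff (v {}) {#}"

lemma finite_klein_vertices [simp]: "finite klein_vertices"
  by (simp add: klein_vertices_def)

lemma finite_klevel [simp]: "finite (klevel i)"
  by (rule finite_subset[of _ "Pow klein_vertices"]) (auto simp: klevel_def)

lemma insert_in_klevel:
  assumes "j \<notin> \<sigma>" "insert j \<sigma> \<in> klevel (Suc i)"
  shows "\<sigma> \<in> klevel i"
proof -
  have "finite (insert j \<sigma>)"
    using assms(2) finite_subset[OF _ finite_klein_vertices] by (auto simp: klevel_def)
  then show ?thesis using assms by (simp add: klevel_def)
qed

lemma insert_notin_klevel_0: "insert j \<sigma> \<notin> klevel 0"
proof
  assume "insert j \<sigma> \<in> klevel 0"
  then have "insert j \<sigma> \<subseteq> klein_vertices" "card (insert j \<sigma>) = 0" by (auto simp: klevel_def)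
  then show False using finite_subset[OF _ finite_klein_vertices] by fastforce
qed

lemma rlinear_koszul_d: "rlinear koszul_d"
  by (rule rlinearI)
    (auto simp: fun_eq_iff koszul_d_def fun_ops_apply algebra_simps sum.distrib sum_distrib_left)

lemma koszul_d_in:
  assumes "v \<in> fvec (klevel (Suc i))"
  shows "koszul_d v \<in> fvec (klevel i)"
proof -
  have "koszul_d v \<sigma> = 0" if "\<sigma> \<notin> klevel i" for \<sigma>
    unfolding koszul_d_def
  proof (rule sum.neutral, rule ballI)
    fix j assume "j \<in> klein_vertices - \<sigma>"
    then have "insert j \<sigma> \<notin> klevel (Suc i)" using insert_in_klevel that by blast
    then show "ksign j \<sigma> * kterm 1 {#j#} * v (insert j \<sigma>) = 0"
      using fvecD[OF assms] by simp
  qed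
  then show ?thesis by (simp add: fvec_def)
qed

lemma sum_antisymmetric:
  fixes g :: "'i \<Rightarrow> 'i \<Rightarrow> 'a::ab_group_add"
  assumes "finite W" "\<And>j k. j \<in> W \<Longrightarrow> k \<in> W \<Longrightarrow> j \<noteq> k \<Longrightarrow> g j k = - g k j"
  shows "(\<Sum>j\<in>W. \<Sum>k\<in>W - {j}. g j k) = 0"
  using assms
proof (induction W rule: finite_induct)
  case (insert x W)
  have anti: "g j k = - g k j" if "j \<in> insert x W" "k \<in> insert x W" "j \<noteq> k" for j k
    by (rule insert.prems[OF that])
  have IH: "(\<Sum>j\<in>W. \<Sum>k\<in>W - {j}. g j k) = 0"
    by (rule insert.IH, rule anti) simp_all
  have 1: "(\<Sum>k\<in>insert x W - {j}. g j k) = g j x + (\<Sum>k\<in>W - {j}. g j k)" if "j \<in> W" for j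
  proof -
    have "insert x W - {j} = insert x (W - {j})" using that insert.hyps(2) by auto
    then show ?thesis using insert.hyps by simp
  qed
  have 2: "insert x W - {x} = W" using insert.hyps(2) by auto
  have "(\<Sum>j\<in>insert x W. \<Sum>k\<in>insert x W - {j}. g j k) =
      (\<Sum>k\<in>W. g x k) + (\<Sum>j\<in>W. g j x + (\<Sum>k\<in>W - {j}. g j k))"
    using insert.hyps 1 2 by simp
  also have "\<dots> = (\<Sum>k\<in>W. g x k) + (\<Sum>j\<in>W. g j x)"
    by (simp add: sum.distrib IH)
  also have "(\<Sum>j\<in>W. g j x) = (\<Sum>j\<in>W. - g x j)"
    by (rule sum.cong[OF refl], rule anti) (use insert.hyps(2) in auto)
  finally show ?case by (simp add: sum_negf)
qed simp

text \<open>The two ways of adding \<open>j\<close> and \<open>k\<close> have opposite signs. As this is also needed in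
  characteristic two, the terms are paired instead of showing that the sum is its own negative.\<close>

lemma koszul_d_d:
  assumes "finite \<sigma>"
  shows "koszul_d (koszul_d v) \<sigma> = 0"
proof -
  define g where "g j k = ksign j \<sigma> * kterm 1 {#j#} *
    (ksign k (insert j \<sigma>) * kterm 1 {#k#} * v (insert k (insert j \<sigma>)))" for j k
  have "g j k = - g k j"
    if "j \<in> klein_vertices - \<sigma>" "k \<in> klein_vertices - \<sigma>" "j \<noteq> k" for j k
  proof -
    let ?x = "kterm 1 {#j#} * kterm 1 {#k#} * v (insert j (insert k \<sigma>))"
    have "g j k = (ksign j \<sigma> * ksign k (insert j \<sigma>)) * ?x"
      by (simp add: g_def insert_commute algebra_simps)
    also have "ksign j \<sigma> * ksign k (insert j \<sigma>) = (- (ksign k \<sigma> * ksign j (insert k \<sigma>)) :: 'a kpoly)"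
      by (rule ksign_swap) (use that assms in auto)
    also have "\<dots> * ?x = - g k j"
      by (simp add: g_def algebra_simps)
    finally show ?thesis .
  qed
  then have "(\<Sum>j\<in>klein_vertices - \<sigma>. \<Sum>k\<in>klein_vertices - \<sigma> - {j}. g j k) = 0"
    by (rule sum_antisymmetric[rotated]) simp_all
  moreover have "klein_vertices - \<sigma> - {j} = klein_vertices - insert j \<sigma>" for j by auto
  ultimately show ?thesis
    by (simp add: koszul_d_def g_def sum_distrib_left)
qed

subsection \<open>The complex in terms of coefficients\<close>

text \<open>Coefficients of chains, indexed by a set \<open>\<sigma>\<close>, which stands for a basis vector, and a
  monomial.\<close>

type_synonym 'f kfun = "nat set \<times> nat multiset \<Rightarrow> 'f"

text \<open>A chain with polynomial entries is given by its coefficients, indexed by pairs of a set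
  \<open>\<sigma>\<close> and a monomial \<open>m\<close>. The differential preserves the exponent of each variable in the product
  of \<open>m\<close> and the variables in \<open>\<sigma>\<close>.\<close>

definition koszul_bd :: "'f::comm_ring_1 kfun \<Rightarrow> 'f kfun" where
  "koszul_bd c = (\<lambda>(\<sigma>, m). \<Sum>j\<in>klein_vertices - \<sigma>.
     if j \<in># m then ksign j \<sigma> * c (insert j \<sigma>, m - {#j#}) else 0)"

text \<open>The exponent of the \<open>j\<close>-th variable in the degree of the basis element \<open>(\<sigma>, m)\<close>.\<close>

definition kexp :: "nat set \<Rightarrow> nat multiset \<Rightarrow> nat \<Rightarrow> nat" where
  "kexp \<sigma> m j = count m j + (if j \<in> \<sigma> then 1 else 0)"

lemma kexp_insert: "j \<notin> \<sigma> \<Longrightarrow> j \<in># m \<Longrightarrow> kexp (insert j \<sigma>) (m - {#j#}) = kexp \<sigma> m"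
  by (auto simp: kexp_def fun_eq_iff)

text \<open>The passage between chains with polynomial entries and their coefficients.\<close>

definition kcoeffs :: "(nat set \<Rightarrow> 'f::comm_ring_1 kpoly) \<Rightarrow> 'f kfun" where
  "kcoeffs v = (\<lambda>(\<sigma>, m). kcoeff (v \<sigma>) m)"

definition of_kcoeffs :: "'f::comm_ring_1 kfun \<Rightarrow> nat set \<Rightarrow> 'f kpoly" where
  "of_kcoeffs c = (\<lambda>\<sigma>. Abs_kpoly (\<lambda>m. c (\<sigma>, m)))"

text \<open>The coefficients of the \<open>i\<close>-chains with entries in the span of \<open>M\<close>.\<close>

definition kchains :: "nat \<Rightarrow> nat multiset set \<Rightarrow> 'f::comm_ring_1 kfun set" where
  "kchains i M = {c. finite {x. c x \<noteq> 0} \<and>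
     (\<forall>\<sigma> m. c (\<sigma>, m) \<noteq> 0 \<longrightarrow> \<sigma> \<in> klevel i \<and> set_mset m \<subseteq> klein_vertices \<and> m \<in> M)}"

lemma rlinear_koszul_bd: "rlinear (koszul_bd :: 'f::comm_ring_1 kfun \<Rightarrow> _)"
  by (rule rlinearI)
    (auto simp: koszul_bd_def fun_eq_iff fun_ops_apply algebra_simps sum_distrib_left
      simp flip: sum.distrib intro!: sum.cong)

lemma kcoeff_ksign_mult: "kcoeff (ksign j \<sigma> * p) m = ksign j \<sigma> * kcoeff p m"
  for p :: "'f::comm_ring_1 kpoly"
  using ksign_cases[of j \<sigma>, where 'a = "'f kpoly" and 'b = 'f] by auto

lemma kcoeffs_koszul_d: "kcoeffs (koszul_d v) = koszul_bd (kcoeffs v)"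
proof (rule ext, clarify)
  fix \<sigma> m
  show "kcoeffs (koszul_d v) (\<sigma>, m) = koszul_bd (kcoeffs v) (\<sigma>, m)"
    by (auto simp: kcoeffs_def koszul_d_def koszul_bd_def kcoeff_sum mult.assoc kcoeff_ksign_mult
        kcoeff_term_mult intro!: sum.cong)
qed

lemma kcoeffs_inject: "kcoeffs v = kcoeffs w \<longleftrightarrow> v = w"
  by (auto simp: kcoeffs_def fun_eq_iff intro!: kpoly_eqI)

lemma kcoeffs_diff: "kcoeffs (v - w) = kcoeffs v - kcoeffs w"
  by (auto simp: kcoeffs_def fun_eq_iff fun_ops_apply)

lemma kcoeffs_add: "kcoeffs (v + w) = kcoeffs v + kcoeffs w"
  by (auto simp: kcoeffs_def fun_eq_iff fun_ops_apply)

lemma kcoeffs_0: "kcoeffs 0 = 0"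
  by (auto simp: kcoeffs_def fun_eq_iff fun_ops_apply)

lemma kcoeffs_in_kchains:
  assumes "v \<in> fvec (klevel i)" "range v \<subseteq> monomial_span M"
  shows "kcoeffs v \<in> kchains i M"
proof -
  have *: "\<sigma> \<in> klevel i \<and> set_mset m \<subseteq> klein_vertices \<and> m \<in> M" if "kcoeff (v \<sigma>) m \<noteq> 0" for \<sigma> m
  proof (intro conjI)
    show "\<sigma> \<in> klevel i" using that fvecD[OF assms(1), of \<sigma>] by force
    show "set_mset m \<subseteq> klein_vertices" by (rule kcoeff_vars[OF that])
    show "m \<in> M" using that assms(2) by (auto simp: monomial_span_def)
  qed
  have "{x. kcoeffs v x \<noteq> 0} \<subseteq> Sigma (klevel i) (\<lambda>\<sigma>. {m. kcoeff (v \<sigma>) m \<noteq> 0})"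
    using * by (auto simp: kcoeffs_def)
  moreover have "finite (Sigma (klevel i) (\<lambda>\<sigma>. {m. kcoeff (v \<sigma>) m \<noteq> 0}))"
    by (intro finite_SigmaI finite_klevel kcoeff_finite)
  ultimately have "finite {x. kcoeffs v x \<noteq> 0}" by (rule finite_subset)
  then show ?thesis using * by (simp add: kchains_def kcoeffs_def)
qed

lemma kcoeff_of_kcoeffs:
  assumes "c \<in> kchains i M"
  shows "kcoeff (of_kcoeffs c \<sigma>) m = c (\<sigma>, m)"
proof -
  have "(\<lambda>m. (\<sigma>, m)) ` {m. c (\<sigma>, m) \<noteq> 0} \<subseteq> {x. c x \<noteq> 0}" by auto
  then have "finite ((\<lambda>m. (\<sigma>, m)) ` {m. c (\<sigma>, m) \<noteq> 0})"
    by (rule finite_subset) (use assms in \<open>simp add: kchains_def\<close>)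
  then have "finite {m. c (\<sigma>, m) \<noteq> 0}"
    by (rule finite_imageD) (simp add: inj_on_def)
  then show ?thesis
    unfolding of_kcoeffs_def using assms by (subst Abs_kpoly_inverse) (auto simp: kchains_def)
qed

lemma kcoeffs_of_kcoeffs: "c \<in> kchains i M \<Longrightarrow> kcoeffs (of_kcoeffs c) = c"
  by (auto simp: kcoeffs_def kcoeff_of_kcoeffs)

lemma of_kcoeffs_in_fvec:
  assumes "c \<in> kchains i M"
  shows "of_kcoeffs c \<in> fvec (klevel i)" "range (of_kcoeffs c) \<subseteq> monomial_span M"
proof -
  have "of_kcoeffs c \<sigma> = 0" if "\<sigma> \<notin> klevel i" for \<sigma>
    using that assms by (intro kpoly_eqI) (auto simp: kcoeff_of_kcoeffs[OF assms] kchains_def)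
  then show "of_kcoeffs c \<in> fvec (klevel i)" by (simp add: fvec_def)
  show "range (of_kcoeffs c) \<subseteq> monomial_span M"
    using assms by (auto simp: monomial_span_def kcoeff_of_kcoeffs[OF assms] kchains_def)
qed

subsection \<open>A contraction in large degrees\<close>

text \<open>Dividing by the first variable whose exponent exceeds \<open>h\<close> contracts the part of the complex
  where such a variable exists. For \<open>h = 0\<close> this is the exactness of the Koszul complex; for a monomial
  ideal with generators of exponents at most \<open>h\<close> it confines the homology to exponents at
  most \<open>h\<close>.\<close>

definition koszul_homotopy ::
    "nat \<Rightarrow> 'f::comm_ring_1 kfun \<Rightarrow> 'f kfun" where
  "koszul_homotopy h c = (\<lambda>(\<sigma>, m). let j = (LEAST j. kexp \<sigma> m j > h) in
     if (\<exists>j. kexp \<sigma> m j > h) \<and> j \<in> \<sigma> then ksign j (\<sigma> - {j}) * c (\<sigma> - {j}, add_mset j m) else 0)"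

text \<open>Membership in \<open>M\<close> is not affected by the exponent of a variable beyond \<open>h\<close>.\<close>

definition exponents_bounded :: "nat \<Rightarrow> nat multiset set \<Rightarrow> bool" where
  "exponents_bounded h M \<longleftrightarrow> (\<forall>j m. add_mset j m \<in> M \<longrightarrow> count m j \<ge> h \<longrightarrow> m \<in> M)"

lemma koszul_homotopy_identity:
  assumes ex: "\<exists>j. kexp \<sigma> m j > h" and \<sigma>: "\<sigma> \<subseteq> klein_vertices" and m: "set_mset m \<subseteq> klein_vertices"
  shows "koszul_bd (koszul_homotopy h c) (\<sigma>, m) + koszul_homotopy h (koszul_bd c) (\<sigma>, m) = c (\<sigma>, m)"
proof -
  define j where "j = (LEAST j. kexp \<sigma> m j > h)"
  have j: "kexp \<sigma> m j > h" unfolding j_def by (rule LeastI_ex[OF ex])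
  have fin: "finite \<sigma>" by (rule finite_subset[OF \<sigma> finite_klein_vertices])
  have hom: "koszul_homotopy h c (insert i \<sigma>, m - {#i#}) =
      (if j \<in> insert i \<sigma> then ksign j (insert i \<sigma> - {j}) * c (insert i \<sigma> - {j}, add_mset j (m - {#i#})) else 0)"
    if "i \<in> klein_vertices - \<sigma>" "i \<in># m" for i
    using that ex by (simp add: koszul_homotopy_def kexp_insert j_def Let_def)
  show ?thesis
  proof (cases "j \<in> \<sigma>")
    case False
    then have "h < count m j" using j by (simp add: kexp_def)
    then have jm: "j \<in># m" by (intro count_inI) simp
    then have jV: "j \<in> klein_vertices - \<sigma>" using m False by auto
    \<comment> \<open>Only the summand \<open>i = j\<close> of the boundary of the homotopy is left.\<close>
    have "koszul_homotopy h (koszul_bd c) (\<sigma>, m) = 0"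
      using False by (simp add: koszul_homotopy_def flip: j_def)
    moreover have "koszul_bd (koszul_homotopy h c) (\<sigma>, m) =
        (\<Sum>i\<in>klein_vertices - \<sigma>. if i = j then c (\<sigma>, m) else 0)"
      unfolding koszul_bd_def split_conv
    proof (rule sum.cong[OF refl])
      fix i assume i: "i \<in> klein_vertices - \<sigma>"
      show "(if i \<in># m then ksign i \<sigma> * koszul_homotopy h c (insert i \<sigma>, m - {#i#}) else 0) =
          (if i = j then c (\<sigma>, m) else 0)"
        using False jm i hom[OF i] by auto
    qed
    ultimately show ?thesis using jV by simp
  next
    case True
    \<comment> \<open>The homotopy of the boundary has the summand \<open>i = j\<close>; the others cancel by the sign rule.\<close>
    define \<tau> where "\<tau> = \<sigma> - {j}"
    have \<tau>: "\<sigma> = insert j \<tau>" "j \<notin> \<tau>" "finite \<tau>" using True fin by (auto simp: \<tau>_def)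
    let ?g = "\<lambda>i. if i \<in># m then ksign j \<tau> * ksign i \<tau> * c (insert i \<tau>, add_mset j m - {#i#}) else 0"
    have V: "klein_vertices - \<tau> = insert j (klein_vertices - \<sigma>)" using \<tau> \<sigma> by auto
    have "koszul_homotopy h (koszul_bd c) (\<sigma>, m) = ksign j \<tau> * koszul_bd c (\<tau>, add_mset j m)"
      using True ex by (simp add: koszul_homotopy_def \<tau>_def flip: j_def)
    also have "koszul_bd c (\<tau>, add_mset j m) = ksign j \<tau> * c (\<sigma>, m) +
        (\<Sum>i\<in>klein_vertices - \<sigma>. if i \<in># m then ksign i \<tau> * c (insert i \<tau>, add_mset j m - {#i#}) else 0)"
    proof -
      have "(\<Sum>i\<in>klein_vertices - \<sigma>. if i \<in># add_mset j m then ksign i \<tau> * c (insert i \<tau>, add_mset j m - {#i#}) else 0) =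
        (\<Sum>i\<in>klein_vertices - \<sigma>. if i \<in># m then ksign i \<tau> * c (insert i \<tau>, add_mset j m - {#i#}) else 0)"
        by (rule sum.cong) (use \<tau> in auto)
      moreover have "j \<notin> klein_vertices - \<sigma>" using True by simp
      ultimately show ?thesis
        unfolding koszul_bd_def split_conv V by (simp flip: \<tau>(1))
    qed
    finally have 1: "koszul_homotopy h (koszul_bd c) (\<sigma>, m) = c (\<sigma>, m) +
        (\<Sum>i\<in>klein_vertices - \<sigma>. ksign j \<tau> *
          (if i \<in># m then ksign i \<tau> * c (insert i \<tau>, add_mset j m - {#i#}) else 0))"
      unfolding distrib_left ksign_sq_left sum_distrib_left .
    also have "(\<Sum>i\<in>klein_vertices - \<sigma>. ksign j \<tau> *
          (if i \<in># m then ksign i \<tau> * c (insert i \<tau>, add_mset j m - {#i#}) else 0)) =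
        (\<Sum>i\<in>klein_vertices - \<sigma>. ?g i)"
      by (rule sum.cong) (simp_all add: mult.assoc)
    finally have 1: "koszul_homotopy h (koszul_bd c) (\<sigma>, m) = c (\<sigma>, m) + (\<Sum>i\<in>klein_vertices - \<sigma>. ?g i)" .
    have 2: "koszul_bd (koszul_homotopy h c) (\<sigma>, m) = (\<Sum>i\<in>klein_vertices - \<sigma>. - ?g i)"
      unfolding koszul_bd_def split_conv
    proof (rule sum.cong[OF refl])
      fix i assume i: "i \<in> klein_vertices - \<sigma>"
      show "(if i \<in># m then ksign i \<sigma> * koszul_homotopy h c (insert i \<sigma>, m - {#i#}) else 0) = - ?g i"
      proof (cases "i \<in># m")
        case im: True
        have ij: "i \<noteq> j" "i \<notin> \<tau>" using i \<tau> by auto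
        have "insert i \<sigma> - {j} = insert i \<tau>" using \<tau> ij by auto
        moreover have "add_mset j (m - {#i#}) = add_mset j m - {#i#}" using im ij by simp
        ultimately have "koszul_homotopy h c (insert i \<sigma>, m - {#i#}) =
            ksign j (insert i \<tau>) * c (insert i \<tau>, add_mset j m - {#i#})"
          using hom[OF i im] True by simp
        then have "ksign i \<sigma> * koszul_homotopy h c (insert i \<sigma>, m - {#i#}) =
            (ksign i (insert j \<tau>) * ksign j (insert i \<tau>)) * c (insert i \<tau>, add_mset j m - {#i#})"
          by (simp add: \<tau>(1) mult.assoc)
        also have "\<dots> = - (ksign j \<tau> * ksign i \<tau> * c (insert i \<tau>, add_mset j m - {#i#}))"
          unfolding ksign_swap(2)[OF \<tau>(3) ij(2) \<tau>(2) ij(1)] mult_minus_left ..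
        finally show ?thesis using im by simp
      qed simp
    qed
    show ?thesis unfolding 1 2 by (simp add: sum_negf)
  qed
qed

lemma koszul_homotopy_in_kchains:
  assumes c: "c \<in> kchains i M" and M: "exponents_bounded h M"
  shows "koszul_homotopy h c \<in> kchains (Suc i) M"
proof -
  have *: "\<exists>j\<in>klein_vertices. \<exists>\<tau> m'. c (\<tau>, m') \<noteq> 0 \<and> \<sigma> = insert j \<tau> \<and> j \<notin> \<tau> \<and> m' = add_mset j m \<and> m \<in> M"
    if nz: "koszul_homotopy h c (\<sigma>, m) \<noteq> 0" for \<sigma> m
  proof -
    define j where "j = (LEAST j. kexp \<sigma> m j > h)"
    have j: "\<exists>j. kexp \<sigma> m j > h" "j \<in> \<sigma>" "c (\<sigma> - {j}, add_mset j m) \<noteq> 0"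
      using nz by (auto simp: koszul_homotopy_def Let_def j_def split: if_splits)
    have "kexp \<sigma> m j > h" unfolding j_def by (rule LeastI_ex[OF j(1)])
    then have "count m j \<ge> h" using j(2) by (simp add: kexp_def)
    moreover have "add_mset j m \<in> M" "set_mset (add_mset j m) \<subseteq> klein_vertices"
      using c j(3) unfolding kchains_def by blast+
    ultimately have "m \<in> M" "j \<in> klein_vertices" using M by (auto simp: exponents_bounded_def)
    then show ?thesis
      using j by (intro bexI[of _ j] exI[of _ "\<sigma> - {j}"] exI[of _ "add_mset j m"]) auto
  qed
  have "{x. koszul_homotopy h c x \<noteq> 0} \<subseteq>
      (\<lambda>(j, \<tau>, m'). (insert j \<tau>, m' - {#j#})) ` (klein_vertices \<times> {x. c x \<noteq> 0})"
  proof
    fix x assume "x \<in> {x. koszul_homotopy h c x \<noteq> 0}"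
    then obtain \<sigma> m where x: "x = (\<sigma>, m)" "koszul_homotopy h c (\<sigma>, m) \<noteq> 0" by (cases x) auto
    obtain j \<tau> m' where "j \<in> klein_vertices" "c (\<tau>, m') \<noteq> 0" "\<sigma> = insert j \<tau>" "m' = add_mset j m"
      using *[OF x(2)] by blast
    then show "x \<in> (\<lambda>(j, \<tau>, m'). (insert j \<tau>, m' - {#j#})) ` (klein_vertices \<times> {x. c x \<noteq> 0})"
      using x(1) by (intro image_eqI[of _ _ "(j, \<tau>, m')"]) auto
  qed
  moreover have "finite {x. c x \<noteq> 0}" using c by (simp add: kchains_def)
  ultimately have "finite {x. koszul_homotopy h c x \<noteq> 0}"
    by (elim finite_subset) simp
  moreover have "\<sigma> \<in> klevel (Suc i) \<and> set_mset m \<subseteq> klein_vertices \<and> m \<in> M"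
    if nz: "koszul_homotopy h c (\<sigma>, m) \<noteq> 0" for \<sigma> m
  proof -
    obtain j \<tau> m' where j: "j \<in> klein_vertices" "c (\<tau>, m') \<noteq> 0" "\<sigma> = insert j \<tau>" "j \<notin> \<tau>"
        "m' = add_mset j m" "m \<in> M"
      using *[OF nz] by blast
    then have \<tau>: "\<tau> \<in> klevel i" "set_mset m' \<subseteq> klein_vertices" using c unfolding kchains_def by blast+
    have "finite \<tau>" using \<tau>(1) finite_subset[OF _ finite_klein_vertices] by (auto simp: klevel_def)
    then show ?thesis using j \<tau> by (simp add: klevel_def)
  qed
  ultimately show ?thesis by (simp add: kchains_def)
qed

lemma koszul_contraction:
  assumes c: "c \<in> kchains i M" and M: "exponents_bounded h M"
    and large: "\<And>\<sigma> m. c (\<sigma>, m) \<noteq> 0 \<Longrightarrow> \<exists>j. kexp \<sigma> m j > h" and cycle: "koszul_bd c = 0"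
  shows "koszul_bd (koszul_homotopy h c) = c"
proof (rule ext, clarify)
  fix \<sigma> m
  show "koszul_bd (koszul_homotopy h c) (\<sigma>, m) = c (\<sigma>, m)"
  proof (cases "\<sigma> \<subseteq> klein_vertices \<and> set_mset m \<subseteq> klein_vertices \<and> (\<exists>j. kexp \<sigma> m j > h)")
    case True
    moreover have "koszul_homotopy h (koszul_bd c) (\<sigma>, m) = 0"
      unfolding cycle by (simp add: koszul_homotopy_def zero_fun_apply Let_def)
    ultimately show ?thesis
      using koszul_homotopy_identity[of h \<sigma> m c] by simp
  next
    case False
    then have c0: "c (\<sigma>, m) = 0" using large[of \<sigma> m] c by (auto simp: kchains_def klevel_def)
    have "koszul_homotopy h c (insert j \<sigma>, m - {#j#}) = 0"
      if j: "j \<in> klein_vertices - \<sigma>" "j \<in># m" for j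
    proof (rule ccontr)
      assume nz: "koszul_homotopy h c (insert j \<sigma>, m - {#j#}) \<noteq> 0"
      then have lev: "insert j \<sigma> \<in> klevel (Suc i)" and vars: "set_mset (m - {#j#}) \<subseteq> klein_vertices"
        using koszul_homotopy_in_kchains[OF c M] unfolding kchains_def by blast+
      have "set_mset m = insert j (set_mset (m - {#j#}))"
        using j(2) by (metis insert_DiffM set_mset_add_mset_insert)
      also have "\<dots> \<subseteq> klein_vertices" using vars j(1) by simp
      finally have "set_mset m \<subseteq> klein_vertices" .
      moreover have "\<sigma> \<subseteq> klein_vertices" using lev by (simp add: klevel_def)
      moreover have "\<exists>i. kexp (insert j \<sigma>) (m - {#j#}) i > h"
        by (rule ccontr) (use nz in \<open>simp add: koszul_homotopy_def Let_def\<close>)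
      then have "\<exists>i. kexp \<sigma> m i > h"
        using j by (simp add: kexp_insert)
      ultimately show False using False by blast
    qed
    then have "koszul_bd (koszul_homotopy h c) (\<sigma>, m) = 0"
      unfolding koszul_bd_def split_conv by (intro sum.neutral) simp
    then show ?thesis using c0 by simp
  qed
qed

subsection \<open>The Koszul complex as a resolution\<close>

lemma klevel_0: "klevel 0 = {{}}"
  using finite_subset[OF _ finite_klein_vertices] by (auto simp: klevel_def)

lemma range_subset_monomial_span_UNIV: "range v \<subseteq> monomial_span UNIV"
  by (simp add: monomial_span_def)

text \<open>The contraction in terms of chains with polynomial entries.\<close>

lemma koszul_boundaryI:
  fixes v :: "nat set \<Rightarrow> 'f::comm_ring_1 kpoly"
  assumes v: "v \<in> fvec (klevel i)" "range v \<subseteq> monomial_span M" and M: "exponents_bounded h M"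
    and large: "\<And>\<sigma> m. kcoeff (v \<sigma>) m \<noteq> 0 \<Longrightarrow> \<exists>j. kexp \<sigma> m j > h"
    and cycle: "koszul_bd (kcoeffs v) = 0"
  shows "\<exists>w\<in>fvec (klevel (Suc i)). range w \<subseteq> monomial_span M \<and> v = koszul_d w"
proof -
  let ?c = "koszul_homotopy h (kcoeffs v)"
  have c: "?c \<in> kchains (Suc i) M"
    by (rule koszul_homotopy_in_kchains[OF kcoeffs_in_kchains[OF v] M])
  have "koszul_bd ?c = kcoeffs v"
    by (rule koszul_contraction[OF kcoeffs_in_kchains[OF v] M _ cycle])
      (simp add: kcoeffs_def large)
  then have "kcoeffs (koszul_d (of_kcoeffs ?c)) = kcoeffs v"
    by (simp add: kcoeffs_koszul_d kcoeffs_of_kcoeffs[OF c])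
  then have "v = koszul_d (of_kcoeffs ?c)" by (simp add: kcoeffs_inject)
  then show ?thesis using of_kcoeffs_in_fvec[OF c] by blast
qed

lemma exponents_bounded_UNIV: "exponents_bounded h UNIV"
  by (simp add: exponents_bounded_def)

lemma koszul_bd_level_0:
  assumes "v \<in> fvec (klevel 0)"
  shows "koszul_bd (kcoeffs v) = 0"
proof (rule ext, clarify)
  fix \<sigma> m
  have "v (insert j \<sigma>) = 0" for j
    by (rule fvecD[OF assms insert_notin_klevel_0])
  then show "koszul_bd (kcoeffs v) (\<sigma>, m) = 0 (\<sigma>, m)"
    by (simp add: koszul_bd_def kcoeffs_def zero_fun_apply cong: if_cong)
qed

lemma koszul_aug_d: "koszul_aug (koszul_d w) = 0"
proof -
  have "koszul_aug (koszul_d w) = kcoeffs (koszul_d w) ({}, {#})"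
    by (simp add: koszul_aug_def kcoeffs_def)
  also have "\<dots> = 0"
    by (simp only: kcoeffs_koszul_d) (simp add: koszul_bd_def)
  finally show ?thesis .
qed

interpretation koszul: resolution "\<lambda>(r :: 'f::comm_ring_1 kpoly) c. kcoeff r {#} * c" klevel
  "\<lambda>_. koszul_d" koszul_aug
proof
  fix v w :: "nat set \<Rightarrow> 'f kpoly" and r :: "'f kpoly" and c :: 'f and i :: nat
  show "finite (klevel i)" by simp
  show "rlinear (koszul_d :: (nat set \<Rightarrow> 'f kpoly) \<Rightarrow> nat set \<Rightarrow> 'f kpoly)" by (rule rlinear_koszul_d)
  show "koszul_d v \<in> fvec (klevel i)" if "v \<in> fvec (klevel (Suc i))"
    by (rule koszul_d_in[OF that])
  show "koszul_aug (v + w) = koszul_aug v + koszul_aug w"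
    by (simp add: koszul_aug_def plus_fun_apply)
  show "koszul_aug (scl r v) = kcoeff r {#} * koszul_aug v"
    by (simp add: koszul_aug_def scl_apply kcoeff_mult_0)
  show "\<exists>v\<in>fvec (klevel 0). koszul_aug v = c"
    by (rule bexI[of _ "\<lambda>\<sigma>. if \<sigma> = {} then kterm c {#} else 0"])
      (simp_all add: koszul_aug_def kcoeff_term fvec_def klevel_0)
  show "koszul_aug v = 0 \<longleftrightarrow> v \<in> koszul_d ` fvec (klevel 1)" if v: "v \<in> fvec (klevel 0)"
  proof
    assume aug: "koszul_aug v = 0"
    have "\<exists>j. kexp \<sigma> m j > 0" if nz: "kcoeff (v \<sigma>) m \<noteq> 0" for \<sigma> m
    proof -
      have "\<sigma> = {}" using nz fvecD[OF v, of \<sigma>] by (cases "\<sigma> = {}") (simp_all add: klevel_0)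
      then have "m \<noteq> {#}" using nz aug by (auto simp: koszul_aug_def)
      then obtain j where "j \<in># m" by blast
      then have "kexp \<sigma> m j > 0" by (simp add: kexp_def)
      then show ?thesis ..
    qed
    from koszul_boundaryI[OF v range_subset_monomial_span_UNIV exponents_bounded_UNIV this
        koszul_bd_level_0[OF v]]
    show "v \<in> koszul_d ` fvec (klevel 1)" by auto
  qed (auto simp: koszul_aug_d)
  show "koszul_d v = 0 \<longleftrightarrow> v \<in> koszul_d ` fvec (klevel (Suc (Suc i)))"
    if v: "v \<in> fvec (klevel (Suc i))"
  proof
    assume d: "koszul_d v = 0"
    have "\<exists>j. kexp \<sigma> m j > 0" if nz: "kcoeff (v \<sigma>) m \<noteq> 0" for \<sigma> m
    proof -
      have "\<sigma> \<in> klevel (Suc i)" using nz fvecD[OF v, of \<sigma>] by force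
      then have "\<sigma> \<noteq> {}" by (auto simp: klevel_def)
      then obtain j where "j \<in> \<sigma>" by blast
      then have "kexp \<sigma> m j > 0" by (simp add: kexp_def)
      then show ?thesis ..
    qed
    moreover have "koszul_bd (kcoeffs v) = 0"
      by (simp add: d kcoeffs_0 flip: kcoeffs_koszul_d)
    ultimately show "v \<in> koszul_d ` fvec (klevel (Suc (Suc i)))"
      using koszul_boundaryI[OF v range_subset_monomial_span_UNIV exponents_bounded_UNIV, of 0] by auto
  next
    assume "v \<in> koszul_d ` fvec (klevel (Suc (Suc i)))"
    then obtain w where w: "w \<in> fvec (klevel (Suc (Suc i)))" "v = koszul_d w" by blast
    show "koszul_d v = 0"
    proof (rule ext)
      fix \<sigma>
      show "koszul_d v \<sigma> = 0 \<sigma>"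
      proof (cases "\<sigma> \<in> klevel i")
        case True
        then have "finite \<sigma>" using finite_subset[OF _ finite_klein_vertices] by (auto simp: klevel_def)
        then show ?thesis by (simp add: w(2) koszul_d_d zero_fun_apply)
      next
        case False
        then show ?thesis using fvecD[OF koszul_d_in[OF v] False] by (simp add: zero_fun_apply)
      qed
    qed
  qed
qed

subsection \<open>Restriction to bounded exponents\<close>

text \<open>The basis elements \<open>(\<sigma>, m)\<close> with \<open>m \<in> M\<close> whose degree has exponents at most \<open>h\<close>, and the
  projection of the chains to their span.\<close>

definition koszul_basis :: "nat \<Rightarrow> nat multiset set \<Rightarrow> nat \<Rightarrow> (nat set \<times> nat multiset) set" where
  "koszul_basis h M i = {(\<sigma>, m). \<sigma> \<in> klevel i \<and> set_mset m \<subseteq> klein_vertices \<and> m \<in> M \<and>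
     (\<forall>j. kexp \<sigma> m j \<le> h)}"

definition koszul_truncate ::
    "nat \<Rightarrow> 'f::zero kfun \<Rightarrow> 'f kfun" where
  "koszul_truncate h c = (\<lambda>(\<sigma>, m). if \<forall>j. kexp \<sigma> m j \<le> h then c (\<sigma>, m) else 0)"

lemma finite_koszul_basis [simp]: "finite (koszul_basis h M i)"
proof -
  let ?B = "\<lambda>f. \<Sum>j\<in>klein_vertices. replicate_mset (f j) j"
  have "m \<in> ?B ` (klein_vertices \<rightarrow>\<^sub>E {..h})"
    if m: "set_mset m \<subseteq> klein_vertices" "\<And>j. count m j \<le> h" for m
  proof (rule image_eqI[of _ _ "restrict (count m) klein_vertices"])
    have "m = (\<Sum>j\<in>klein_vertices. replicate_mset (count m j) j)"
    proof (rule multiset_eqI)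
      fix x
      have "count (\<Sum>j\<in>klein_vertices. replicate_mset (count m j) j) x =
          (\<Sum>j\<in>klein_vertices. if j = x then count m x else 0)"
        unfolding count_sum by (rule sum.cong) auto
      then show "count m x = count (\<Sum>j\<in>klein_vertices. replicate_mset (count m j) j) x"
        using m(1) by (auto simp: not_in_iff[symmetric])
    qed
    then show "m = ?B (restrict (count m) klein_vertices)" by simp
    show "restrict (count m) klein_vertices \<in> klein_vertices \<rightarrow>\<^sub>E {..h}" using m(2) by auto
  qed
  moreover have "count m j \<le> h" if "\<forall>j. kexp \<sigma> m j \<le> h" for \<sigma> m j
    using spec[OF that, of j] by (simp add: kexp_def split: if_splits)
  ultimately have "koszul_basis h M i \<subseteq> klevel i \<times> ?B ` (klein_vertices \<rightarrow>\<^sub>E {..h})"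
    unfolding koszul_basis_def by blast
  moreover have "finite (klevel i \<times> ?B ` (klein_vertices \<rightarrow>\<^sub>E {..h}))"
    by (intro finite_cartesian_product finite_imageI finite_PiE) simp_all
  ultimately show ?thesis by (rule finite_subset)
qed

lemma koszul_bd_truncate: "koszul_bd (koszul_truncate h c) = koszul_truncate h (koszul_bd c)"
proof (rule ext, clarify)
  fix \<sigma> m
  show "koszul_bd (koszul_truncate h c) (\<sigma>, m) = koszul_truncate h (koszul_bd c) (\<sigma>, m)"
    by (auto simp: koszul_bd_def koszul_truncate_def kexp_insert intro!: sum.neutral sum.cong)
qed

lemma koszul_truncate_in_fvec: "c \<in> kchains i M \<Longrightarrow> koszul_truncate h c \<in> fvec (koszul_basis h M i)"
  unfolding fvec_def koszul_basis_def koszul_truncate_def kchains_def by auto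

lemma koszul_truncate_id: "c \<in> fvec (koszul_basis h M i) \<Longrightarrow> koszul_truncate h c = c"
  by (auto simp: fvec_def koszul_basis_def koszul_truncate_def fun_eq_iff)

lemma fvec_koszul_basis_kchains:
  assumes "c \<in> fvec (koszul_basis h M i)"
  shows "c \<in> kchains i M"
proof -
  have *: "x \<in> koszul_basis h M i" if "c x \<noteq> 0" for x using fvecD[OF assms] that by blast
  then have "{x. c x \<noteq> 0} \<subseteq> koszul_basis h M i" by blast
  then have "finite {x. c x \<noteq> 0}" by (rule finite_subset) simp
  moreover have "\<sigma> \<in> klevel i \<and> set_mset m \<subseteq> klein_vertices \<and> m \<in> M" if "c (\<sigma>, m) \<noteq> 0" for \<sigma> m
    using *[OF that] by (simp add: koszul_basis_def)
  ultimately show ?thesis by (simp add: kchains_def)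
qed

lemma koszul_cycleI:
  assumes "c \<in> fvec (koszul_basis h M i)" "koszul_bd c = 0"
  shows "of_kcoeffs c \<in> koszul.cycles (monomial_span M) i"
proof -
  have c: "c \<in> kchains i M" by (rule fvec_koszul_basis_kchains[OF assms(1)])
  have "kcoeffs (koszul_d (of_kcoeffs c)) = kcoeffs 0"
    by (simp add: kcoeffs_koszul_d kcoeffs_of_kcoeffs[OF c] assms(2) kcoeffs_0)
  then have "koszul_d (of_kcoeffs c) = 0" by (simp only: kcoeffs_inject)
  then show ?thesis using of_kcoeffs_in_fvec[OF c] by (simp add: koszul.cycles_def)
qed

text \<open>Every class has a representative with bounded exponents.\<close>

lemma koszul_cycle_representative:
  assumes M: "exponents_bounded h M" and z: "z \<in> koszul.cycles (monomial_span M) i"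
  shows "\<exists>c\<in>fvec (koszul_basis h M i). koszul_bd c = 0 \<and>
    z - of_kcoeffs c \<in> koszul.boundaries (monomial_span M) i"
proof -
  have zf: "z \<in> fvec (klevel i)" "range z \<subseteq> monomial_span M" using z by (auto simp: koszul.cycles_def)
  have bd: "koszul_bd (kcoeffs z) = 0"
  proof (cases i)
    case 0
    then show ?thesis using koszul_bd_level_0 zf by blast
  next
    case (Suc j)
    then have "koszul_d z = 0" using z by (simp add: koszul.cycles_def)
    then show ?thesis by (simp add: kcoeffs_0 flip: kcoeffs_koszul_d)
  qed
  let ?c = "koszul_truncate h (kcoeffs z)"
  have c: "?c \<in> fvec (koszul_basis h M i)"
    by (rule koszul_truncate_in_fvec[OF kcoeffs_in_kchains[OF zf]])
  have ck: "?c \<in> kchains i M" by (rule fvec_koszul_basis_kchains[OF c])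
  have cbd: "koszul_bd ?c = 0"
    unfolding koszul_bd_truncate bd by (auto simp: koszul_truncate_def zero_fun_apply)
  let ?y = "z - of_kcoeffs ?c"
  have y: "?y \<in> fvec (klevel i)" by (rule fvec_diff[OF zf(1) of_kcoeffs_in_fvec(1)[OF ck]])
  have co: "kcoeff (?y \<sigma>) m = (if \<forall>j. kexp \<sigma> m j \<le> h then 0 else kcoeff (z \<sigma>) m)" for \<sigma> m
    unfolding minus_apply kcoeff_diff kcoeff_of_kcoeffs[OF ck]
    by (simp add: koszul_truncate_def kcoeffs_def)
  have zM: "m \<in> M" if "kcoeff (z \<sigma>) m \<noteq> 0" for \<sigma> m
    using that zf(2) by (auto simp: monomial_span_def)
  have large: "m \<in> M \<and> (\<exists>j. kexp \<sigma> m j > h)" if "kcoeff (?y \<sigma>) m \<noteq> 0" for \<sigma> m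
    using that[unfolded co] zM by (auto simp: not_le split: if_splits)
  then have "range ?y \<subseteq> monomial_span M"
    unfolding monomial_span_def by blast
  moreover have "\<exists>j. kexp \<sigma> m j > h" if "kcoeff (?y \<sigma>) m \<noteq> 0" for \<sigma> m
    using large[OF that] ..
  moreover have "koszul_bd (kcoeffs ?y) = 0"
  proof -
    have "kcoeffs (koszul_d ?y) = kcoeffs (koszul_d z) - kcoeffs (koszul_d (of_kcoeffs ?c))"
      by (simp add: rlinear_diff[OF rlinear_koszul_d] kcoeffs_diff)
    then show ?thesis by (simp add: kcoeffs_koszul_d bd kcoeffs_of_kcoeffs[OF ck] cbd)
  qed
  ultimately have "\<exists>w\<in>fvec (klevel (Suc i)). range w \<subseteq> monomial_span M \<and> ?y = koszul_d w"
    by (intro koszul_boundaryI[OF y _ M])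
  then have "?y \<in> koszul.boundaries (monomial_span M) i"
    unfolding koszul.boundaries_def by blast
  then show ?thesis using c cbd by blast
qed

text \<open>A bounded cycle is a boundary if and only if it is the boundary of a bounded chain.\<close>

lemma koszul_boundary_iff:
  assumes c: "c \<in> fvec (koszul_basis h M i)"
  shows "of_kcoeffs c \<in> koszul.boundaries (monomial_span M) i \<longleftrightarrow>
    c \<in> koszul_bd ` fvec (koszul_basis h M (Suc i))"
proof
  have ck: "c \<in> kchains i M" by (rule fvec_koszul_basis_kchains[OF c])
  {
    assume "of_kcoeffs c \<in> koszul.boundaries (monomial_span M) i"
    then obtain w where w: "w \<in> fvec (klevel (Suc i))" "range w \<subseteq> monomial_span M"
      and eq: "of_kcoeffs c = koszul_d w"
      unfolding koszul.boundaries_def by blast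
    have "c = kcoeffs (koszul_d w)" by (simp add: kcoeffs_of_kcoeffs[OF ck] flip: eq)
    then have "c = koszul_truncate h (koszul_bd (kcoeffs w))"
      using koszul_truncate_id[OF c] by (simp add: kcoeffs_koszul_d)
    then have "c = koszul_bd (koszul_truncate h (kcoeffs w))" by (simp add: koszul_bd_truncate)
    then show "c \<in> koszul_bd ` fvec (koszul_basis h M (Suc i))"
      using koszul_truncate_in_fvec[OF kcoeffs_in_kchains[OF w]] by blast
  }
  assume "c \<in> koszul_bd ` fvec (koszul_basis h M (Suc i))"
  then obtain b where b: "b \<in> fvec (koszul_basis h M (Suc i))" "c = koszul_bd b" by blast
  have bk: "b \<in> kchains (Suc i) M" by (rule fvec_koszul_basis_kchains[OF b(1)])
  have "kcoeffs (of_kcoeffs c) = kcoeffs (koszul_d (of_kcoeffs b))"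
    unfolding kcoeffs_koszul_d kcoeffs_of_kcoeffs[OF bk] kcoeffs_of_kcoeffs[OF ck] by (rule b(2))
  then have "of_kcoeffs c = koszul_d (of_kcoeffs b)" by (simp only: kcoeffs_inject)
  then show "of_kcoeffs c \<in> koszul.boundaries (monomial_span M) i"
    unfolding koszul.boundaries_def using of_kcoeffs_in_fvec[OF bk] by blast
qed

section \<open>Rings, fields and modules as records\<close>

text \<open>An additive group given as a record whose carrier is the image of a subgroup \<open>J\<close> of a type
  under an additive map \<open>e\<close>, which need not be injective.\<close>

locale encoded_group =
  fixes G :: "('g, 'b) ring_scheme" and e :: "'x::ab_group_add \<Rightarrow> 'g" and J :: "'x set"
  assumes carrier_eq: "carrier G = e ` J"
    and zero_in: "0 \<in> J"
    and add_in: "x \<in> J \<Longrightarrow> y \<in> J \<Longrightarrow> x + y \<in> J"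
    and uminus_in: "x \<in> J \<Longrightarrow> - x \<in> J"
    and zero_eq: "\<zero>\<^bsub>G\<^esub> = e 0"
    and add_eq: "x \<in> J \<Longrightarrow> y \<in> J \<Longrightarrow> e x \<oplus>\<^bsub>G\<^esub> e y = e (x + y)"
begin

lemma abelian_group: "abelian_group G"
proof (rule abelian_groupI)
  show "x \<oplus>\<^bsub>G\<^esub> y \<in> carrier G" if "x \<in> carrier G" "y \<in> carrier G" for x y
    using that by (auto simp: carrier_eq add_eq add_in)
  show "\<zero>\<^bsub>G\<^esub> \<in> carrier G" by (simp add: carrier_eq zero_eq zero_in)
  show "x \<oplus>\<^bsub>G\<^esub> y \<oplus>\<^bsub>G\<^esub> z = x \<oplus>\<^bsub>G\<^esub> (y \<oplus>\<^bsub>G\<^esub> z)"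
    if "x \<in> carrier G" "y \<in> carrier G" "z \<in> carrier G" for x y z
    using that by (auto simp: carrier_eq add_eq add_in add.assoc)
  show "x \<oplus>\<^bsub>G\<^esub> y = y \<oplus>\<^bsub>G\<^esub> x" if "x \<in> carrier G" "y \<in> carrier G" for x y
    using that by (auto simp: carrier_eq add_eq add.commute)
  show "\<zero>\<^bsub>G\<^esub> \<oplus>\<^bsub>G\<^esub> x = x" if "x \<in> carrier G" for x
    using that by (auto simp: carrier_eq add_eq zero_eq zero_in)
  show "\<exists>y\<in>carrier G. y \<oplus>\<^bsub>G\<^esub> x = \<zero>\<^bsub>G\<^esub>" if x: "x \<in> carrier G" for x
  proof -
    obtain u where u: "u \<in> J" "x = e u" using x by (auto simp: carrier_eq)
    then show ?thesis
      by (intro bexI[of _ "e (- u)"]) (simp_all add: carrier_eq add_eq zero_eq uminus_in)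
  qed
qed

lemma sum_in: "(\<And>a. a \<in> A \<Longrightarrow> f a \<in> J) \<Longrightarrow> sum f A \<in> J"
  by (induction A rule: infinite_finite_induct) (simp_all add: zero_in add_in)

lemma finsum_eq:
  assumes "finite A" "\<And>a. a \<in> A \<Longrightarrow> f a \<in> J" "\<And>a. a \<in> A \<Longrightarrow> g a = e (f a)"
  shows "finsum G g A = e (sum f A)"
  using assms
proof (induction A rule: finite_induct)
  case empty
  then show ?case by (simp add: abelian_monoid.finsum_empty[OF abelian_group.axioms(1)[OF abelian_group]] zero_eq)
next
  case (insert a A)
  interpret abelian_group G by (rule abelian_group)
  have "finsum G g (insert a A) = g a \<oplus>\<^bsub>G\<^esub> finsum G g A"
    using insert.hyps insert.prems by (intro finsum_insert) (auto simp: carrier_eq)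
  also have "finsum G g A = e (sum f A)" by (rule insert.IH) (use insert.prems in simp_all)
  also have "g a \<oplus>\<^bsub>G\<^esub> e (sum f A) = e (f a + sum f A)"
    using insert.prems by (simp add: add_eq sum_in)
  finally show ?case using insert.hyps by simp
qed

end

text \<open>A ring given as a record that is isomorphic to a type of class \<open>comm_ring_1\<close>.\<close>

locale encoded_ring =
  fixes R :: "('g, 'b) ring_scheme" and e :: "'r::comm_ring_1 \<Rightarrow> 'g"
  assumes inj_e: "inj e" and carrier_R: "carrier R = range e"
    and R_zero: "\<zero>\<^bsub>R\<^esub> = e 0" and R_one: "\<one>\<^bsub>R\<^esub> = e 1"
    and R_add: "e x \<oplus>\<^bsub>R\<^esub> e y = e (x + y)" and R_mult: "e x \<otimes>\<^bsub>R\<^esub> e y = e (x * y)"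
begin

sublocale encoded_group R e UNIV
  by unfold_locales (simp_all add: carrier_R R_zero R_add)

lemma e_eq_iff [simp]: "e x = e y \<longleftrightarrow> x = y"
  using inj_e by (simp add: inj_eq)

lemma cring: "cring R"
proof (rule cringI)
  show "abelian_group R" by (rule abelian_group)
  show "comm_monoid R"
    by (rule comm_monoidI) (auto simp: carrier_R R_one R_mult mult.assoc mult.commute)
  show "(x \<oplus>\<^bsub>R\<^esub> y) \<otimes>\<^bsub>R\<^esub> z = x \<otimes>\<^bsub>R\<^esub> z \<oplus>\<^bsub>R\<^esub> y \<otimes>\<^bsub>R\<^esub> z"
    if "x \<in> carrier R" "y \<in> carrier R" "z \<in> carrier R" for x y z
    using that by (auto simp: carrier_R R_add R_mult distrib_right)
qed

end

locale encoded_field = encoded_ring K \<phi>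
  for K :: "('a, 'b) ring_scheme" and \<phi> :: "'f::field \<Rightarrow> 'a"
begin

lemma field: "field K"
proof (rule cring.cring_fieldI2[OF cring])
  show "\<zero>\<^bsub>K\<^esub> \<noteq> \<one>\<^bsub>K\<^esub>" by (simp add: R_zero R_one)
  show "\<exists>b\<in>carrier K. a \<otimes>\<^bsub>K\<^esub> b = \<one>\<^bsub>K\<^esub>" if a: "a \<in> carrier K" "a \<noteq> \<zero>\<^bsub>K\<^esub>" for a
  proof -
    obtain x where "a = \<phi> x" "x \<noteq> 0" using a by (auto simp: carrier_R R_zero)
    then show ?thesis by (intro bexI[of _ "\<phi> (inverse x)"]) (simp_all add: R_mult R_one carrier_R)
  qed
qed

abbreviation "R \<equiv> mpoly_ring K klein_vertices"

text \<open>The isomorphism of the type of polynomials with the record of polynomials over \<open>K\<close>.\<close>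

definition enc :: "'f kpoly \<Rightarrow> nat multiset \<Rightarrow> 'a" where
  "enc p = (\<lambda>m. \<phi> (kcoeff p m))"

lemma mpoly_term_eq: "set_mset m \<subseteq> klein_vertices \<Longrightarrow> mpoly_term K (\<phi> c) m = enc (kterm c m)"
  by (auto simp: mpoly_term_def enc_def kcoeff_term R_zero)

sublocale P: encoded_ring R enc
proof
  show "inj enc"
    by (rule injI, rule kpoly_eqI) (simp add: enc_def fun_eq_iff)
  show "carrier R = range enc"
  proof
    show "range enc \<subseteq> carrier R"
      using subsetD[OF kcoeff_vars] by (auto simp: mpoly_ring_def enc_def carrier_R R_zero kcoeff_finite)
    show "carrier R \<subseteq> range enc"
    proof
      fix p assume p: "p \<in> carrier R"
      then have "\<forall>m. \<exists>c. p m = \<phi> c" by (auto simp: mpoly_ring_def carrier_R)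
      then obtain c where c: "\<And>m. p m = \<phi> (c m)" by metis
      have "kcoeff (Abs_kpoly c) = c"
        using p by (intro Abs_kpoly_inverse) (simp add: mpoly_ring_def c R_zero)
      then have "p = enc (Abs_kpoly c)" by (simp add: enc_def c fun_eq_iff)
      then show "p \<in> range enc" by simp
    qed
  qed
  show "\<zero>\<^bsub>R\<^esub> = enc 0" by (simp add: mpoly_ring_def enc_def R_zero)
  show "\<one>\<^bsub>R\<^esub> = enc 1" by (auto simp: mpoly_ring_def enc_def R_zero R_one kcoeff_1)
  show "enc x \<oplus>\<^bsub>R\<^esub> enc y = enc (x + y)" for x y
    by (simp add: mpoly_ring_def enc_def R_add)
  show "enc x \<otimes>\<^bsub>R\<^esub> enc y = enc (x * y)" for x y
    by (auto simp: mpoly_ring_def enc_def R_mult kcoeff_mult intro!: ext finsum_eq)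
qed

subsection \<open>Modules\<close>

text \<open>An element of the record \<open>power_module (ideal_mod J) n\<close> is undefined from the index \<open>n\<close> on,
  a vector in \<open>ideal_vecs n J\<close> is zero there.\<close>

definition vec_enc :: "nat \<Rightarrow> (nat \<Rightarrow> 'f kpoly) \<Rightarrow> nat \<Rightarrow> nat multiset \<Rightarrow> 'a" where
  "vec_enc n v = (\<lambda>j\<in>{..<n}. enc (v j))"

definition ideal_vecs :: "nat \<Rightarrow> 'f kpoly set \<Rightarrow> (nat \<Rightarrow> 'f kpoly) set" where
  "ideal_vecs n J = {v \<in> fvec {..<n}. range v \<subseteq> J}"

abbreviation "ideal_mod J \<equiv> ideal_module R (enc ` J)"

lemma ideal_mod_simps:
  "carrier (ideal_mod J) = enc ` J" "\<zero>\<^bsub>ideal_mod J\<^esub> = enc 0"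
  "enc x \<oplus>\<^bsub>ideal_mod J\<^esub> enc y = enc (x + y)" "enc x \<odot>\<^bsub>ideal_mod J\<^esub> enc y = enc (x * y)"
  by (simp_all add: ideal_module_def P.R_zero P.R_add P.R_mult)

lemma is_ideal_uminus: "is_ideal J \<Longrightarrow> a \<in> J \<Longrightarrow> - a \<in> J"
  using is_ideal_minus[of J 0 a] by (simp add: is_ideal_def)

lemma encoded_ideal: "is_ideal J \<Longrightarrow> encoded_group (ideal_mod J) enc J"
  by unfold_locales (simp_all add: ideal_mod_simps is_ideal_uminus, simp_all add: is_ideal_def)

lemma carrier_power_module:
  assumes "0 \<in> J"
  shows "carrier (power_module (ideal_mod J) n) = vec_enc n ` ideal_vecs n J"
proof
  show "vec_enc n ` ideal_vecs n J \<subseteq> carrier (power_module (ideal_mod J) n)"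
    by (auto simp: power_module_def vec_enc_def ideal_vecs_def ideal_mod_simps image_subset_iff)
  show "carrier (power_module (ideal_mod J) n) \<subseteq> vec_enc n ` ideal_vecs n J"
  proof
    fix u assume "u \<in> carrier (power_module (ideal_mod J) n)"
    then have u: "u \<in> {..<n} \<rightarrow>\<^sub>E enc ` J" by (simp add: power_module_def ideal_mod_simps)
    then have "\<forall>j\<in>{..<n}. \<exists>p\<in>J. u j = enc p" by auto
    then obtain v where v: "\<And>j. j < n \<Longrightarrow> v j \<in> J \<and> u j = enc (v j)" by (metis lessThan_iff)
    let ?v = "\<lambda>j. if j < n then v j else 0"
    have "?v \<in> ideal_vecs n J" using v assms by (auto simp: ideal_vecs_def fvec_def)
    moreover have "u = vec_enc n ?v"
      using u v by (auto simp: vec_enc_def fun_eq_iff restrict_def PiE_def extensional_def)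
    ultimately show "u \<in> vec_enc n ` ideal_vecs n J" by blast
  qed
qed

lemma vec_enc_eq_iff:
  "v \<in> fvec {..<n} \<Longrightarrow> w \<in> fvec {..<n} \<Longrightarrow> vec_enc n v = vec_enc n w \<longleftrightarrow> v = w"
proof
  assume v: "v \<in> fvec {..<n}" and w: "w \<in> fvec {..<n}" and eq: "vec_enc n v = vec_enc n w"
  show "v = w"
  proof
    fix j
    show "v j = w j"
      using fun_cong[OF eq, of j] fvecD[OF v, of j] fvecD[OF w, of j]
      by (cases "j < n") (simp_all add: vec_enc_def)
  qed
qed simp

lemma encoded_power_module:
  assumes "is_ideal J"
  shows "encoded_group (power_module (ideal_mod J) n) (vec_enc n) (ideal_vecs n J)"
proof
  note J = assms[unfolded is_ideal_def]
  show "carrier (power_module (ideal_mod J) n) = vec_enc n ` ideal_vecs n J"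
    using carrier_power_module J by blast
  show "0 \<in> ideal_vecs n J" using J by (auto simp: ideal_vecs_def zero_fun_apply)
  show "x + y \<in> ideal_vecs n J" if "x \<in> ideal_vecs n J" "y \<in> ideal_vecs n J" for x y
    using that J by (auto simp: ideal_vecs_def fvec_add plus_fun_apply)
  show "- x \<in> ideal_vecs n J" if "x \<in> ideal_vecs n J" for x
    using that is_ideal_uminus[OF assms] by (auto simp: ideal_vecs_def fvec_def)
  show "\<zero>\<^bsub>power_module (ideal_mod J) n\<^esub> = vec_enc n 0"
    by (simp add: power_module_def vec_enc_def ideal_mod_simps zero_fun_apply)
  show "vec_enc n x \<oplus>\<^bsub>power_module (ideal_mod J) n\<^esub> vec_enc n y = vec_enc n (x + y)" for x y
    by (auto simp: power_module_def vec_enc_def ideal_mod_simps plus_fun_apply fun_eq_iff restrict_def)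
qed

lemma smult_power_module:
  "enc r \<odot>\<^bsub>power_module (ideal_mod J) n\<^esub> vec_enc n v = vec_enc n (scl r v)"
  by (auto simp: power_module_def vec_enc_def ideal_mod_simps scl_apply fun_eq_iff restrict_def)

lemma mat_map_eq:
  assumes J: "is_ideal J" and v: "v \<in> ideal_vecs n J"
    and A: "\<And>a j. a < l \<Longrightarrow> j < n \<Longrightarrow> A a j = enc (B a j)"
  shows "mat_map (ideal_mod J) l n A (vec_enc n v) = vec_enc l (\<lambda>a. \<Sum>j<n. B a j * v j)"
proof -
  interpret encoded_group "ideal_mod J" enc J by (rule encoded_ideal[OF J])
  have vJ: "v j \<in> J" for j using v by (auto simp: ideal_vecs_def)
  have "(\<Oplus>\<^bsub>ideal_mod J\<^esub>j\<in>{..<n}. A a j \<odot>\<^bsub>ideal_mod J\<^esub> vec_enc n v j) = enc (\<Sum>j<n. B a j * v j)"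
    if "a < l" for a
  proof (rule finsum_eq)
    show "B a j * v j \<in> J" for j using J vJ by (simp add: is_ideal_def)
    show "A a j \<odot>\<^bsub>ideal_mod J\<^esub> vec_enc n v j = enc (B a j * v j)" if "j \<in> {..<n}" for j
      using A[OF \<open>a < l\<close>, of j] that by (simp add: vec_enc_def ideal_mod_simps)
  qed simp
  then show ?thesis by (auto simp: mat_map_def vec_enc_def fun_eq_iff restrict_def)
qed

lemma encoded_residue: "encoded_group (residue_module K) \<phi> UNIV"
  by unfold_locales (simp_all add: residue_module_def carrier_R R_zero R_add)

lemma smult_residue: "enc r \<odot>\<^bsub>residue_module K\<^esub> \<phi> c = \<phi> (kcoeff r {#} * c)"
  by (simp add: residue_module_def enc_def R_mult)

lemma ideal_module_carrier: "ideal_module R (carrier R) = ideal_mod UNIV"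
  by (simp add: P.carrier_R)

lemma is_ideal_UNIV: "is_ideal UNIV"
  by (simp add: is_ideal_def)

text \<open>The differentials and the augmentation over the type of polynomials that a complex in coordinates
  describes.\<close>

definition dec_diff :: "(nat multiset \<Rightarrow> 'a, 'c) free_complex \<Rightarrow> nat \<Rightarrow> (nat \<Rightarrow> 'f kpoly) \<Rightarrow> nat \<Rightarrow> 'f kpoly" where
  "dec_diff F i v = (\<lambda>a. if a < res_rank F i then
     \<Sum>b<res_rank F (Suc i). inv_into UNIV enc (res_diff F i a b) * v b else 0)"

definition dec_aug :: "(nat multiset \<Rightarrow> 'a, 'a) free_complex \<Rightarrow> (nat \<Rightarrow> 'f kpoly) \<Rightarrow> 'f" where
  "dec_aug F v = (\<Sum>j<res_rank F 0. kcoeff (v j) {#} * inv_into UNIV \<phi> (res_aug F j))"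

lemma enc_inv: "p \<in> carrier R \<Longrightarrow> enc (inv_into UNIV enc p) = p"
  by (metis P.carrier_R f_inv_into_f)

lemma phi_inv: "c \<in> carrier K \<Longrightarrow> \<phi> (inv_into UNIV \<phi> c) = c"
  by (metis carrier_R f_inv_into_f)

lemma vec_enc_restrict: "vec_enc n (\<lambda>a. if a < n then f a else 0) = vec_enc n f"
  by (auto simp: vec_enc_def fun_eq_iff restrict_def)

lemma mat_map_dec_diff:
  assumes "is_ideal J" "v \<in> ideal_vecs (res_rank F (Suc i)) J"
    and "\<And>a b. a < res_rank F i \<Longrightarrow> b < res_rank F (Suc i) \<Longrightarrow> res_diff F i a b \<in> carrier R"
  shows "mat_map (ideal_mod J) (res_rank F i) (res_rank F (Suc i)) (res_diff F i)
      (vec_enc (res_rank F (Suc i)) v) = vec_enc (res_rank F i) (dec_diff F i v)"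
  unfolding dec_diff_def vec_enc_restrict
  by (rule mat_map_eq[OF assms(1,2)]) (simp add: enc_inv assms(3))

lemma aug_eq:
  assumes "\<And>j. j < n \<Longrightarrow> e j = \<phi> (c j)"
  shows "finsum (residue_module K :: (nat multiset \<Rightarrow> 'a, 'a) module)
      (\<lambda>j. vec_enc n v j \<odot>\<^bsub>residue_module K\<^esub> e j) {..<n} =
    \<phi> (\<Sum>j<n. kcoeff (v j) {#} * c j)"
  by (rule encoded_group.finsum_eq[OF encoded_residue])
    (simp_all add: vec_enc_def smult_residue assms)

lemma ideal_vecs_UNIV: "ideal_vecs n UNIV = fvec {..<n}"
  by (simp add: ideal_vecs_def)

lemma rlinear_dec_diff: "rlinear (dec_diff F i)"
  by (rule rlinearI)
    (auto simp: dec_diff_def fun_eq_iff fun_ops_apply algebra_simps sum.distrib sum_distrib_left)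

lemma dec_diff_in: "dec_diff F i v \<in> fvec {..<res_rank F i}"
  by (simp add: dec_diff_def fvec_def)

lemma vec_enc_image_eq_iff:
  "V \<subseteq> fvec {..<n} \<Longrightarrow> W \<subseteq> fvec {..<n} \<Longrightarrow> vec_enc n ` V = vec_enc n ` W \<longleftrightarrow> V = W"
  by (rule inj_on_image_eq_iff[of _ "fvec {..<n}"]) (auto intro: inj_onI simp: vec_enc_eq_iff)

text \<open>Resolutions in coordinates are the resolutions over the type of polynomials.\<close>

lemma free_resolution_iff:
  assumes e: "\<And>j. j < res_rank F 0 \<Longrightarrow> res_aug F j \<in> carrier K"
    and D: "\<And>i a b. a < res_rank F i \<Longrightarrow> b < res_rank F (Suc i) \<Longrightarrow> res_diff F i a b \<in> carrier R"
  shows "free_resolution R (residue_module K) F \<longleftrightarrow>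
    dec_aug F ` fvec {..<res_rank F 0} = UNIV \<and>
    dec_diff F 0 ` fvec {..<res_rank F 1} = {v \<in> fvec {..<res_rank F 0}. dec_aug F v = 0} \<and>
    (\<forall>i. dec_diff F (Suc i) ` fvec {..<res_rank F (Suc (Suc i))} =
      {v \<in> fvec {..<res_rank F (Suc i)}. dec_diff F i v = 0})"
proof -
  let ?n = "res_rank F" and ?N = "residue_module K :: (nat multiset \<Rightarrow> 'a, 'a) module" and ?S = "ideal_mod UNIV"
  let ?d = "\<lambda>i. mat_map ?S (?n i) (?n (Suc i)) (res_diff F i)"
  let ?\<epsilon> = "\<lambda>v. \<Oplus>\<^bsub>?N\<^esub>j\<in>{..<?n 0}. v j \<odot>\<^bsub>?N\<^esub> res_aug F j"
  have C: "carrier (power_module ?S n) = vec_enc n ` fvec {..<n}" for n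
    using carrier_power_module[of UNIV n] by (simp add: ideal_vecs_UNIV)
  have d: "?d i (vec_enc (?n (Suc i)) v) = vec_enc (?n i) (dec_diff F i v)"
    if "v \<in> fvec {..<?n (Suc i)}" for i v
    by (rule mat_map_dec_diff[OF is_ideal_UNIV]) (use that D in \<open>simp_all add: ideal_vecs_UNIV\<close>)
  have \<epsilon>: "?\<epsilon> (vec_enc (?n 0) v) = \<phi> (dec_aug F v)" for v
    unfolding dec_aug_def by (rule aug_eq) (simp add: phi_inv e)
  have z: "\<zero>\<^bsub>power_module ?S n\<^esub> = vec_enc n 0" for n
    by (rule encoded_group.zero_eq[OF encoded_power_module[OF is_ideal_UNIV]])
  have N: "carrier ?N = range \<phi>" "\<zero>\<^bsub>?N\<^esub> = \<phi> 0"
    by (simp_all add: residue_module_def carrier_R R_zero)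
  have 1: "?\<epsilon> ` carrier (power_module ?S (?n 0)) = carrier ?N \<longleftrightarrow>
      dec_aug F ` fvec {..<?n 0} = UNIV"
  proof -
    have "?\<epsilon> ` carrier (power_module ?S (?n 0)) = \<phi> ` dec_aug F ` fvec {..<?n 0}"
      by (simp only: C image_image \<epsilon>)
    then show ?thesis by (simp add: N inj_image_eq_iff[OF inj_e])
  qed
  have im: "?d i ` carrier (power_module ?S (?n (Suc i))) =
      vec_enc (?n i) ` dec_diff F i ` fvec {..<?n (Suc i)}" for i
    by (simp add: C image_image d)
  have ker0: "{v \<in> carrier (power_module ?S (?n 0)). ?\<epsilon> v = \<zero>\<^bsub>?N\<^esub>} =
      vec_enc (?n 0) ` {v \<in> fvec {..<?n 0}. dec_aug F v = 0}"
    by (auto simp: C \<epsilon> N)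
  have kerS: "{v \<in> carrier (power_module ?S (?n (Suc i))). ?d i v = \<zero>\<^bsub>power_module ?S (?n i)\<^esub>} =
      vec_enc (?n (Suc i)) ` {v \<in> fvec {..<?n (Suc i)}. dec_diff F i v = 0}" for i
    by (auto simp: C d z vec_enc_eq_iff dec_diff_in)
  have 2: "?d 0 ` carrier (power_module ?S (?n 1)) =
      {v \<in> carrier (power_module ?S (?n 0)). ?\<epsilon> v = \<zero>\<^bsub>?N\<^esub>} \<longleftrightarrow>
      dec_diff F 0 ` fvec {..<?n 1} = {v \<in> fvec {..<?n 0}. dec_aug F v = 0}"
    using im[of 0] unfolding ker0 One_nat_def
    by (simp only:) (intro vec_enc_image_eq_iff; auto simp: dec_diff_in)
  have 3: "?d (Suc i) ` carrier (power_module ?S (?n (Suc (Suc i)))) =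
      {v \<in> carrier (power_module ?S (?n (Suc i))). ?d i v = \<zero>\<^bsub>power_module ?S (?n i)\<^esub>} \<longleftrightarrow>
      dec_diff F (Suc i) ` fvec {..<?n (Suc (Suc i))} =
      {v \<in> fvec {..<?n (Suc i)}. dec_diff F i v = 0}" for i
    unfolding kerS im by (intro vec_enc_image_eq_iff; auto simp: dec_diff_in)
  have 4: "(\<forall>j<?n 0. res_aug F j \<in> carrier ?N) \<longleftrightarrow> True"
    using e by (simp add: residue_module_def)
  have 5: "(\<forall>i. \<forall>a<?n i. \<forall>b<?n (Suc i). res_diff F i a b \<in> carrier R) \<longleftrightarrow> True"
    using D by simp
  show ?thesis
    unfolding free_resolution_def Let_def ideal_module_carrier 1 2 3 4 5 simp_thms ..
qed

lemma resolution_of_free_resolution: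
  assumes F: "free_resolution R (residue_module K) F"
  shows "resolution (\<lambda>r c. kcoeff r {#} * c) (\<lambda>i. {..<res_rank F i}) (dec_diff F) (dec_aug F)"
proof -
  have e: "res_aug F j \<in> carrier K" if "j < res_rank F 0" for j
    using F that unfolding free_resolution_def Let_def by (simp add: residue_module_def)
  have D: "res_diff F i a b \<in> carrier R" if "a < res_rank F i" "b < res_rank F (Suc i)" for i a b
    using F that unfolding free_resolution_def Let_def by simp
  note iff = free_resolution_iff[of F, OF e D, THEN iffD1, OF _ _ _ F]
  have 1: "dec_aug F ` fvec {..<res_rank F 0} = UNIV"
    and 2: "dec_diff F 0 ` fvec {..<res_rank F 1} = {v \<in> fvec {..<res_rank F 0}. dec_aug F v = 0}"
    and 3: "dec_diff F (Suc i) ` fvec {..<res_rank F (Suc (Suc i))} =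
      {v \<in> fvec {..<res_rank F (Suc i)}. dec_diff F i v = 0}" for i
    using iff by simp_all
  show ?thesis
  proof
    show "\<exists>v\<in>fvec {..<res_rank F 0}. dec_aug F v = c" for c
      using 1 by (metis UNIV_I imageE)
    show "dec_aug F v = 0 \<longleftrightarrow> v \<in> dec_diff F 0 ` fvec {..<res_rank F 1}"
      if "v \<in> fvec {..<res_rank F 0}" for v
      unfolding 2 using that by simp
    show "dec_diff F i v = 0 \<longleftrightarrow> v \<in> dec_diff F (Suc i) ` fvec {..<res_rank F (Suc (Suc i))}"
      if "v \<in> fvec {..<res_rank F (Suc i)}" for v i
      unfolding 3 using that by simp
  qed (simp_all add: rlinear_dec_diff dec_diff_in dec_aug_def plus_fun_apply scl_apply kcoeff_mult_0
      distrib_right sum.distrib sum_distrib_left mult.assoc)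
qed

text \<open>A resolution with arbitrary finite bases is put into coordinates by enumerating the bases.\<close>

lemma free_resolution_exists:
  assumes "resolution (\<lambda>r c. kcoeff r {#} * c) X d (\<epsilon> :: ('x \<Rightarrow> 'f kpoly) \<Rightarrow> 'f)"
  shows "\<exists>F. free_resolution R (residue_module K) F"
proof -
  interpret resolution "\<lambda>r c. kcoeff r {#} * c" X d \<epsilon> by (rule assms)
  define n where "n i = card (X i)" for i
  have "\<forall>i. \<exists>f. bij_betw f {..<n i} (X i)"
    using ex_bij_betw_nat_finite[OF finite_X] by (simp add: n_def lessThan_atLeast0)
  then obtain x where x: "\<And>i. bij_betw (x i) {..<n i} (X i)" by metis
  define F :: "(nat multiset \<Rightarrow> 'a, 'a) free_complex" where
    "F = \<lparr>res_rank = n, res_diff = \<lambda>i a b. enc (d i (unit_vec (x (Suc i) b)) (x i a)),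
      res_aug = \<lambda>b. \<phi> (\<epsilon> (unit_vec (x 0 b)))\<rparr>"
  define \<Phi> where "\<Phi> i w = (\<lambda>b. if b < n i then w (x i b) else 0)" for i and w :: "'x \<Rightarrow> 'f kpoly"
  have sum_x: "(\<Sum>b<n i. g (x i b)) = (\<Sum>y\<in>X i. g y)" for i and g :: "'x \<Rightarrow> 'c::comm_monoid_add"
    by (rule sum.reindex_bij_betw[OF x])
  have d: "dec_diff F i (\<Phi> (Suc i) w) = \<Phi> i (d i w)" if "w \<in> fvec (X (Suc i))" for i w
  proof
    fix a
    have "(\<Sum>b<n (Suc i). d i (unit_vec (x (Suc i) b)) (x i a) * w (x (Suc i) b)) = d i w (x i a)"
      unfolding rlinear_expand[OF d_linear finite_X that]
      by (subst sum_x) (simp add: sum_fun_apply scl_apply mult.commute)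
    then show "dec_diff F i (\<Phi> (Suc i) w) a = \<Phi> i (d i w) a"
      by (simp add: dec_diff_def F_def \<Phi>_def inv_f_f[OF P.inj_e])
  qed
  have \<epsilon>: "dec_aug F (\<Phi> 0 w) = \<epsilon> w" if "w \<in> fvec (X 0)" for w
  proof -
    have "dec_aug F (\<Phi> 0 w) = (\<Sum>b<n 0. kcoeff (w (x 0 b)) {#} * \<epsilon> (unit_vec (x 0 b)))"
      by (simp add: dec_aug_def F_def \<Phi>_def inv_f_f[OF inj_e])
    also have "\<dots> = \<epsilon> (\<Sum>y\<in>X 0. scl (w y) (unit_vec y))"
      by (subst sum_x) (simp add: aug_sum aug_scl)
    finally show ?thesis using fvec_expand[OF finite_X that] by simp
  qed
  have \<Phi>: "\<Phi> i ` fvec (X i) = fvec {..<n i}" for i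
  proof
    show "\<Phi> i ` fvec (X i) \<subseteq> fvec {..<n i}" by (auto simp: \<Phi>_def fvec_def)
    show "fvec {..<n i} \<subseteq> \<Phi> i ` fvec (X i)"
    proof
      fix v :: "nat \<Rightarrow> 'f kpoly" assume v: "v \<in> fvec {..<n i}"
      let ?w = "\<lambda>y. if y \<in> X i then v (inv_into {..<n i} (x i) y) else 0"
      have "v b = \<Phi> i ?w b" for b
        using x[of i] fvecD[OF v, of b]
        by (auto simp: \<Phi>_def bij_betw_def inv_into_f_f)
      then have "v = \<Phi> i ?w" by blast
      moreover have "?w \<in> fvec (X i)" by (simp add: fvec_def)
      ultimately show "v \<in> \<Phi> i ` fvec (X i)" by blast
    qed
  qed
  have \<Phi>_0: "\<Phi> i w = 0 \<longleftrightarrow> w = 0" if w: "w \<in> fvec (X i)" for i w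
  proof
    assume 0: "\<Phi> i w = 0"
    have "w y = 0" for y
    proof (cases "y \<in> X i")
      case True
      then obtain b where "b < n i" "y = x i b" using x[of i] by (auto simp: bij_betw_def)
      then show ?thesis using fun_cong[OF 0, of b] by (simp add: \<Phi>_def zero_fun_apply)
    next
      case False
      then show ?thesis by (rule fvecD[OF w])
    qed
    then show "w = 0" by (simp add: fun_eq_iff zero_fun_apply)
  qed (simp add: \<Phi>_def fun_eq_iff zero_fun_apply)
  have rank: "res_rank F = n" by (simp add: F_def)
  have "free_resolution R (residue_module K) F"
  proof (rule free_resolution_iff[THEN iffD2])
    show "res_aug F j \<in> carrier K" for j by (simp add: F_def carrier_R)
    show "res_diff F i a b \<in> carrier R" for i a b by (simp add: F_def P.carrier_R)
    have "dec_aug F ` fvec {..<n 0} = \<epsilon> ` fvec (X 0)"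
      unfolding \<Phi>[symmetric] image_image by (rule image_cong) (simp_all add: \<epsilon>)
    also have "\<dots> = UNIV" using aug_surj by (auto simp: image_iff) metis
    finally have 1: "dec_aug F ` fvec {..<res_rank F 0} = UNIV" by (simp add: rank)
    have im: "dec_diff F i ` fvec {..<n (Suc i)} = \<Phi> i ` d i ` fvec (X (Suc i))" for i
      unfolding \<Phi>[symmetric] image_image by (rule image_cong) (simp_all add: d)
    have "d 0 ` fvec (X (Suc 0)) = {w \<in> fvec (X 0). \<epsilon> w = 0}"
      using exact_0 d_in by auto
    then have "dec_diff F 0 ` fvec {..<n (Suc 0)} = \<Phi> 0 ` {w \<in> fvec (X 0). \<epsilon> w = 0}"
      by (simp add: im)
    also have "\<dots> = {v \<in> fvec {..<n 0}. dec_aug F v = 0}"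
      unfolding \<Phi>[symmetric] by (auto simp: \<epsilon>)
    finally have 2: "dec_diff F 0 ` fvec {..<res_rank F 1} = {v \<in> fvec {..<res_rank F 0}. dec_aug F v = 0}"
      by (simp add: rank)
    have 3: "dec_diff F (Suc i) ` fvec {..<res_rank F (Suc (Suc i))} =
        {v \<in> fvec {..<res_rank F (Suc i)}. dec_diff F i v = 0}" for i
    proof -
      have "d (Suc i) ` fvec (X (Suc (Suc i))) = {w \<in> fvec (X (Suc i)). d i w = 0}"
        using exact_Suc d_in by blast
      then have "dec_diff F (Suc i) ` fvec {..<n (Suc (Suc i))} =
          \<Phi> (Suc i) ` {w \<in> fvec (X (Suc i)). d i w = 0}"
        by (simp add: im)
      also have "\<dots> = {v \<in> fvec {..<n (Suc i)}. dec_diff F i v = 0}"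
        unfolding \<Phi>[symmetric] by (auto simp: d \<Phi>_0 d_in)
      finally show ?thesis by (simp add: rank)
    qed
    show "dec_aug F ` fvec {..<res_rank F 0} = UNIV \<and>
      dec_diff F 0 ` fvec {..<res_rank F 1} = {v \<in> fvec {..<res_rank F 0}. dec_aug F v = 0} \<and>
      (\<forall>i. dec_diff F (Suc i) ` fvec {..<res_rank F (Suc (Suc i))} =
        {v \<in> fvec {..<res_rank F (Suc i)}. dec_diff F i v = 0})"
      using 1 2 3 by blast
  qed
  then show ?thesis ..
qed

end

section \<open>Betti numbers as dimensions\<close>

context encoded_field begin

text \<open>A basis of a vector space that is given as the image of a space of functions.\<close>

lemma dim_eq_card:
  fixes H :: "('a, 'h) module" and \<theta> :: "('y \<Rightarrow> 'f) \<Rightarrow> 'h"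
  assumes Z: "is_submodule Z" and carrier_H: "carrier H = \<theta> ` Z" and zero_H: "\<zero>\<^bsub>H\<^esub> = \<theta> 0"
    and add_H: "\<And>x y. x \<in> Z \<Longrightarrow> y \<in> Z \<Longrightarrow> \<theta> x \<oplus>\<^bsub>H\<^esub> \<theta> y = \<theta> (x + y)"
    and smult_H: "\<And>c x. x \<in> Z \<Longrightarrow> \<phi> c \<odot>\<^bsub>H\<^esub> \<theta> x = \<theta> (scl c x)"
    and S: "finite S" "S \<subseteq> Z"
    and indep: "\<And>a s. \<theta> (\<Sum>s\<in>S. scl (a s) s) = \<zero>\<^bsub>H\<^esub> \<Longrightarrow> s \<in> S \<Longrightarrow> a s = 0"
    and span: "\<And>z. z \<in> Z \<Longrightarrow> \<exists>a. \<theta> z = \<theta> (\<Sum>s\<in>S. scl (a s) s)"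
  shows "vectorspace.dim K H = card S"
proof -
  have Z': "0 \<in> Z" "\<And>x y. x \<in> Z \<Longrightarrow> y \<in> Z \<Longrightarrow> x + y \<in> Z" "\<And>c x. x \<in> Z \<Longrightarrow> scl c x \<in> Z"
    "\<And>x. x \<in> Z \<Longrightarrow> - x \<in> Z"
    using Z is_submodule_uminus[OF Z] by (simp_all add: is_submodule_def)
  interpret H: encoded_group H \<theta> Z
    by unfold_locales (simp_all add: carrier_H zero_H add_H Z')
  have "module K H"
  proof (rule moduleI[OF cring H.abelian_group])
    show "a \<odot>\<^bsub>H\<^esub> x \<in> carrier H" if "a \<in> carrier K" "x \<in> carrier H" for a x
      using that by (auto simp: carrier_R carrier_H smult_H Z')
    show "(a \<oplus>\<^bsub>K\<^esub> b) \<odot>\<^bsub>H\<^esub> x = a \<odot>\<^bsub>H\<^esub> x \<oplus>\<^bsub>H\<^esub> b \<odot>\<^bsub>H\<^esub> x"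
      if "a \<in> carrier K" "b \<in> carrier K" "x \<in> carrier H" for a b x
      using that by (auto simp: carrier_R carrier_H smult_H R_add add_H Z' scl_add_left)
    show "a \<odot>\<^bsub>H\<^esub> (x \<oplus>\<^bsub>H\<^esub> y) = a \<odot>\<^bsub>H\<^esub> x \<oplus>\<^bsub>H\<^esub> a \<odot>\<^bsub>H\<^esub> y"
      if "a \<in> carrier K" "x \<in> carrier H" "y \<in> carrier H" for a x y
      using that by (auto simp: carrier_R carrier_H smult_H add_H Z' scl_add_right)
    show "(a \<otimes>\<^bsub>K\<^esub> b) \<odot>\<^bsub>H\<^esub> x = a \<odot>\<^bsub>H\<^esub> (b \<odot>\<^bsub>H\<^esub> x)"
      if "a \<in> carrier K" "b \<in> carrier K" "x \<in> carrier H" for a b x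
      using that by (auto simp: carrier_R carrier_H smult_H R_mult Z' scl_scl)
    show "\<one>\<^bsub>K\<^esub> \<odot>\<^bsub>H\<^esub> x = x" if "x \<in> carrier H" for x
      using that by (auto simp: carrier_H smult_H R_one scl_one)
  qed
  then interpret V: vectorspace K H
    by (intro vectorspace.intro field)
  have inj: "inj_on \<theta> S"
  proof (rule inj_onI, rule ccontr)
    fix s t assume st: "s \<in> S" "t \<in> S" "\<theta> s = \<theta> t" "s \<noteq> t"
    define a :: "('y \<Rightarrow> 'f) \<Rightarrow> 'f" where "a x = (if x = s then 1 else if x = t then - 1 else 0)" for x
    have "(\<Sum>x\<in>S. scl (a x) x) = (\<Sum>x\<in>S. (if x = s then s else 0) + (if x = t then - t else 0))"
      using st(4) by (intro sum.cong) (auto simp: a_def scl_def zero_fun_def fun_Compl_def)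
    also have "\<dots> = s + - t" using S st by (simp add: sum.distrib)
    finally have eq: "(\<Sum>x\<in>S. scl (a x) x) = s + - t" .
    have sZ: "s \<in> Z" "t \<in> Z" using S st by auto
    have "\<theta> (s + - t) = \<theta> s \<oplus>\<^bsub>H\<^esub> \<theta> (- t)" using sZ by (simp add: add_H Z')
    also have "\<dots> = \<theta> (t + - t)" using st(3) sZ by (simp add: add_H Z')
    finally have "\<theta> (\<Sum>x\<in>S. scl (a x) x) = \<zero>\<^bsub>H\<^esub>" unfolding eq zero_H by simp
    from indep[OF this st(1)] show False by (simp add: a_def)
  qed
  have lin: "V.lincomb b (\<theta> ` S) = \<theta> (\<Sum>s\<in>S. scl (a s) s)"
    if "\<And>s. s \<in> S \<Longrightarrow> b (\<theta> s) = \<phi> (a s)" for a b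
  proof -
    have "V.lincomb b (\<theta> ` S) = finsum H (\<lambda>s. b (\<theta> s) \<odot>\<^bsub>H\<^esub> \<theta> s) S"
      unfolding V.lincomb_def using that S
      by (intro V.finsum_reindex[OF _ inj]) (auto simp: carrier_H smult_H Z' subset_iff)
    also have "\<dots> = \<theta> (\<Sum>s\<in>S. scl (a s) s)"
      using S that by (intro H.finsum_eq) (auto simp: smult_H Z' subset_iff)
    finally show ?thesis .
  qed
  have "V.basis (\<theta> ` S)"
    unfolding V.basis_def
  proof (intro conjI)
    show sub: "\<theta> ` S \<subseteq> carrier H" using S by (auto simp: carrier_H)
    show "V.lin_indpt (\<theta> ` S)"
    proof (rule V.finite_lin_indpt2)
      fix b assume b: "b \<in> \<theta> ` S \<rightarrow> carrier K" "V.lincomb b (\<theta> ` S) = \<zero>\<^bsub>H\<^esub>"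
      then have "\<forall>s\<in>S. \<exists>c. b (\<theta> s) = \<phi> c" by (auto simp: carrier_R)
      then obtain a where a: "\<And>s. s \<in> S \<Longrightarrow> b (\<theta> s) = \<phi> (a s)" by metis
      have "a s = 0" if "s \<in> S" for s
        using indep[of a, OF _ that] b(2) lin[of b a, OF a] by simp
      then show "\<forall>v\<in>\<theta> ` S. b v = \<zero>\<^bsub>K\<^esub>" by (auto simp: a R_zero)
    qed (use S sub in auto)
    show "V.span (\<theta> ` S) = carrier H"
    proof
      show "V.span (\<theta> ` S) \<subseteq> carrier H" using V.span_is_subset2[OF sub] .
      show "carrier H \<subseteq> V.span (\<theta> ` S)"
      proof
        fix w assume "w \<in> carrier H"
        then obtain z where "z \<in> Z" "w = \<theta> z" by (auto simp: carrier_H)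
        then obtain a where a: "w = \<theta> (\<Sum>s\<in>S. scl (a s) s)" using span by blast
        let ?b = "\<lambda>v. \<phi> (a (inv_into S \<theta> v))"
        have "V.lincomb ?b (\<theta> ` S) = w"
          unfolding a by (rule lin) (simp add: inv_into_f_f[OF inj])
        moreover have "?b \<in> \<theta> ` S \<rightarrow> carrier K" by (simp add: carrier_R)
        ultimately show "w \<in> V.span (\<theta> ` S)"
          unfolding V.span_def using S(1) by blast
      qed
    qed
  qed
  then have "V.dim = card (\<theta> ` S)" using S(1) by (intro V.dim_basis) simp_all
  then show ?thesis by (simp add: card_image[OF inj])
qed

text \<open>The coset of \<open>z\<close> modulo \<open>B\<close>, and the quotient \<open>Z / B\<close> as a vector space over \<open>K\<close>, in the
  form in which they occur in the definition of the Betti numbers.\<close>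

definition coset_enc :: "nat \<Rightarrow> (nat \<Rightarrow> 'f kpoly) set \<Rightarrow> (nat \<Rightarrow> 'f kpoly) \<Rightarrow> (nat \<Rightarrow> nat multiset \<Rightarrow> 'a) set" where
  "coset_enc n B z = (\<lambda>b. vec_enc n (b + z)) ` B"

definition quotient_vs :: "nat \<Rightarrow> 'f kpoly set \<Rightarrow> (nat \<Rightarrow> 'f kpoly) set \<Rightarrow> (nat \<Rightarrow> 'f kpoly) set \<Rightarrow>
    ('a, (nat \<Rightarrow> nat multiset \<Rightarrow> 'a) set) module" where
  "quotient_vs n J Z B = restrict_scalars (\<lambda>c. mpoly_term K c {#})
     (quotient_module (power_module (ideal_mod J) n) (vec_enc n ` Z) (vec_enc n ` B))"

lemma quotient_vs:
  assumes J: "is_ideal J" and Z: "is_submodule Z" "Z \<subseteq> ideal_vecs n J"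
    and B: "is_submodule B" "B \<subseteq> Z"
  shows "carrier (quotient_vs n J Z B) = coset_enc n B ` Z"
    and "\<zero>\<^bsub>quotient_vs n J Z B\<^esub> = coset_enc n B 0"
    and "x \<in> Z \<Longrightarrow> y \<in> Z \<Longrightarrow>
      coset_enc n B x \<oplus>\<^bsub>quotient_vs n J Z B\<^esub> coset_enc n B y = coset_enc n B (x + y)"
    and "x \<in> Z \<Longrightarrow> \<phi> c \<odot>\<^bsub>quotient_vs n J Z B\<^esub> coset_enc n B x = coset_enc n B (scl (kterm c {#}) x)"
    and "x \<in> Z \<Longrightarrow> coset_enc n B x = coset_enc n B 0 \<longleftrightarrow> x \<in> B"
proof -
  let ?P = "power_module (ideal_mod J) n"
  interpret P': encoded_group ?P "vec_enc n" "ideal_vecs n J" by (rule encoded_power_module[OF J])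
  have B0: "0 \<in> B" and Badd: "\<And>b b'. b \<in> B \<Longrightarrow> b' \<in> B \<Longrightarrow> b + b' \<in> B"
    and Bscl: "\<And>r b. b \<in> B \<Longrightarrow> scl r b \<in> B"
    using B(1) by (simp_all add: is_submodule_def)
  have ZP: "z \<in> ideal_vecs n J" if "z \<in> Z" for z using that Z by blast
  have BP: "z \<in> ideal_vecs n J" if "z \<in> B" for z using that B ZP by blast
  have shift: "(\<lambda>c. b + c) ` B = B" if b: "b \<in> B" for b
  proof
    show "(\<lambda>c. b + c) ` B \<subseteq> B" using Badd b by blast
    show "B \<subseteq> (\<lambda>c. b + c) ` B"
    proof
      fix c assume "c \<in> B"
      then have "c - b \<in> B" using is_submodule_diff[OF B(1)] b by blast
      then show "c \<in> (\<lambda>c. b + c) ` B" by (intro image_eqI[of _ _ "c - b"]) simp_all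
    qed
  qed
  have absorb: "coset_enc n B (b + z) = coset_enc n B z" if "b \<in> B" for b z
  proof -
    have "coset_enc n B (b + z) = (\<lambda>c. vec_enc n (c + z)) ` (\<lambda>c. b + c) ` B"
      unfolding coset_enc_def image_image by (simp add: algebra_simps)
    then show ?thesis by (simp add: shift[OF that] coset_enc_def)
  qed
  have coset: "vec_enc n ` B +>\<^bsub>?P\<^esub> vec_enc n z = coset_enc n B z" if "z \<in> ideal_vecs n J" for z
    unfolding a_r_coset_def' coset_enc_def using BP that by (auto simp: P'.add_eq)
  show "carrier (quotient_vs n J Z B) = coset_enc n B ` Z"
  proof -
    have "carrier (quotient_vs n J Z B) = (\<lambda>z. vec_enc n ` B +>\<^bsub>?P\<^esub> vec_enc n z) ` Z"
      by (simp add: quotient_vs_def restrict_scalars_def quotient_module_def image_image)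
    also have "\<dots> = coset_enc n B ` Z"
      by (rule image_cong) (simp_all add: coset ZP)
    finally show ?thesis .
  qed
  show "\<zero>\<^bsub>quotient_vs n J Z B\<^esub> = coset_enc n B 0"
    by (simp add: quotient_vs_def restrict_scalars_def quotient_module_def coset_enc_def)
  show "coset_enc n B x \<oplus>\<^bsub>quotient_vs n J Z B\<^esub> coset_enc n B y = coset_enc n B (x + y)"
    if xy: "x \<in> Z" "y \<in> Z"
  proof -
    have eq: "vec_enc n (b + x) \<oplus>\<^bsub>?P\<^esub> vec_enc n (b' + y) = vec_enc n ((b + b') + (x + y))"
      if "b \<in> B" "b' \<in> B" for b b'
      using that xy BP ZP by (simp add: P'.add_eq P'.add_in algebra_simps)
    have "coset_enc n B x <+>\<^bsub>?P\<^esub> coset_enc n B y = coset_enc n B (x + y)"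
    proof
      show "coset_enc n B x <+>\<^bsub>?P\<^esub> coset_enc n B y \<subseteq> coset_enc n B (x + y)"
        unfolding set_add_def' using Badd by (auto simp: coset_enc_def eq)
      show "coset_enc n B (x + y) \<subseteq> coset_enc n B x <+>\<^bsub>?P\<^esub> coset_enc n B y"
      proof
        fix u assume "u \<in> coset_enc n B (x + y)"
        then obtain b where b: "b \<in> B" "u = vec_enc n (b + (x + y))" by (auto simp: coset_enc_def)
        then have "u = vec_enc n (b + x) \<oplus>\<^bsub>?P\<^esub> vec_enc n (0 + y)" using eq[OF b(1) B0] by simp
        then show "u \<in> coset_enc n B x <+>\<^bsub>?P\<^esub> coset_enc n B y"
          unfolding set_add_def' coset_enc_def using b(1) B0 by blast
      qed
    qed
    then show ?thesis by (simp add: quotient_vs_def restrict_scalars_def quotient_module_def)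
  qed
  show "\<phi> c \<odot>\<^bsub>quotient_vs n J Z B\<^esub> coset_enc n B x = coset_enc n B (scl (kterm c {#}) x)"
    if x: "x \<in> Z" for c
  proof -
    let ?r = "kterm c {#}"
    have "vec_enc n ` B +>\<^bsub>?P\<^esub> (enc ?r \<odot>\<^bsub>?P\<^esub> vec_enc n (b + x)) = coset_enc n B (scl ?r x)"
      if b: "b \<in> B" for b
    proof -
      have bx: "scl ?r (b + x) = scl ?r b + scl ?r x" by (rule scl_add_right)
      have "scl ?r b \<in> ideal_vecs n J" "scl ?r x \<in> ideal_vecs n J"
        using BP Bscl[OF b] ZP x Z(1) by (auto simp: is_submodule_def)
      then have "scl ?r (b + x) \<in> ideal_vecs n J" unfolding bx by (rule P'.add_in)
      then show ?thesis
        unfolding smult_power_module by (simp add: coset) (simp add: bx absorb Bscl[OF b])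
    qed
    then have "(\<Union>u\<in>coset_enc n B x. vec_enc n ` B +>\<^bsub>?P\<^esub> (enc ?r \<odot>\<^bsub>?P\<^esub> u)) = coset_enc n B (scl ?r x)"
      unfolding coset_enc_def[of n B x] using B0 by auto
    then show ?thesis
      by (simp add: quotient_vs_def restrict_scalars_def quotient_module_def mpoly_term_eq)
  qed
  show "coset_enc n B x = coset_enc n B 0 \<longleftrightarrow> x \<in> B" if x: "x \<in> Z"
  proof
    assume "coset_enc n B x = coset_enc n B 0"
    moreover have "vec_enc n (0 + x) \<in> coset_enc n B x" unfolding coset_enc_def by (rule imageI[OF B0])
    ultimately obtain b where "b \<in> B" "vec_enc n x = vec_enc n b" by (auto simp: coset_enc_def)
    then show "x \<in> B"
      using vec_enc_eq_iff[of x n b] BP ZP x by (auto simp: ideal_vecs_def)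
  next
    assume "x \<in> B"
    from absorb[OF this, of 0] show "coset_enc n B x = coset_enc n B 0" by simp
  qed
qed

text \<open>The homology of the Koszul complex with entries in a monomial ideal computes the Betti numbers,
  and a basis can be found among the chains with bounded exponents.\<close>

lemma betti_eq_card:
  fixes S :: "'f kfun set"
  assumes M: "multiples_closed M" "exponents_bounded h M"
    and S: "finite S" "S \<subseteq> {c \<in> fvec (koszul_basis h M i). koszul_bd c = 0}"
    and indep: "\<And>a s. (\<Sum>s\<in>S. scl (a s) s) \<in> koszul_bd ` fvec (koszul_basis h M (Suc i)) \<Longrightarrow>
      s \<in> S \<Longrightarrow> a s = 0"
    and span: "\<And>c. c \<in> fvec (koszul_basis h M i) \<Longrightarrow> koszul_bd c = 0 \<Longrightarrow>
      \<exists>a. c - (\<Sum>s\<in>S. scl (a s) s) \<in> koszul_bd ` fvec (koszul_basis h M (Suc i))"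
  shows "betti K klein_vertices i (enc ` monomial_span M) = card S"
proof -
  define J :: "'f kpoly set" where "J = monomial_span M"
  have J: "is_ideal J" unfolding J_def by (rule is_ideal_monomial_span[OF M(1)])
  define F where "F = (SOME F. free_resolution R (residue_module K) F)"
  have F: "free_resolution R (residue_module K) F"
    unfolding F_def using free_resolution_exists[OF koszul.resolution_axioms] by (rule someI_ex)
  interpret F: resolution "\<lambda>r c. kcoeff r {#} * c" "\<lambda>i. {..<res_rank F i}" "dec_diff F" "dec_aug F"
    by (rule resolution_of_free_resolution[OF F])
  interpret KF: resolution_pair "\<lambda>r c. kcoeff r {#} * c" klevel "\<lambda>_. koszul_d" koszul_aug
    "\<lambda>i. {..<res_rank F i}" "dec_diff F" "dec_aug F" ..
  let ?n = "res_rank F"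
  have D: "res_diff F i a b \<in> carrier R" if "a < ?n i" "b < ?n (Suc i)" for i a b
    using F that unfolding free_resolution_def Let_def by simp
  have vecs: "ideal_vecs (?n i) J = {v \<in> fvec {..<?n i}. range v \<subseteq> J}" for i
    by (simp add: ideal_vecs_def)
  have J0: "0 \<in> J" using J by (simp add: is_ideal_def)
  have d: "mat_map (ideal_mod J) (?n i) (?n (Suc i)) (res_diff F i) (vec_enc (?n (Suc i)) v) =
      vec_enc (?n i) (dec_diff F i v)" if "v \<in> ideal_vecs (?n (Suc i)) J" for i v
    by (rule mat_map_dec_diff[OF J that D])
  have B: "tensor_boundaries (ideal_mod J) F i = vec_enc (?n i) ` F.boundaries J i"
    unfolding tensor_boundaries_def Let_def carrier_power_module[OF J0] F.boundaries_def image_image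
    by (simp add: d cong: image_cong_simp) (simp add: vecs)
  have Z: "tensor_cycles (ideal_mod J) F i = vec_enc (?n i) ` F.cycles J i"
  proof (cases i)
    case 0
    then show ?thesis
      by (simp add: tensor_cycles_def Let_def carrier_power_module[OF J0] F.cycles_def ideal_vecs_def)
  next
    case (Suc j)
    have z: "\<zero>\<^bsub>power_module (ideal_mod J) (?n j)\<^esub> = vec_enc (?n j) 0"
      by (rule encoded_group.zero_eq[OF encoded_power_module[OF J]])
    have "tensor_cycles (ideal_mod J) F i = {u \<in> vec_enc (?n i) ` ideal_vecs (?n i) J.
        mat_map (ideal_mod J) (?n j) (?n i) (res_diff F j) u = vec_enc (?n j) 0}"
      by (simp add: tensor_cycles_def Let_def Suc carrier_power_module[OF J0] z)
    also have "\<dots> = vec_enc (?n i) ` {v \<in> ideal_vecs (?n i) J. dec_diff F j v = 0}"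
      unfolding Suc by (auto simp: d vec_enc_eq_iff dec_diff_in)
    also have "{v \<in> ideal_vecs (?n i) J. dec_diff F j v = 0} = F.cycles J i"
      by (auto simp: F.cycles_def ideal_vecs_def Suc)
    finally show ?thesis .
  qed
  let ?Z = "F.cycles J i" and ?B = "F.boundaries J i"
  have subs: "is_submodule ?Z" "?Z \<subseteq> ideal_vecs (?n i) J" "is_submodule ?B" "?B \<subseteq> ?Z"
    using F.is_submodule_cycles[OF J] F.is_submodule_boundaries[OF J] F.boundaries_subset_cycles[OF J]
    by (auto simp: F.cycles_def ideal_vecs_def)
  note Q = quotient_vs[OF J subs]
  let ?Q = "quotient_vs (?n i) J ?Z ?B" and ?cos = "coset_enc (?n i) ?B"
  \<comment> \<open>From here on the homology of the chosen resolution is a quotient of spaces over the type.\<close>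
  have betti: "betti K klein_vertices i (enc ` J) = vectorspace.dim K ?Q"
    by (simp add: betti_def Tor_def tensor_homology_def B Z quotient_vs_def flip: F_def)
  obtain \<theta> where \<theta>: "rlinear \<theta>" "\<And>z. z \<in> koszul.cycles J i \<Longrightarrow> \<theta> z \<in> ?Z"
    "\<And>z. z \<in> koszul.cycles J i \<Longrightarrow> \<theta> z \<in> ?B \<longleftrightarrow> z \<in> koszul.boundaries J i"
    "\<And>y. y \<in> ?Z \<Longrightarrow> \<exists>z\<in>koszul.cycles J i. y - \<theta> z \<in> ?B"
    by (rule KF.homology_comparison[OF J]) blast
  define L where "L = {c :: nat set \<times> nat multiset \<Rightarrow> 'f. c \<in> fvec (koszul_basis h M i) \<and> koszul_bd c = 0}"
  have L: "is_submodule L"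
    unfolding L_def by (rule is_submodule_kernel[OF rlinear_koszul_bd is_submodule_fvec])
  have Lk: "c \<in> kchains i M" "of_kcoeffs c \<in> koszul.cycles J i" if "c \<in> L" for c
    using that fvec_koszul_basis_kchains koszul_cycleI unfolding L_def J_def by blast+
  have of_add: "of_kcoeffs (x + y) = of_kcoeffs x + of_kcoeffs y" if "x \<in> L" "y \<in> L" for x y
  proof -
    have "x + y \<in> L" using L that by (simp add: is_submodule_def)
    from Lk(1)[OF this] have "kcoeffs (of_kcoeffs (x + y)) = kcoeffs (of_kcoeffs x + of_kcoeffs y)"
      using Lk(1)[OF that(1)] Lk(1)[OF that(2)] by (simp add: kcoeffs_add kcoeffs_of_kcoeffs)
    then show ?thesis by (simp only: kcoeffs_inject)
  qed
  have of_scl: "of_kcoeffs (scl c x) = scl (kterm c {#}) (of_kcoeffs x)" if "x \<in> L" for c x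
  proof -
    have "scl c x \<in> L" using L that by (simp add: is_submodule_def)
    from kcoeffs_of_kcoeffs[OF Lk(1)[OF this]]
    have "kcoeffs (of_kcoeffs (scl c x)) = scl c (kcoeffs (of_kcoeffs x))"
      by (simp add: kcoeffs_of_kcoeffs[OF Lk(1)[OF that]])
    also have "\<dots> = kcoeffs (scl (kterm c {#}) (of_kcoeffs x))"
      by (auto simp: kcoeffs_def fun_eq_iff scl_apply kcoeff_const_mult)
    finally show ?thesis by (simp only: kcoeffs_inject)
  qed
  have of_0: "of_kcoeffs (0 :: nat set \<times> nat multiset \<Rightarrow> 'f) = 0"
  proof -
    have "0 \<in> L" using L by (simp add: is_submodule_def)
    from kcoeffs_of_kcoeffs[OF Lk(1)[OF this]] have "kcoeffs (of_kcoeffs 0) = kcoeffs (0 :: nat set \<Rightarrow> 'f kpoly)"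
      by (simp add: kcoeffs_0)
    then show ?thesis by (simp only: kcoeffs_inject)
  qed
  have of_diff: "of_kcoeffs (x - y) = of_kcoeffs x - of_kcoeffs y" if "x \<in> L" "y \<in> L" for x y
    using of_add[of "x - y" y] is_submodule_diff[OF L that] that by (simp add: algebra_simps)
  \<comment> \<open>The map from the bounded Koszul cycles onto the homology; its kernel consists of the boundaries.\<close>
  define \<Theta> where "\<Theta> c = ?cos (\<theta> (of_kcoeffs c))" for c
  have \<Theta>L: "\<theta> (of_kcoeffs c) \<in> ?Z" if "c \<in> L" for c
    using \<theta>(2) Lk(2)[OF that] by blast
  have \<Theta>0: "\<Theta> c = \<zero>\<^bsub>?Q\<^esub> \<longleftrightarrow> c \<in> koszul_bd ` fvec (koszul_basis h M (Suc i))"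
    if c: "c \<in> L" for c
  proof -
    have "\<Theta> c = \<zero>\<^bsub>?Q\<^esub> \<longleftrightarrow> of_kcoeffs c \<in> koszul.boundaries J i"
      unfolding \<Theta>_def Q(2) Q(5)[OF \<Theta>L[OF c]] by (rule \<theta>(3)[OF Lk(2)[OF c]])
    also have "\<dots> \<longleftrightarrow> c \<in> koszul_bd ` fvec (koszul_basis h M (Suc i))"
      unfolding J_def by (rule koszul_boundary_iff) (use c in \<open>simp add: L_def\<close>)
    finally show ?thesis .
  qed
  have \<Theta>_cong: "?cos x = ?cos y" if "x \<in> ?Z" "y \<in> ?Z" "x - y \<in> ?B" for x y
  proof -
    have "x - y \<in> ?Z" using that subs by blast
    then have "?cos (x - y) \<oplus>\<^bsub>?Q\<^esub> ?cos y =
        ?cos x"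
      using Q(3)[of "x - y" y] that by simp
    moreover have "?cos (x - y) = ?cos 0"
      using Q(5)[OF \<open>x - y \<in> ?Z\<close>] that by simp
    moreover have "?cos 0 \<oplus>\<^bsub>?Q\<^esub> ?cos y =
        ?cos y"
      using Q(3)[of 0 y] that subs(1) by (simp add: is_submodule_def)
    ultimately show ?thesis by simp
  qed
  have \<theta>_diff: "\<theta> (of_kcoeffs (x - y)) = \<theta> (of_kcoeffs x) - \<theta> (of_kcoeffs y)" if "x \<in> L" "y \<in> L" for x y
    by (simp add: of_diff[OF that] rlinear_diff[OF \<theta>(1)])
  have "vectorspace.dim K ?Q = card S"
  proof (rule dim_eq_card[OF L, where \<theta> = \<Theta>])
    show "carrier ?Q = \<Theta> ` L"
    proof
      show "\<Theta> ` L \<subseteq> carrier ?Q"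
        using \<Theta>L by (auto simp: Q(1) \<Theta>_def)
      show "carrier ?Q \<subseteq> \<Theta> ` L"
        unfolding Q(1)
      proof
        fix w assume "w \<in> ?cos ` ?Z"
        then obtain y where y: "y \<in> ?Z" "w = ?cos y" by blast
        obtain z where z: "z \<in> koszul.cycles J i" "y - \<theta> z \<in> ?B" using \<theta>(4)[OF y(1)] by blast
        obtain c where c: "c \<in> L" "z - of_kcoeffs c \<in> koszul.boundaries J i"
          using koszul_cycle_representative[OF M(2), of z i] z(1) unfolding J_def L_def by blast
        have "z - of_kcoeffs c \<in> koszul.cycles J i"
          using c(2) koszul.boundaries_subset_cycles[OF J] by blast
        then have "\<theta> z - \<theta> (of_kcoeffs c) \<in> ?B"
          using \<theta>(3) c(2) by (simp add: rlinear_diff[OF \<theta>(1), symmetric])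
        then have "(y - \<theta> z) + (\<theta> z - \<theta> (of_kcoeffs c)) \<in> ?B"
          using z(2) subs(3) unfolding is_submodule_def by blast
        then have "y - \<theta> (of_kcoeffs c) \<in> ?B" by simp
        then have "w = \<Theta> c"
          unfolding y(2) \<Theta>_def using \<Theta>_cong y(1) \<Theta>L[OF c(1)] by blast
        then show "w \<in> \<Theta> ` L" using c(1) by blast
      qed
    qed
    show "\<zero>\<^bsub>?Q\<^esub> = \<Theta> 0"
      by (simp add: \<Theta>_def Q(2) of_0 rlinear_0[OF \<theta>(1)])
    show "\<Theta> x \<oplus>\<^bsub>?Q\<^esub> \<Theta> y = \<Theta> (x + y)" if "x \<in> L" "y \<in> L" for x y
      using that by (simp add: \<Theta>_def Q(3) \<Theta>L of_add rlinear_add[OF \<theta>(1)])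
    show "\<phi> c \<odot>\<^bsub>?Q\<^esub> \<Theta> x = \<Theta> (scl c x)" if "x \<in> L" for c x
      using that by (simp add: \<Theta>_def Q(4) \<Theta>L of_scl rlinear_scl[OF \<theta>(1)])
    show SL: "finite S" "S \<subseteq> L" using S by (auto simp: L_def)
    have sumL: "(\<Sum>s\<in>S. scl (a s) s) \<in> L" for a
      using L SL by (intro is_submodule_sum) (auto simp: is_submodule_def)
    show "a s = 0" if "\<Theta> (\<Sum>s\<in>S. scl (a s) s) = \<zero>\<^bsub>?Q\<^esub>" "s \<in> S" for a s
      using indep[of a s] that \<Theta>0[OF sumL] by blast
    show "\<exists>a. \<Theta> z = \<Theta> (\<Sum>s\<in>S. scl (a s) s)" if z: "z \<in> L" for z
    proof -
      obtain a where a: "z - (\<Sum>s\<in>S. scl (a s) s) \<in> koszul_bd ` fvec (koszul_basis h M (Suc i))"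
        using span z unfolding L_def by blast
      have "z - (\<Sum>s\<in>S. scl (a s) s) \<in> L" by (rule is_submodule_diff[OF L z sumL])
      then have "\<Theta> (z - (\<Sum>s\<in>S. scl (a s) s)) = \<zero>\<^bsub>?Q\<^esub>" using \<Theta>0 a by blast
      then have "\<theta> (of_kcoeffs z) - \<theta> (of_kcoeffs (\<Sum>s\<in>S. scl (a s) s)) \<in> ?B"
        using Q(5)[OF \<Theta>L[OF \<open>z - _ \<in> L\<close>]] by (simp add: \<Theta>_def Q(2) \<theta>_diff[OF z sumL])
      then have "\<Theta> z = \<Theta> (\<Sum>s\<in>S. scl (a s) s)"
        unfolding \<Theta>_def using \<Theta>_cong \<Theta>L z sumL by blast
      then show ?thesis by blast
    qed
  qed
  then show ?thesis using betti by (simp add: J_def)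
qed

end

section \<open>Ranks of integral matrices modulo two\<close>

interpretation fs: vector_space "scl :: 'f::field \<Rightarrow> ('x \<Rightarrow> 'f) \<Rightarrow> 'x \<Rightarrow> 'f"
  by unfold_locales (simp_all add: scl_add_left scl_add_right scl_scl scl_one)

lemma fs_subspace: "is_submodule U \<longleftrightarrow> fs.subspace U"
  by (auto simp: is_submodule_def fs.subspace_def)

text \<open>A family can be dependent by having a repeated member, unlike the set of its members.\<close>

definition independent_family :: "('s \<Rightarrow> 'x \<Rightarrow> 'f::field) \<Rightarrow> 's set \<Rightarrow> bool" where
  "independent_family w S \<longleftrightarrow> (\<forall>a. (\<Sum>s\<in>S. scl (a s) (w s)) = 0 \<longrightarrow> (\<forall>s\<in>S. a s = 0))"

lemma independent_familyI:
  "(\<And>a s. (\<Sum>s\<in>S. scl (a s) (w s)) = 0 \<Longrightarrow> s \<in> S \<Longrightarrow> a s = 0) \<Longrightarrow> independent_family w S"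
  by (simp add: independent_family_def)

lemma independent_familyD:
  "independent_family w S \<Longrightarrow> (\<Sum>s\<in>S. scl (a s) (w s)) = 0 \<Longrightarrow> s \<in> S \<Longrightarrow> a s = 0"
  by (simp add: independent_family_def)

lemma independent_family_cong:
  assumes "independent_family w S" "\<And>s. s \<in> S \<Longrightarrow> w s = w' s"
  shows "independent_family w' S"
proof (rule independent_familyI)
  fix a s assume a: "(\<Sum>s\<in>S. scl (a s) (w' s)) = 0" "s \<in> S"
  have "(\<Sum>s\<in>S. scl (a s) (w s)) = (\<Sum>s\<in>S. scl (a s) (w' s))"
    by (rule sum.cong) (simp_all add: assms(2))
  then show "a s = 0" using independent_familyD[OF assms(1) _ a(2)] a(1) by simp
qed

lemma independent_family_image:
  fixes w :: "'s \<Rightarrow> 'x \<Rightarrow> 'f::field"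
  assumes S: "finite S" and indep: "independent_family w S"
  shows "inj_on w S" "fs.independent (w ` S)"
proof -
  show inj: "inj_on w S"
  proof (rule inj_onI, rule ccontr)
    fix s t assume st: "s \<in> S" "t \<in> S" "w s = w t" "s \<noteq> t"
    define a :: "'s \<Rightarrow> 'f" where "a x = (if x = s then 1 else if x = t then - 1 else 0)" for x
    have "(\<Sum>x\<in>S. scl (a x) (w x)) = (\<Sum>x\<in>S. (if x = s then w s else 0) + (if x = t then - w t else 0))"
      using st(4) by (intro sum.cong) (auto simp: a_def scl_def zero_fun_def fun_Compl_def)
    also have "\<dots> = 0" using S st by (simp add: sum.distrib)
    finally have "a s = 0" using independent_familyD[OF indep _ st(1)] by blast
    then show False by (simp add: a_def)
  qed
  show "fs.independent (w ` S)"
  proof (rule fs.independent_if_scalars_zero)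
    fix f v assume f: "(\<Sum>x\<in>w ` S. scl (f x) x) = 0" "v \<in> w ` S"
    then obtain s where s: "s \<in> S" "v = w s" by blast
    have "(\<Sum>s\<in>S. scl (f (w s)) (w s)) = 0"
      using f(1) by (simp add: sum.reindex[OF inj])
    from independent_familyD[OF indep this s(1)] show "f v = 0" by (simp add: s(2))
  qed (use S in simp)
qed

lemma fs_span_units:
  assumes Y: "finite Y"
  shows "(fvec Y :: ('x \<Rightarrow> 'f::field) set) \<subseteq> fs.span (unit_vec ` Y)"
proof
  fix v :: "'x \<Rightarrow> 'f" assume v: "v \<in> fvec Y"
  have "(\<Sum>x\<in>Y. scl (v x) (unit_vec x)) \<in> fs.span (unit_vec ` Y)"
    by (intro fs.span_sum fs.span_scale fs.span_base imageI)
  then show "v \<in> fs.span (unit_vec ` Y)" using fvec_expand[OF Y v] by simp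
qed

lemma fs_finite_independent:
  fixes B :: "('x \<Rightarrow> 'f::field) set"
  assumes "finite Y" "fs.independent B" "B \<subseteq> fvec Y"
  shows "finite B"
proof -
  have "B \<subseteq> fs.span (unit_vec ` Y)" using assms(3) fs_span_units[OF assms(1)] by blast
  then show ?thesis using fs.independent_span_bound[OF _ assms(2)] assms(1) by blast
qed

lemma fs_dim_fvec:
  assumes Y: "finite Y"
  shows "fs.dim (fvec Y :: ('x \<Rightarrow> 'f::field) set) = card Y"
proof -
  have "independent_family (unit_vec :: 'x \<Rightarrow> 'x \<Rightarrow> 'f) Y"
  proof (rule independent_familyI)
    fix a :: "'x \<Rightarrow> 'f" and s
    assume a: "(\<Sum>s\<in>Y. scl (a s) (unit_vec s)) = (0 :: 'x \<Rightarrow> 'f)" "s \<in> Y"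
    have "(\<Sum>t\<in>Y. scl (a t) (unit_vec t)) s = (\<Sum>t\<in>Y. if t = s then a s else 0)"
      unfolding sum_fun_apply by (rule sum.cong) (auto simp: scl_apply unit_vec_def)
    also have "\<dots> = a s" using a(2) Y by simp
    finally show "a s = 0" by (simp add: a(1) zero_fun_apply)
  qed
  note ind = independent_family_image[OF Y this]
  have "card (unit_vec ` Y :: ('x \<Rightarrow> 'f) set) = fs.dim (fvec Y :: ('x \<Rightarrow> 'f) set)"
    by (rule fs.basis_card_eq_dim[OF image_subsetI[OF unit_vec_in_fvec] fs_span_units[OF Y] ind(2)])
  then show ?thesis by (simp add: card_image[OF ind(1)])
qed

lemma fs_independent_complement:
  fixes B :: "('x \<Rightarrow> 'f::field) set"
  assumes B: "fs.independent B" "finite B" "A \<subseteq> B"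
    and sum: "(\<Sum>b\<in>B - A. scl (a b) b) \<in> fs.span A" and b: "b \<in> B - A"
  shows "a b = 0"
proof -
  have "finite A" by (rule finite_subset[OF B(3,2)])
  then obtain c where c: "(\<Sum>b\<in>B - A. scl (a b) b) = (\<Sum>b\<in>A. scl (c b) b)"
    using sum by (auto simp: fs.span_finite)
  let ?f = "\<lambda>b. if b \<in> A then - c b else a b"
  have "(\<Sum>b\<in>B. scl (?f b) b) = (\<Sum>b\<in>B - A. scl (?f b) b) + (\<Sum>b\<in>A. scl (?f b) b)"
    by (rule sum.subset_diff[OF B(3,2)])
  also have "(\<Sum>b\<in>B - A. scl (?f b) b) = (\<Sum>b\<in>B - A. scl (a b) b)" by (rule sum.cong) auto
  also have "(\<Sum>b\<in>A. scl (?f b) b) = - (\<Sum>b\<in>A. scl (c b) b)"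
    by (simp add: fs.scale_minus_left sum_negf)
  also have "(\<Sum>b\<in>B - A. scl (a b) b) + - (\<Sum>b\<in>A. scl (c b) b) = 0"
    unfolding c by (rule right_minus)
  finally have "(\<Sum>b\<in>B. scl (?f b) b) = 0" .
  from fs.independentD[OF B(1,2) order_refl this, of b] b show ?thesis by simp
qed

lemma fs_extend_basis:
  fixes U V :: "('x \<Rightarrow> 'f::field) set"
  assumes Y: "finite Y" and U: "is_submodule U" "U \<subseteq> V" and V: "is_submodule V" "V \<subseteq> fvec Y"
  obtains A B where "finite B" "A \<subseteq> B" "B \<subseteq> V" "fs.independent B" "fs.span A = U" "fs.span B = V"
    "card A = fs.dim U" "card B = fs.dim V"
proof -
  obtain A where A: "A \<subseteq> U" "fs.independent A" "U \<subseteq> fs.span A" "card A = fs.dim U"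
    using fs.basis_exists by blast
  obtain B where B: "A \<subseteq> B" "B \<subseteq> V" "fs.independent B" "V \<subseteq> fs.span B"
    by (rule fs.maximal_independent_subset_extend[OF order_trans[OF A(1) U(2)] A(2)])
  have "fs.span A \<subseteq> U" by (rule fs.span_minimal) (use A U in \<open>simp_all add: fs_subspace\<close>)
  moreover have "fs.span B \<subseteq> V" by (rule fs.span_minimal) (use B V in \<open>simp_all add: fs_subspace\<close>)
  moreover have "finite B" using fs_finite_independent[OF Y B(3)] B(2) V(2) by blast
  moreover have "card B = fs.dim V" by (rule fs.basis_card_eq_dim[OF B(2,4,3)])
  ultimately show ?thesis using that A B by blast
qed

lemma fs_dim_mono:
  fixes U V :: "('x \<Rightarrow> 'f::field) set"
  assumes "finite Y" "is_submodule U" "U \<subseteq> V" "is_submodule V" "V \<subseteq> fvec Y"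
  shows "fs.dim U \<le> fs.dim V"
proof -
  obtain A B where AB: "finite B" "A \<subseteq> B" "B \<subseteq> V" "fs.independent B" "fs.span A = U" "fs.span B = V"
    "card A = fs.dim U" "card B = fs.dim V"
    by (rule fs_extend_basis[OF assms])
  show ?thesis using card_mono[OF AB(1,2)] AB(7,8) by simp
qed

text \<open>The independent family below is a basis of the quotient \<open>V / U\<close>.\<close>

lemma fs_quotient_basis:
  fixes U V :: "('x \<Rightarrow> 'f::field) set"
  assumes "finite Y" "is_submodule U" "U \<subseteq> V" "is_submodule V" "V \<subseteq> fvec Y"
  obtains S where "finite S" "S \<subseteq> V" "card S = fs.dim V - fs.dim U"
    "\<forall>a. (\<Sum>s\<in>S. scl (a s) s) \<in> U \<longrightarrow> (\<forall>s\<in>S. a s = 0)"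
    "\<forall>v\<in>V. \<exists>a. v - (\<Sum>s\<in>S. scl (a s) s) \<in> U"
proof -
  obtain A B where AB: "finite B" "A \<subseteq> B" "B \<subseteq> V" "fs.independent B" "fs.span A = U" "fs.span B = V"
    "card A = fs.dim U" "card B = fs.dim V"
    by (rule fs_extend_basis[OF assms])
  show ?thesis
  proof (rule that[of "B - A"])
    show "finite (B - A)" "B - A \<subseteq> V" using AB by auto
    show "card (B - A) = fs.dim V - fs.dim U"
      using card_Diff_subset[OF finite_subset[OF AB(2,1)] AB(2)] AB(7,8) by simp
    show "\<forall>a. (\<Sum>s\<in>B - A. scl (a s) s) \<in> U \<longrightarrow> (\<forall>s\<in>B - A. a s = 0)"
    proof (intro allI impI ballI)
      fix a s assume "(\<Sum>s\<in>B - A. scl (a s) s) \<in> U" and s: "s \<in> B - A"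
      then have "(\<Sum>s\<in>B - A. scl (a s) s) \<in> fs.span A" by (simp only: AB(5))
      then show "a s = 0" by (rule fs_independent_complement[OF AB(4,1,2) _ s])
    qed
    show "\<forall>v\<in>V. \<exists>a. v - (\<Sum>s\<in>B - A. scl (a s) s) \<in> U"
    proof
      fix v assume "v \<in> V"
      then have "v \<in> fs.span B" using AB(6) by simp
      then obtain a where "v = (\<Sum>b\<in>B. scl (a b) b)" using AB(1) by (auto simp: fs.span_finite)
      then have "v - (\<Sum>s\<in>B - A. scl (a s) s) = (\<Sum>s\<in>A. scl (a s) s)"
        by (simp add: sum.subset_diff[OF AB(2,1)])
      also have "\<dots> \<in> fs.span A" by (intro fs.span_sum fs.span_scale fs.span_base)
      finally show "\<exists>a. v - (\<Sum>s\<in>B - A. scl (a s) s) \<in> U" using AB(5) by blast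
    qed
  qed
qed

lemma fs_rank_nullity:
  fixes T :: "('y \<Rightarrow> 'f::field) \<Rightarrow> 'x \<Rightarrow> 'f"
  assumes Y: "finite Y" and T: "rlinear T"
  shows "fs.dim {v \<in> fvec Y. T v = 0} + fs.dim (T ` fvec Y) = card Y"
proof -
  let ?N = "{v \<in> fvec Y. T v = 0}"
  have N: "is_submodule ?N" by (rule is_submodule_kernel[OF T is_submodule_fvec])
  obtain A B where AB: "finite B" "A \<subseteq> B" "B \<subseteq> fvec Y" "fs.independent B" "fs.span A = ?N"
    "fs.span B = fvec Y" "card A = fs.dim ?N" "card B = fs.dim (fvec Y :: ('y \<Rightarrow> 'f) set)"
    by (rule fs_extend_basis[OF Y N _ is_submodule_fvec order_refl]) blast+
  let ?C = "B - A"
  have T_sum: "T (\<Sum>c\<in>?C. scl (a c) c) = (\<Sum>c\<in>?C. scl (a c) (T c))" for a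
    by (simp add: rlinear_sum[OF T] rlinear_scl[OF T])
  have indep: "independent_family T ?C"
  proof (rule independent_familyI)
    fix a c assume a: "(\<Sum>c\<in>?C. scl (a c) (T c)) = 0" "c \<in> ?C"
    have "(\<Sum>c\<in>?C. scl (a c) c) \<in> fvec Y"
      using AB(3) by (intro fvec_sum fvec_scl) auto
    then have "(\<Sum>c\<in>?C. scl (a c) c) \<in> fs.span A"
      using a(1) by (simp add: AB(5) T_sum)
    then show "a c = 0" by (rule fs_independent_complement[OF AB(4,1,2) _ a(2)])
  qed
  have finC: "finite ?C" using AB(1) by simp
  note ind = independent_family_image[OF finC indep]
  have "card (T ` ?C) = fs.dim (T ` fvec Y)"
  proof (rule fs.basis_card_eq_dim)
    show "T ` ?C \<subseteq> T ` fvec Y" using AB(3) by blast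
    show "fs.independent (T ` ?C)" by (rule ind(2))
    show "T ` fvec Y \<subseteq> fs.span (T ` ?C)"
    proof
      fix w assume "w \<in> T ` fvec Y"
      then obtain v where v: "v \<in> fvec Y" "w = T v" by blast
      then have "v \<in> fs.span B" using AB(6) by simp
      then obtain a where a: "v = (\<Sum>b\<in>B. scl (a b) b)" using AB(1) by (auto simp: fs.span_finite)
      have "A \<subseteq> ?N" using fs.span_superset[of A] AB(5) by simp
      then have "(\<Sum>b\<in>A. scl (a b) (T b)) = 0"
        by (intro sum.neutral) (auto simp: scl_zero)
      then have "w = (\<Sum>c\<in>?C. scl (a c) (T c))"
        unfolding v(2) a rlinear_sum[OF T] rlinear_scl[OF T] by (simp add: sum.subset_diff[OF AB(2,1)])
      also have "\<dots> \<in> fs.span (T ` ?C)"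
        by (intro fs.span_sum fs.span_scale fs.span_base imageI)
      finally show "w \<in> fs.span (T ` ?C)" .
    qed
  qed
  moreover have "card (T ` ?C) = card B - card A"
    using card_image[OF ind(1)] card_Diff_subset[OF finite_subset[OF AB(2,1)] AB(2)] by simp
  moreover have "card A \<le> card B" using AB by (intro card_mono)
  ultimately show ?thesis using AB(7,8) fs_dim_fvec[OF Y, where 'f = 'f] by simp
qed

lemma of_int_bit_eq_0: "of_int d = (0::bit) \<longleftrightarrow> even d"
proof
  assume "of_int d = (0::bit)"
  show "even d"
  proof (rule ccontr)
    assume "odd d"
    then obtain k where "d = 2 * k + 1" by (rule oddE)
    then have "of_int d = (1::bit)" by simp
    with \<open>of_int d = (0::bit)\<close> show False by simp
  qed
next
  assume "even d"
  then obtain k where "d = 2 * k" by (rule evenE)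
  then show "of_int d = (0::bit)" by simp
qed

text \<open>Integer vectors that are independent modulo two are independent over the rationals: an integral
  relation without a common factor two would survive the reduction.\<close>

lemma int_relation_trivial:
  fixes u :: "'s \<Rightarrow> 'x \<Rightarrow> int" and d :: "'s \<Rightarrow> int"
  assumes S: "finite S"
    and indep: "independent_family (\<lambda>s x. of_int (u s x) :: bit) S"
    and rel: "\<And>x. (\<Sum>s\<in>S. d s * u s x) = 0" and s: "s \<in> S"
  shows "d s = 0"
  using rel s
proof (induction "\<Sum>s\<in>S. nat \<bar>d s\<bar>" arbitrary: d s rule: less_induct)
  case less
  have "(\<Sum>s\<in>S. scl (of_int (d s)) (\<lambda>x. of_int (u s x))) = (0 :: 'x \<Rightarrow> bit)"
  proof
    fix x
    have "(\<Sum>s\<in>S. of_int (d s) * of_int (u s x) :: bit) = of_int (\<Sum>s\<in>S. d s * u s x)" by simp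
    then show "(\<Sum>s\<in>S. scl (of_int (d s)) (\<lambda>x. of_int (u s x))) x = (0 :: 'x \<Rightarrow> bit) x"
      by (simp add: fun_ops_apply less.prems(1))
  qed
  then have even: "even (d t)" if "t \<in> S" for t
    using independent_familyD[OF indep _ that, of "\<lambda>s. of_int (d s)"] of_int_bit_eq_0 by blast
  define e where "e t = d t div 2" for t
  have de: "d t = 2 * e t" if "t \<in> S" for t using even[OF that] by (simp add: e_def)
  have rel_e: "(\<Sum>t\<in>S. e t * u t x) = 0" for x
  proof -
    have "2 * (\<Sum>t\<in>S. e t * u t x) = (\<Sum>t\<in>S. d t * u t x)"
      by (simp add: sum_distrib_left de mult.assoc)
    then show ?thesis using less.prems(1)[of x] by simp
  qed
  show ?case
  proof (rule ccontr)
    assume nz: "d s \<noteq> 0"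
    have "(\<Sum>t\<in>S. nat \<bar>e t\<bar>) < (\<Sum>t\<in>S. nat \<bar>d t\<bar>)"
    proof (rule sum_strict_mono_ex1[OF S])
      show "\<forall>t\<in>S. nat \<bar>e t\<bar> \<le> nat \<bar>d t\<bar>" using de by (auto simp: abs_mult)
      show "\<exists>t\<in>S. nat \<bar>e t\<bar> < nat \<bar>d t\<bar>"
        using de[OF less.prems(2)] nz less.prems(2) by (intro bexI[of _ s]) (auto simp: abs_mult)
    qed
    from less.hyps[OF this rel_e less.prems(2)] nz de[OF less.prems(2)] show False by simp
  qed
qed

lemma rat_independent_of_bit_independent:
  fixes u :: "'s \<Rightarrow> 'x \<Rightarrow> int"
  assumes S: "finite S" and indep: "independent_family (\<lambda>s x. of_int (u s x) :: bit) S"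
  shows "independent_family (\<lambda>s x. of_int (u s x) :: rat) S"
proof (rule independent_familyI)
  fix c :: "'s \<Rightarrow> rat" and s
  assume rel: "(\<Sum>s\<in>S. scl (c s) (\<lambda>x. of_int (u s x))) = 0" and s: "s \<in> S"
  have "\<exists>p q. q \<noteq> 0 \<and> c s = of_int p / of_int q" for s
  proof -
    obtain a b where "b > 0" "c s = of_int a / of_int b"
      by (cases "c s" rule: Rat_cases) (auto simp: Fract_of_int_quotient)
    then show ?thesis by (intro exI[of _ a] exI[of _ b]) simp
  qed
  then obtain p q where pq: "\<And>s. q s \<noteq> 0" "\<And>s. c s = of_int (p s) / of_int (q s)" by metis
  \<comment> \<open>Multiplying by the product of the denominators makes the relation integral.\<close>
  define d where "d t = p t * (\<Prod>r\<in>S - {t}. q r)" for t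
  define N :: rat where "N = of_int (\<Prod>r\<in>S. q r)"
  have N: "N \<noteq> 0" using pq(1) S by (simp add: N_def)
  have dN: "of_int (d t) = N * c t" if "t \<in> S" for t
  proof -
    have "N = of_int (q t) * of_int (\<Prod>r\<in>S - {t}. q r)"
      unfolding N_def prod.remove[OF S that, of q] of_int_mult ..
    then show ?thesis using pq by (simp add: d_def)
  qed
  have rel_d: "(\<Sum>t\<in>S. d t * u t x) = 0" for x
  proof -
    have "(\<Sum>t\<in>S. c t * of_int (u t x)) = 0"
      using fun_cong[OF rel, of x] by (simp add: fun_ops_apply)
    then have "0 = (\<Sum>t\<in>S. N * (c t * of_int (u t x)))"
      by (simp flip: sum_distrib_left)
    also have "\<dots> = (\<Sum>t\<in>S. of_int (d t * u t x))"
      by (rule sum.cong) (simp_all add: dN)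
    also have "\<dots> = of_int (\<Sum>t\<in>S. d t * u t x)" by (rule of_int_sum[symmetric])
    finally show ?thesis by (simp only: of_int_eq_0_iff eq_commute[of "0 :: rat"])
  qed
  have "d s = 0" by (rule int_relation_trivial[where d = d, OF S indep rel_d s])
  then show "c s = 0" using dN[OF s] N by simp
qed

lemma fs_card_le_dim:
  fixes w :: "'s \<Rightarrow> 'x \<Rightarrow> 'f::field"
  assumes X: "finite X" and S: "finite S" and indep: "independent_family w S"
    and U: "U \<subseteq> fvec X" "\<And>s. s \<in> S \<Longrightarrow> w s \<in> U"
  shows "card S \<le> fs.dim U"
proof -
  note ind = independent_family_image[OF S indep]
  obtain B where B: "B \<subseteq> U" "fs.independent B" "U \<subseteq> fs.span B" "card B = fs.dim U"
    by (rule fs.basis_exists)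
  have "finite B" by (rule fs_finite_independent[OF X B(2) order_trans[OF B(1) U(1)]])
  moreover have "w ` S \<subseteq> fs.span B" using U(2) B(3) by blast
  ultimately have "card (w ` S) \<le> card B"
    using fs.independent_span_bound[OF _ ind(2), of B] by simp
  then show ?thesis by (simp add: card_image[OF ind(1)] B(4))
qed

text \<open>The image of a matrix has a basis among the columns.\<close>

lemma fs_image_columns:
  fixes T :: "('y \<Rightarrow> 'f::field) \<Rightarrow> 'x \<Rightarrow> 'f"
  assumes Y: "finite Y" and T: "rlinear T"
  obtains S where "S \<subseteq> Y" "card S = fs.dim (T ` fvec Y)" "independent_family (\<lambda>y. T (unit_vec y)) S"
proof -
  let ?w = "\<lambda>y. T (unit_vec y)"
  obtain C where C: "C \<subseteq> ?w ` Y" "fs.independent C" "?w ` Y \<subseteq> fs.span C"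
    by (rule fs.maximal_independent_subset)
  obtain S where S: "S \<subseteq> Y" "inj_on ?w S" "C = ?w ` S"
    using C(1) by (meson subset_image_inj)
  have finS: "finite S" using S(1) Y by (rule finite_subset)
  have "card C = fs.dim (T ` fvec Y)"
  proof (rule fs.basis_card_eq_dim[OF _ _ C(2)])
    have "?w ` Y \<subseteq> T ` fvec Y" by (rule image_subsetI) (rule imageI[OF unit_vec_in_fvec])
    then show "C \<subseteq> T ` fvec Y" using C(1) by (rule order_trans[rotated])
    show "T ` fvec Y \<subseteq> fs.span C"
    proof
      fix u assume "u \<in> T ` fvec Y"
      then obtain v where v: "v \<in> fvec Y" "u = T v" by blast
      have "u = (\<Sum>y\<in>Y. scl (v y) (?w y))" unfolding v(2) by (rule rlinear_expand[OF T Y v(1)])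
      also have "\<dots> \<in> fs.span C" using C(3) by (intro fs.span_sum fs.span_scale) auto
      finally show "u \<in> fs.span C" .
    qed
  qed
  moreover have "card C = card S" using S(2,3) by (simp add: card_image)
  moreover have "independent_family ?w S"
  proof (rule independent_familyI)
    fix a s assume a: "(\<Sum>s\<in>S. scl (a s) (?w s)) = 0" "s \<in> S"
    let ?f = "\<lambda>v. a (inv_into S ?w v)"
    have "(\<Sum>v\<in>C. scl (?f v) v) = (\<Sum>s\<in>S. scl (a s) (?w s))"
      unfolding S(3) sum.reindex[OF S(2)] by (rule sum.cong) (simp_all add: inv_into_f_f[OF S(2)])
    then have "(\<Sum>v\<in>C. scl (?f v) v) = 0" using a(1) by simp
    moreover have "?w s \<in> C" using a(2) S(3) by blast
    moreover have "finite C" using S(3) finS by simp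
    ultimately have "?f (?w s) = 0" using fs.independentD[OF C(2) _ order_refl, of ?f "?w s"] by blast
    then show "a s = 0" using a(2) by (simp add: inv_into_f_f[OF S(2)])
  qed
  ultimately show ?thesis using that[OF S(1)] by simp
qed

lemma rank_bit_le_rank_rat:
  fixes T2 :: "('y \<Rightarrow> bit) \<Rightarrow> 'x \<Rightarrow> bit" and TQ :: "('y \<Rightarrow> rat) \<Rightarrow> 'x \<Rightarrow> rat" and u :: "'y \<Rightarrow> 'x \<Rightarrow> int"
  assumes fin: "finite X" "finite Y" and lin: "rlinear T2" "rlinear TQ"
    and im: "TQ ` fvec Y \<subseteq> fvec X"
    and u: "\<And>y. y \<in> Y \<Longrightarrow> T2 (unit_vec y) = (\<lambda>x. of_int (u y x))"
      "\<And>y. y \<in> Y \<Longrightarrow> TQ (unit_vec y) = (\<lambda>x. of_int (u y x))"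
  shows "fs.dim (T2 ` fvec Y) \<le> fs.dim (TQ ` fvec Y)"
proof -
  obtain S where S: "S \<subseteq> Y" "card S = fs.dim (T2 ` fvec Y)"
    and indep: "independent_family (\<lambda>y. T2 (unit_vec y)) S"
    by (rule fs_image_columns[OF fin(2) lin(1)])
  have finS: "finite S" using S(1) fin(2) by (rule finite_subset)
  have indep2: "independent_family (\<lambda>s x. of_int (u s x) :: bit) S"
    by (rule independent_family_cong[OF indep]) (use S(1) u(1) in auto)
  have "card S \<le> fs.dim (TQ ` fvec Y)"
  proof (rule fs_card_le_dim[OF fin(1) finS rat_independent_of_bit_independent[OF finS indep2] im])
    show "(\<lambda>x. of_int (u s x)) \<in> TQ ` fvec Y" if "s \<in> S" for s
      using u(2)[of s] that S(1) unit_vec_in_fvec[of s Y] by (metis imageI subsetD)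
  qed
  then show ?thesis using S(2) by simp
qed

text \<open>The rank drops modulo two if some integer vector \<open>z\<close> lies in the rational image, while its
  reduction is not in the image modulo two.\<close>

lemma rank_bit_less_rank_rat:
  fixes T2 :: "('y \<Rightarrow> bit) \<Rightarrow> 'x \<Rightarrow> bit" and TQ :: "('y \<Rightarrow> rat) \<Rightarrow> 'x \<Rightarrow> rat" and u :: "'y \<Rightarrow> 'x \<Rightarrow> int"
  assumes fin: "finite X" "finite Y" and lin: "rlinear T2" "rlinear TQ"
    and im: "TQ ` fvec Y \<subseteq> fvec X"
    and u: "\<And>y. y \<in> Y \<Longrightarrow> T2 (unit_vec y) = (\<lambda>x. of_int (u y x))"
      "\<And>y. y \<in> Y \<Longrightarrow> TQ (unit_vec y) = (\<lambda>x. of_int (u y x))"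
    and z: "(\<lambda>x. of_int (z x)) \<notin> T2 ` fvec Y" "(\<lambda>x. of_int (z x)) \<in> TQ ` fvec Y"
  shows "fs.dim (T2 ` fvec Y) < fs.dim (TQ ` fvec Y)"
proof -
  obtain S where S: "S \<subseteq> Y" "card S = fs.dim (T2 ` fvec Y)"
    and indep: "independent_family (\<lambda>y. T2 (unit_vec y)) S"
    by (rule fs_image_columns[OF fin(2) lin(1)])
  have finS: "finite S" using S(1) fin(2) by (rule finite_subset)
  \<comment> \<open>A column basis modulo two together with \<open>z\<close>, which has the index \<open>None\<close>, is independent.\<close>
  define S' where "S' = insert None (Some ` S)"
  define u' where "u' t = (case t of None \<Rightarrow> z | Some s \<Rightarrow> u s)" for t
  have finS': "finite S'" and cardS': "card S' = Suc (card S)"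
    using finS by (simp_all add: S'_def card_image)
  have sum': "(\<Sum>s\<in>S'. g s) = g None + (\<Sum>s\<in>S. g (Some s))" for g :: "'y option \<Rightarrow> 'c::comm_monoid_add"
    using finS by (simp add: S'_def sum.reindex)
  have indep2: "independent_family (\<lambda>s x. of_int (u' s x) :: bit) S'"
  proof (rule independent_familyI)
    fix a s
    assume rel: "(\<Sum>s\<in>S'. scl (a s) (\<lambda>x. of_int (u' s x))) = (0 :: 'x \<Rightarrow> bit)" and s: "s \<in> S'"
    let ?v = "\<Sum>s\<in>S. scl (a (Some s)) (unit_vec s)"
    have T2v: "T2 ?v = (\<Sum>s\<in>S. scl (a (Some s)) (T2 (unit_vec s)))"
      by (simp add: rlinear_sum[OF lin(1)] rlinear_scl[OF lin(1)])
    have "(\<Sum>s\<in>S. scl (a (Some s)) (\<lambda>x. of_int (u s x))) = (\<Sum>s\<in>S. scl (a (Some s)) (T2 (unit_vec s)))"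
      by (rule sum.cong) (use S(1) u(1) in auto)
    then have rel': "scl (a None) (\<lambda>x. of_int (z x)) + T2 ?v = 0"
      using rel by (simp add: sum' u'_def T2v)
    have None: "a None = 0"
    proof (rule ccontr)
      assume "a None \<noteq> 0"
      then have "a None = 1" by (cases "a None") simp_all
      then have "(\<lambda>x. of_int (z x)) + T2 ?v = 0" using rel' by (simp only: scl_one)
      then have "(\<lambda>x. of_int (z x)) = - T2 ?v" by (simp only: eq_neg_iff_add_eq_0)
      also have "\<dots> = scl (- 1) (T2 ?v)" by (simp only: fs.scale_minus_left scl_one)
      also have "\<dots> = T2 (scl (- 1) ?v)" by (rule rlinear_scl[OF lin(1), symmetric])
      also have "\<dots> \<in> T2 ` fvec Y"
        using S(1) by (intro imageI fvec_scl fvec_sum unit_vec_in_fvec) auto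
      finally show False using z(1) by blast
    qed
    have "(\<Sum>s\<in>S. scl (a (Some s)) (T2 (unit_vec s))) = 0"
      using rel' unfolding None T2v by simp
    then have "a (Some t) = 0" if "t \<in> S" for t
      using independent_familyD[OF indep _ that, of "\<lambda>s. a (Some s)"] by blast
    then show "a s = 0" using None s by (auto simp: S'_def)
  qed
  have "card S' \<le> fs.dim (TQ ` fvec Y)"
  proof (rule fs_card_le_dim[OF fin(1) finS' rat_independent_of_bit_independent[OF finS' indep2] im])
    have "(\<lambda>x. of_int (u s x)) \<in> TQ ` fvec Y" if "s \<in> S" for s
      using u(2)[of s] that S(1) unit_vec_in_fvec[of s Y] by (metis imageI subsetD)
    then show "(\<lambda>x. of_int (u' s x)) \<in> TQ ` fvec Y" if "s \<in> S'" for s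
      using that z(2) by (auto simp: S'_def u'_def)
  qed
  then show ?thesis using S(2) cardS' by simp
qed

section \<open>The triangulation and its Stanley-Reisner ideal\<close>

lemma klein_vertices_eq: "klein_vertices = {1, 2, 3, 4, 5, 6, 7, 8}"
  by (auto simp: klein_vertices_def)

lemma klein_generators_vars: "g \<in> klein_generators \<Longrightarrow> set_mset g \<subseteq> klein_vertices"
  unfolding klein_generators_def klein_vertices_eq by (elim insertE emptyE; simp)

lemma klein_generators_count: "g \<in> klein_generators \<Longrightarrow> count g x \<le> 1"
  unfolding klein_generators_def by (elim insertE emptyE; simp)

lemma klein_generators_nonface:
  assumes "g \<in> klein_generators"
  shows "set_mset g \<notin> complex_of_facets klein_facets"
proof -
  have "\<forall>g\<in>klein_generators. \<forall>T\<in>klein_facets. \<not> set_mset g \<subseteq> T"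
    unfolding klein_generators_def klein_facets_def by simp
  then show ?thesis using assms unfolding complex_of_facets_def by blast
qed

text \<open>Every non-face contains a generator. The hypotheses say that the set of the vertices \<open>j\<close>
  with \<open>aj\<close> contains no generator, the disjuncts that it is contained in a given facet.\<close>

lemma klein_nonface_boolean:
  assumes
    "\<not> (a3 \<and> a8)" "\<not> (a4 \<and> a5)" "\<not> (a6 \<and> a7)"
    "\<not> (a7 \<and> a8)" "\<not> (a1 \<and> a2 \<and> a4)" "\<not> (a1 \<and> a3 \<and> a4)"
    "\<not> (a2 \<and> a3 \<and> a4)" "\<not> (a1 \<and> a2 \<and> a5)"
    "\<not> (a2 \<and> a3 \<and> a5)" "\<not> (a1 \<and> a4 \<and> a6)"
    "\<not> (a1 \<and> a5 \<and> a6)" "\<not> (a2 \<and> a5 \<and> a6)"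
    "\<not> (a1 \<and> a2 \<and> a7)" "\<not> (a1 \<and> a3 \<and> a7)"
    "\<not> (a2 \<and> a4 \<and> a7)" "\<not> (a3 \<and> a5 \<and> a7)"
    "\<not> (a1 \<and> a2 \<and> a8)" "\<not> (a1 \<and> a5 \<and> a8)"
    "\<not> (a2 \<and> a6 \<and> a8)" "\<not> (a1 \<and> a3 \<and> a6)"
    "\<not> (a2 \<and> a3 \<and> a6)" "\<not> (a4 \<and> a6 \<and> a8)"
  shows "
    (\<not> a1 \<and> \<not> a2 \<and> \<not> a5 \<and> \<not> a6 \<and> \<not> a8) \<or>
    (\<not> a1 \<and> \<not> a2 \<and> \<not> a5 \<and> \<not> a7 \<and> \<not> a8) \<or>
    (\<not> a1 \<and> \<not> a2 \<and> \<not> a4 \<and> \<not> a7 \<and> \<not> a8) \<or>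
    (\<not> a1 \<and> \<not> a2 \<and> \<not> a3 \<and> \<not> a4 \<and> \<not> a7) \<or>
    (\<not> a1 \<and> \<not> a3 \<and> \<not> a4 \<and> \<not> a6 \<and> \<not> a7) \<or>
    (\<not> a1 \<and> \<not> a3 \<and> \<not> a4 \<and> \<not> a6 \<and> \<not> a8) \<or>
    (\<not> a1 \<and> \<not> a3 \<and> \<not> a5 \<and> \<not> a7 \<and> \<not> a8) \<or>
    (\<not> a3 \<and> \<not> a4 \<and> \<not> a5 \<and> \<not> a7 \<and> \<not> a8) \<or>
    (\<not> a2 \<and> \<not> a3 \<and> \<not> a4 \<and> \<not> a5 \<and> \<not> a7) \<or>
    (\<not> a2 \<and> \<not> a3 \<and> \<not> a5 \<and> \<not> a6 \<and> \<not> a7) \<or>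
    (\<not> a1 \<and> \<not> a3 \<and> \<not> a5 \<and> \<not> a6 \<and> \<not> a7) \<or>
    (\<not> a4 \<and> \<not> a5 \<and> \<not> a6 \<and> \<not> a7 \<and> \<not> a8) \<or>
    (\<not> a1 \<and> \<not> a4 \<and> \<not> a5 \<and> \<not> a6 \<and> \<not> a8) \<or>
    (\<not> a2 \<and> \<not> a4 \<and> \<not> a6 \<and> \<not> a7 \<and> \<not> a8) \<or>
    (\<not> a2 \<and> \<not> a3 \<and> \<not> a4 \<and> \<not> a6 \<and> \<not> a8) \<or>
    (\<not> a2 \<and> \<not> a3 \<and> \<not> a5 \<and> \<not> a6 \<and> \<not> a8)"
  using assms by satx

lemma klein_nonface_contains_generator:
  assumes A: "A \<subseteq> klein_vertices" and nonface: "A \<notin> complex_of_facets klein_facets"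
  shows "\<exists>g\<in>klein_generators. set_mset g \<subseteq> A"
proof (rule ccontr)
  assume no: "\<not> ?thesis"
  have sub: "A \<subseteq> T \<longleftrightarrow> (\<forall>x\<in>klein_vertices. x \<in> T \<or> x \<notin> A)" for T using A by blast
  have no': "\<forall>g\<in>klein_generators. \<not> set_mset g \<subseteq> A" using no by blast
  have boolean: "(1 \<notin> A \<and> 2 \<notin> A \<and> 5 \<notin> A \<and> 6 \<notin> A \<and> 8 \<notin> A) \<or>
      (1 \<notin> A \<and> 2 \<notin> A \<and> 5 \<notin> A \<and> 7 \<notin> A \<and> 8 \<notin> A) \<or>
      (1 \<notin> A \<and> 2 \<notin> A \<and> 4 \<notin> A \<and> 7 \<notin> A \<and> 8 \<notin> A) \<or>
      (1 \<notin> A \<and> 2 \<notin> A \<and> 3 \<notin> A \<and> 4 \<notin> A \<and> 7 \<notin> A) \<or>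
      (1 \<notin> A \<and> 3 \<notin> A \<and> 4 \<notin> A \<and> 6 \<notin> A \<and> 7 \<notin> A) \<or>
      (1 \<notin> A \<and> 3 \<notin> A \<and> 4 \<notin> A \<and> 6 \<notin> A \<and> 8 \<notin> A) \<or>
      (1 \<notin> A \<and> 3 \<notin> A \<and> 5 \<notin> A \<and> 7 \<notin> A \<and> 8 \<notin> A) \<or>
      (3 \<notin> A \<and> 4 \<notin> A \<and> 5 \<notin> A \<and> 7 \<notin> A \<and> 8 \<notin> A) \<or>
      (2 \<notin> A \<and> 3 \<notin> A \<and> 4 \<notin> A \<and> 5 \<notin> A \<and> 7 \<notin> A) \<or>
      (2 \<notin> A \<and> 3 \<notin> A \<and> 5 \<notin> A \<and> 6 \<notin> A \<and> 7 \<notin> A) \<or>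
      (1 \<notin> A \<and> 3 \<notin> A \<and> 5 \<notin> A \<and> 6 \<notin> A \<and> 7 \<notin> A) \<or>
      (4 \<notin> A \<and> 5 \<notin> A \<and> 6 \<notin> A \<and> 7 \<notin> A \<and> 8 \<notin> A) \<or>
      (1 \<notin> A \<and> 4 \<notin> A \<and> 5 \<notin> A \<and> 6 \<notin> A \<and> 8 \<notin> A) \<or>
      (2 \<notin> A \<and> 4 \<notin> A \<and> 6 \<notin> A \<and> 7 \<notin> A \<and> 8 \<notin> A) \<or>
      (2 \<notin> A \<and> 3 \<notin> A \<and> 4 \<notin> A \<and> 6 \<notin> A \<and> 8 \<notin> A) \<or>
      (2 \<notin> A \<and> 3 \<notin> A \<and> 5 \<notin> A \<and> 6 \<notin> A \<and> 8 \<notin> A)"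
    by (rule klein_nonface_boolean)
      (use no' in \<open>simp_all add: klein_generators_def del: One_nat_def\<close>)
  have "\<exists>T\<in>klein_facets. A \<subseteq> T"
    unfolding sub klein_facets_def klein_vertices_eq using boolean by (simp del: One_nat_def)
  then show False using nonface by (simp add: complex_of_facets_def)
qed

lemma submultiset_mset_set_iff:
  assumes "\<And>x. count g x \<le> 1" "finite A"
  shows "g \<subseteq># mset_set A \<longleftrightarrow> set_mset g \<subseteq> A"
proof
  assume sub: "g \<subseteq># mset_set A"
  show "set_mset g \<subseteq> A" using set_mset_mono[OF sub] assms(2) by simp
next
  assume "set_mset g \<subseteq> A"
  then have "count g x \<le> count (mset_set A) x" for x
    using assms by (cases "x \<in># g") (auto simp: not_in_iff)
  then show "g \<subseteq># mset_set A" by (simp add: subseteq_mset_def)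
qed

lemma klein_nonface_iff:
  assumes "A \<subseteq> klein_vertices"
  shows "A \<notin> complex_of_facets klein_facets \<longleftrightarrow> (\<exists>g\<in>klein_generators. g \<subseteq># mset_set A)"
proof -
  have fin: "finite A" by (rule finite_subset[OF assms finite_klein_vertices])
  have "A \<notin> complex_of_facets klein_facets" if g: "g \<in> klein_generators" "set_mset g \<subseteq> A" for g
    using klein_generators_nonface[OF g(1)] g(2) unfolding complex_of_facets_def by blast
  then show ?thesis
    using klein_nonface_contains_generator[OF assms] klein_generators_count
    by (auto simp: submultiset_mset_set_iff[OF _ fin])
qed

lemma mpoly_term_mult:
  assumes "field K"
  shows "mpoly_term K \<one>\<^bsub>K\<^esub> b \<otimes>\<^bsub>mpoly_ring K V\<^esub> mpoly_term K \<one>\<^bsub>K\<^esub> g = mpoly_term K \<one>\<^bsub>K\<^esub> (b + g)"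
proof
  fix m
  interpret K: field K by (rule assms)
  let ?f = "\<lambda>a. mpoly_term K \<one>\<^bsub>K\<^esub> b a \<otimes>\<^bsub>K\<^esub> mpoly_term K \<one>\<^bsub>K\<^esub> g (m - a)"
  have "(mpoly_term K \<one>\<^bsub>K\<^esub> b \<otimes>\<^bsub>mpoly_ring K V\<^esub> mpoly_term K \<one>\<^bsub>K\<^esub> g) m = finsum K ?f {a. a \<subseteq># m}"
    by (simp add: mpoly_ring_def)
  also have "\<dots> = mpoly_term K \<one>\<^bsub>K\<^esub> (b + g) m"
  proof (cases "m = b + g")
    case True
    have "finsum K ?f {a. a \<subseteq># m} = finsum K (\<lambda>a. if b = a then \<one>\<^bsub>K\<^esub> else \<zero>\<^bsub>K\<^esub>) {a. a \<subseteq># m}"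
      by (rule K.finsum_cong') (auto simp: mpoly_term_def True)
    also have "\<dots> = \<one>\<^bsub>K\<^esub>" by (rule K.finsum_singleton) (simp_all add: True)
    finally show ?thesis by (simp add: mpoly_term_def True)
  next
    case False
    have "finsum K ?f {a. a \<subseteq># m} = finsum K (\<lambda>a. \<zero>\<^bsub>K\<^esub>) {a. a \<subseteq># m}"
      by (rule K.finsum_cong') (use False in \<open>auto simp: mpoly_term_def\<close>)
    then show ?thesis using False by (simp add: mpoly_term_def)
  qed
  finally show "(mpoly_term K \<one>\<^bsub>K\<^esub> b \<otimes>\<^bsub>mpoly_ring K V\<^esub> mpoly_term K \<one>\<^bsub>K\<^esub> g) m =
      mpoly_term K \<one>\<^bsub>K\<^esub> (b + g) m" .
qed

lemma klein_ideal_stanley_reisner: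
  assumes K: "field K"
  shows "klein_ideal K = stanley_reisner_ideal K klein_vertices (complex_of_facets klein_facets)"
proof -
  let ?R = "mpoly_ring K klein_vertices" and ?t = "mpoly_term K \<one>\<^bsub>K\<^esub>"
  let ?G = "{mset_set A | A. A \<subseteq> klein_vertices \<and> A \<notin> complex_of_facets klein_facets}"
  interpret K: field K by (rule K)
  have sub: "g \<in> ?G" if g: "g \<in> klein_generators" for g
  proof -
    have "g = mset_set (set_mset g)"
    proof (rule multiset_eqI)
      fix x
      show "count g x = count (mset_set (set_mset g)) x"
        using klein_generators_count[OF g, of x]
        by (cases "x \<in># g") (auto simp: not_in_iff intro: le_antisym)
    qed
    then show ?thesis using klein_generators_vars[OF g] klein_generators_nonface[OF g] by blast
  qed
  have "?t ` klein_generators \<subseteq> I \<longleftrightarrow> ?t ` ?G \<subseteq> I" if I: "ideal I ?R" for I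
  proof
    assume gens: "?t ` klein_generators \<subseteq> I"
    show "?t ` ?G \<subseteq> I"
    proof (rule image_subsetI)
      fix m assume "m \<in> ?G"
      then obtain A where A: "m = mset_set A" "A \<subseteq> klein_vertices" "A \<notin> complex_of_facets klein_facets"
        by blast
      then obtain g where g: "g \<in> klein_generators" "g \<subseteq># m" using klein_nonface_iff by blast
      have "finite A" by (rule finite_subset[OF A(2) finite_klein_vertices])
      then have "set_mset (m - g) \<subseteq> klein_vertices" using A in_diffD by fastforce
      then have "?t (m - g) \<in> carrier ?R"
        by (auto simp: mpoly_ring_def mpoly_term_def)
      moreover have "?t g \<in> I" using gens g(1) by blast
      ultimately have "?t (m - g) \<otimes>\<^bsub>?R\<^esub> ?t g \<in> I" using ideal.I_l_closed[OF I] by blast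
      then show "?t m \<in> I" using g(2) by (simp add: mpoly_term_mult[OF K])
    qed
  next
    assume "?t ` ?G \<subseteq> I"
    moreover have "?t ` klein_generators \<subseteq> ?t ` ?G" by (intro image_mono subsetI sub)
    ultimately show "?t ` klein_generators \<subseteq> I" by (rule order_trans[rotated])
  qed
  then show ?thesis
    unfolding klein_ideal_def stanley_reisner_ideal_def monomial_ideal_def genideal_def by auto
qed

section \<open>Powers of the ideal\<close>

text \<open>The monomials that are divisible by a product of \<open>h\<close> generators.\<close>

primrec kmon :: "nat \<Rightarrow> nat multiset set" where
  "kmon 0 = UNIV"
| "kmon (Suc h) = {m. \<exists>g\<in>klein_generators. g \<subseteq># m \<and> m - g \<in> kmon h}"

lemma multiples_closed_kmon: "multiples_closed (kmon h)"
proof (induction h)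
  case (Suc h)
  have "m + m' \<in> kmon (Suc h)" if m: "m \<in> kmon (Suc h)" for m m'
  proof -
    obtain g where g: "g \<in> klein_generators" "g \<subseteq># m" "m - g \<in> kmon h" using m by auto
    have "m - g + m' \<in> kmon h" using Suc g(3) by (simp add: multiples_closed_def)
    moreover have "m + m' - g = m - g + m'" using g(2) by simp
    moreover have "g \<subseteq># m + m'" using g(2) by (simp add: subset_mset.add_increasing2)
    ultimately show ?thesis using g(1) by auto
  qed
  then show ?case unfolding multiples_closed_def by blast
qed (simp add: multiples_closed_def)

text \<open>Each generator is squarefree, so a product of \<open>h\<close> generators has exponents at most \<open>h\<close>.\<close>

lemma exponents_bounded_kmon: "exponents_bounded h (kmon h)"
proof (induction h)
  case (Suc h)
  have "m \<in> kmon (Suc h)" if m: "add_mset j m \<in> kmon (Suc h)" "count m j \<ge> Suc h" for j m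
  proof -
    obtain g where g: "g \<in> klein_generators" "g \<subseteq># add_mset j m" "add_mset j m - g \<in> kmon h"
      using m(1) by auto
    have gj: "count g j \<le> 1" by (rule klein_generators_count[OF g(1)])
    have "count g x \<le> count m x" for x
      using mset_subset_eq_count[OF g(2), of x] gj m(2) by (cases "x = j") simp_all
    then have gm: "g \<subseteq># m" by (simp add: subseteq_mset_def)
    then have "add_mset j m - g = add_mset j (m - g)"
      by (metis add_mset_add_single subset_mset.add_diff_assoc2)
    moreover have "count (m - g) j \<ge> h" using gj m(2) by simp
    ultimately have "m - g \<in> kmon h" using Suc g(3) by (auto simp: exponents_bounded_def)
    then show ?thesis using g(1) gm by auto
  qed
  then show ?case unfolding exponents_bounded_def by blast
qed (simp add: exponents_bounded_def)

context encoded_field begin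

lemma ideal_encI:
  assumes "is_ideal J"
  shows "ideal (enc ` J) R"
proof (rule idealI)
  interpret R: cring R by (rule P.cring)
  show "ring R" by (rule R.ring_axioms)
  show "subgroup (enc ` J) (add_monoid R)"
  proof (rule subgroup.intro)
    show "enc ` J \<subseteq> carrier (add_monoid R)" by (simp add: P.carrier_R image_subset_iff)
    show "x \<otimes>\<^bsub>add_monoid R\<^esub> y \<in> enc ` J" if "x \<in> enc ` J" "y \<in> enc ` J" for x y
      using that assms by (auto simp: P.R_add is_ideal_def)
    show "\<one>\<^bsub>add_monoid R\<^esub> \<in> enc ` J" using assms by (simp add: P.R_zero is_ideal_def)
    show "inv\<^bsub>add_monoid R\<^esub> x \<in> enc ` J" if x: "x \<in> enc ` J" for x
    proof -
      obtain p where p: "x = enc p" "p \<in> J" using x by blast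
      have "\<ominus>\<^bsub>R\<^esub> enc p = enc (- p)"
        by (rule R.minus_equality) (simp_all add: P.carrier_R P.R_add P.R_zero)
      then show ?thesis using p is_ideal_uminus[OF assms p(2)] by (simp add: a_inv_def)
    qed
  qed
  show "x \<otimes>\<^bsub>R\<^esub> a \<in> enc ` J" "a \<otimes>\<^bsub>R\<^esub> x \<in> enc ` J" if a: "a \<in> enc ` J" "x \<in> carrier R" for a x
  proof -
    obtain p r where pr: "a = enc p" "x = enc r" "p \<in> J" using a by (auto simp: P.carrier_R)
    then have "r * p \<in> J" using assms by (simp add: is_ideal_def)
    then show "x \<otimes>\<^bsub>R\<^esub> a \<in> enc ` J" "a \<otimes>\<^bsub>R\<^esub> x \<in> enc ` J"
      by (simp_all only: pr P.R_mult mult.commute[of p r] imageI)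
  qed
qed

lemma mpoly_term_one: "set_mset m \<subseteq> klein_vertices \<Longrightarrow> mpoly_term K \<one>\<^bsub>K\<^esub> m = enc (kterm 1 m)"
  by (simp add: R_one mpoly_term_eq)

lemma kterm_split:
  assumes "g \<subseteq># m" "set_mset m \<subseteq> klein_vertices"
  shows "kterm c m = kterm c (m - g) * kterm (1::'f) g"
proof -
  have "set_mset (m - g) \<subseteq> klein_vertices" "set_mset g \<subseteq> klein_vertices"
    using assms set_mset_mono[OF assms(1)] by (auto dest: in_diffD)
  then show ?thesis using assms(1) by (simp add: kterm_mult)
qed

lemma klein_ideal_eq: "klein_ideal K = enc ` monomial_span (kmon 1)"
proof
  let ?t = "mpoly_term K \<one>\<^bsub>K\<^esub> ` klein_generators"
  interpret R: cring R by (rule P.cring)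
  have t: "?t \<subseteq> enc ` monomial_span (kmon 1)"
    using klein_generators_vars
    by (auto simp: mpoly_term_one monomial_span_def kcoeff_term intro!: imageI split: if_splits)
  have t_carrier: "?t \<subseteq> carrier R" using t by (auto simp: P.carrier_R)
  show "klein_ideal K \<subseteq> enc ` monomial_span (kmon 1)"
    unfolding klein_ideal_def monomial_ideal_def
    by (rule R.genideal_minimal[OF ideal_encI[OF is_ideal_monomial_span[OF multiples_closed_kmon]] t])
  interpret I: ideal "klein_ideal K" R
    unfolding klein_ideal_def monomial_ideal_def by (rule R.genideal_ideal[OF t_carrier])
  have gen: "enc (kterm 1 g) \<in> klein_ideal K" if "g \<in> klein_generators" for g
    using R.genideal_self[OF t_carrier] that klein_generators_vars[OF that]
    unfolding klein_ideal_def monomial_ideal_def by (auto simp: mpoly_term_one)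
  have "monomial_span (kmon 1) \<subseteq> {p. enc p \<in> klein_ideal K}"
  proof (rule monomial_span_subset)
    show "0 \<in> {p. enc p \<in> klein_ideal K}" using I.zero_closed by (simp add: P.R_zero)
    show "p + q \<in> {p. enc p \<in> klein_ideal K}"
      if "p \<in> {p. enc p \<in> klein_ideal K}" "q \<in> {p. enc p \<in> klein_ideal K}" for p q
      using I.a_closed[of "enc p" "enc q"] that by (simp add: P.R_add)
    show "kterm c m \<in> {p. enc p \<in> klein_ideal K}" if m: "m \<in> kmon 1" "set_mset m \<subseteq> klein_vertices" for c m
    proof -
      obtain g where g: "g \<in> klein_generators" "g \<subseteq># m" using m(1) by auto
      have "enc (kterm c (m - g)) \<otimes>\<^bsub>R\<^esub> enc (kterm 1 g) \<in> klein_ideal K"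
        by (rule I.I_l_closed[OF gen[OF g(1)]]) (simp add: P.carrier_R)
      then show ?thesis by (simp add: P.R_mult kterm_split[OF g(2) m(2)])
    qed
  qed
  then show "enc ` monomial_span (kmon 1) \<subseteq> klein_ideal K" by blast
qed

lemma ideal_prod_eq:
  "ideal_prod R (enc ` monomial_span (kmon h)) (enc ` monomial_span (kmon 1)) =
    enc ` monomial_span (kmon (Suc h))" (is "?P = _")
proof
  have J: "is_ideal (monomial_span (kmon (Suc h)) :: 'f kpoly set)"
    by (rule is_ideal_monomial_span[OF multiples_closed_kmon])
  show "?P \<subseteq> enc ` monomial_span (kmon (Suc h))"
  proof
    fix x assume "x \<in> ?P"
    then show "x \<in> enc ` monomial_span (kmon (Suc h))"
    proof (induction rule: ideal_prod.induct)
      case (prod i j)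
      then obtain p q where pq: "i = enc p" "j = enc q"
        "p \<in> monomial_span (kmon h)" "q \<in> monomial_span (kmon 1)" by blast
      have "m \<in> kmon (Suc h)" if nz: "kcoeff (p * q) m \<noteq> 0" for m
      proof -
        obtain a b where ab: "m = a + b" "kcoeff p a \<noteq> 0" "kcoeff q b \<noteq> 0"
          by (rule kcoeff_mult_nonzeroE[OF nz])
        then have a: "a \<in> kmon h" and "b \<in> kmon 1" using pq by (auto simp: monomial_span_def)
        then obtain g where g: "g \<in> klein_generators" "g \<subseteq># b" by auto
        have "a + (b - g) \<in> kmon h" using multiples_closed_kmon a by (simp add: multiples_closed_def)
        moreover have "a + b - g = a + (b - g)" using g(2) by simp
        moreover have "g \<subseteq># a + b" using g(2) by (simp add: subset_mset.add_increasing)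
        ultimately show ?thesis using g(1) ab(1) by auto
      qed
      then show ?case by (simp add: pq P.R_mult monomial_span_def)
    next
      case (sum s1 s2)
      then show ?case using J by (auto simp: P.R_add is_ideal_def)
    qed
  qed
  have "monomial_span (kmon (Suc h)) \<subseteq> {p. enc p \<in> ?P}"
  proof (rule monomial_span_subset)
    have "enc (0 * 0) \<in> ?P"
      unfolding P.R_mult[symmetric] by (rule ideal_prod.prod) (simp_all add: monomial_span_def)
    then show "0 \<in> {p. enc p \<in> ?P}" by simp
    show "p + q \<in> {p. enc p \<in> ?P}" if "p \<in> {p. enc p \<in> ?P}" "q \<in> {p. enc p \<in> ?P}" for p q
      using ideal_prod.sum[of "enc p" R _ _ "enc q"] that by (simp add: P.R_add)
    show "kterm c m \<in> {p. enc p \<in> ?P}" if m: "m \<in> kmon (Suc h)" "set_mset m \<subseteq> klein_vertices" for c m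
    proof -
      obtain g where g: "g \<in> klein_generators" "g \<subseteq># m" "m - g \<in> kmon h" using m(1) by auto
      have "enc (kterm c (m - g)) \<otimes>\<^bsub>R\<^esub> enc (kterm 1 g) \<in> ?P"
      proof (rule ideal_prod.prod)
        show "enc (kterm c (m - g)) \<in> enc ` monomial_span (kmon h)"
          using g(3) by (intro imageI) (simp add: monomial_span_def kcoeff_term)
        show "enc (kterm 1 g) \<in> enc ` monomial_span (kmon 1)"
          using g(1) by (intro imageI) (auto simp: monomial_span_def kcoeff_term)
      qed
      then show ?thesis by (simp add: P.R_mult kterm_split[OF g(2) m(2)])
    qed
  qed
  then show "enc ` monomial_span (kmon (Suc h)) \<subseteq> ?P" by blast
qed

lemma klein_ideal_power_eq: "klein_ideal_power K h = enc ` monomial_span (kmon h)"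
proof (induction h)
  case 0
  then show ?case
    by (simp add: klein_ideal_power_def ideal_power_def nat_pow_def ideals_set_def P.carrier_R
        monomial_span_def)
next
  case (Suc h)
  have "klein_ideal_power K (Suc h) = ideal_prod R (klein_ideal_power K h) (klein_ideal K)"
    by (simp add: klein_ideal_power_def ideal_power_def nat_pow_def ideals_set_def)
  then show ?case unfolding Suc klein_ideal_eq ideal_prod_eq .
qed

end

section \<open>The Klein bottle in the Koszul complex\<close>

text \<open>The product of $(x_4 x_5)^n$ and the variables in \<open>A\<close>.\<close>

definition kmonomial :: "nat \<Rightarrow> nat set \<Rightarrow> nat multiset" where
  "kmonomial n A = mset_set A + (replicate_mset n 4 + replicate_mset n 5)"

lemma kmonomial_remove: "finite A \<Longrightarrow> j \<in> A \<Longrightarrow> kmonomial n A = add_mset j (kmonomial n (A - {j}))"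
  by (simp add: kmonomial_def mset_set.remove)

lemma kmonomial_vars: "A \<subseteq> klein_vertices \<Longrightarrow> set_mset (kmonomial n A) \<subseteq> klein_vertices"
  using finite_subset[OF _ finite_klein_vertices, of A]
  by (auto simp: kmonomial_def klein_vertices_eq split: if_splits)

lemma kmon_weight:
  fixes w :: "nat \<Rightarrow> nat"
  assumes w: "\<And>g. g \<in> klein_generators \<Longrightarrow> k \<le> sum_mset (image_mset w g)" and m: "m \<in> kmon h"
  shows "k * h \<le> sum_mset (image_mset w m)"
  using m
proof (induction h arbitrary: m)
  case (Suc h)
  then obtain g where g: "g \<in> klein_generators" "g \<subseteq># m" "m - g \<in> kmon h" by auto
  have "k * h \<le> sum_mset (image_mset w (m - g))" by (rule Suc.IH[OF g(3)])
  moreover have "k \<le> sum_mset (image_mset w g)" by (rule w[OF g(1)])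
  moreover have "sum_mset (image_mset w m) =
      sum_mset (image_mset w (m - g)) + sum_mset (image_mset w g)"
    using g(2) by (metis image_mset_union subset_mset.diff_add sum_mset.union)
  ultimately show ?case by simp
qed simp

text \<open>Four times the weights that separate $x_4 x_5$ from a facet: a facet with the vertex 4 or 5 (no
  facet contains both) gets weight 0 and everything outside of it weight 1. Otherwise 4 and 5 get weight
  1/2, so that the generators with one of them and two vertices of the facet need weight 1/4 on the
  facet.\<close>

definition facet_weight :: "nat set \<Rightarrow> nat \<Rightarrow> nat" where
  "facet_weight T x =
    (if x \<in> T then (if 4 \<in> T \<or> 5 \<in> T then 0 else 1)
     else if x \<in> {4, 5} \<and> 4 \<notin> T \<and> 5 \<notin> T then 2 else 4)"

lemma facet_weight_generators:
  "\<forall>T\<in>klein_facets. \<forall>g\<in>klein_generators. 4 \<le> sum_mset (image_mset (facet_weight T) g)"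
  unfolding klein_facets_def klein_generators_def facet_weight_def by simp

lemma facet_weight_facet:
  "\<forall>T\<in>klein_facets. (\<Sum>x\<in>T. facet_weight T x) < 4 \<and> facet_weight T 4 + facet_weight T 5 = 4"
  unfolding klein_facets_def facet_weight_def by simp

lemma replicate_45_in_kmon: "replicate_mset n 4 + replicate_mset n 5 \<in> kmon n"
proof (induction n)
  case (Suc n)
  have "{#4, 5#} \<in> klein_generators" by (simp add: klein_generators_def)
  then show ?case using Suc
    by (simp add: bexI[of _ "{#4, 5#}"])
qed simp

lemma kmonomial_in_kmon_iff:
  assumes A: "A \<subseteq> klein_vertices"
  shows "kmonomial n A \<in> kmon (Suc n) \<longleftrightarrow> A \<notin> complex_of_facets klein_facets"
proof
  assume "A \<notin> complex_of_facets klein_facets"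
  then obtain g where g: "g \<in> klein_generators" "g \<subseteq># mset_set A" using klein_nonface_iff[OF A] by blast
  let ?r = "replicate_mset n 4 + replicate_mset n 5 :: nat multiset"
  have "?r + (mset_set A - g) \<in> kmon n"
    using multiples_closed_kmon replicate_45_in_kmon unfolding multiples_closed_def by blast
  moreover have "kmonomial n A - g = ?r + (mset_set A - g)"
    unfolding kmonomial_def using g(2) by (metis subset_mset.add_diff_assoc2 add.commute)
  moreover have "g \<subseteq># kmonomial n A"
    unfolding kmonomial_def using g(2) by (simp add: subset_mset.add_increasing2)
  ultimately show "kmonomial n A \<in> kmon (Suc n)" using g(1) by auto
next
  assume mon: "kmonomial n A \<in> kmon (Suc n)"
  show "A \<notin> complex_of_facets klein_facets"
  proof
    assume "A \<in> complex_of_facets klein_facets"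
    then obtain T where T: "T \<in> klein_facets" "A \<subseteq> T" by (auto simp: complex_of_facets_def)
    have finT: "finite T" using T(1) by (auto simp: klein_facets_def)
    have w: "(\<Sum>x\<in>T. facet_weight T x) < 4" "facet_weight T 4 + facet_weight T 5 = 4"
      using facet_weight_facet T(1) by auto
    have "4 * Suc n \<le> sum_mset (image_mset (facet_weight T) (kmonomial n A))"
      by (rule kmon_weight[OF _ mon]) (use facet_weight_generators T(1) in blast)
    also have "\<dots> = (\<Sum>x\<in>A. facet_weight T x) + n * (facet_weight T 4 + facet_weight T 5)"
      by (simp add: kmonomial_def sum_unfold_sum_mset distrib_left)
    also have "\<dots> \<le> (\<Sum>x\<in>T. facet_weight T x) + n * 4"
      using T(2) finT w(2) by (simp add: sum_mono2)
    finally show False using w(1) by simp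
  qed
qed

text \<open>A function on the sets of vertices as a chain in the degree of $x_1 \cdots x_8 (x_4 x_5)^n$: its
  value on \<open>A\<close> is the coefficient of the basis element for the complement of \<open>A\<close>. The boundary of
  chains becomes the coboundary of these cochains, up to the signs.\<close>

definition klift :: "nat \<Rightarrow> (nat set \<Rightarrow> 'f::zero) \<Rightarrow> 'f kfun" where
  "klift n x = (\<lambda>(\<sigma>, m). if \<sigma> \<subseteq> klein_vertices \<and> m = kmonomial n (klein_vertices - \<sigma>)
     then x (klein_vertices - \<sigma>) else 0)"

definition kcobd :: "(nat set \<Rightarrow> 'f::comm_ring_1) \<Rightarrow> nat set \<Rightarrow> 'f" where
  "kcobd x A = (\<Sum>j\<in>A. ksign j (klein_vertices - A) * x (A - {j}))"

lemma klift_nonzeroD: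
  assumes "klift n x (\<sigma>, m) \<noteq> 0"
  shows "\<sigma> \<subseteq> klein_vertices" "m = kmonomial n (klein_vertices - \<sigma>)" "x (klein_vertices - \<sigma>) \<noteq> 0"
  using assms by (simp_all add: klift_def split: if_splits)

lemma koszul_bd_klift: "koszul_bd (klift n x) = klift n (kcobd x)"
proof (rule ext, clarify)
  fix \<sigma> m
  let ?A = "klein_vertices - \<sigma>"
  have V: "klein_vertices - insert j \<sigma> = ?A - {j}" for j by auto
  show "koszul_bd (klift n x) (\<sigma>, m) = klift n (kcobd x) (\<sigma>, m)"
  proof (cases "\<sigma> \<subseteq> klein_vertices \<and> m = kmonomial n ?A")
    case True
    then have \<sigma>: "klein_vertices - ?A = \<sigma>" and m: "m = kmonomial n ?A" by auto
    have "koszul_bd (klift n x) (\<sigma>, m) = (\<Sum>j\<in>?A. ksign j \<sigma> * x (?A - {j}))"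
      unfolding koszul_bd_def split_conv
    proof (rule sum.cong[OF refl])
      fix j assume j: "j \<in> ?A"
      have "m = add_mset j (kmonomial n (?A - {j}))"
        unfolding m by (rule kmonomial_remove) (use j in simp_all)
      then show "(if j \<in># m then ksign j \<sigma> * klift n x (insert j \<sigma>, m - {#j#}) else 0) =
          ksign j \<sigma> * x (?A - {j})"
        using j True by (simp add: klift_def V)
    qed
    also have "\<dots> = klift n (kcobd x) (\<sigma>, m)" using True \<sigma> by (simp add: klift_def kcobd_def)
    finally show ?thesis .
  next
    case False
    have "klift n x (insert j \<sigma>, m - {#j#}) = 0" if j: "j \<in> ?A" "j \<in># m" for j
    proof (rule ccontr)
      assume "klift n x (insert j \<sigma>, m - {#j#}) \<noteq> 0"
      then have "\<sigma> \<subseteq> klein_vertices" "m - {#j#} = kmonomial n (?A - {j})"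
        using klift_nonzeroD[of n x "insert j \<sigma>" "m - {#j#}"] by (simp_all add: V)
      moreover have "kmonomial n ?A = add_mset j (kmonomial n (?A - {j}))"
        by (rule kmonomial_remove) (use j in simp_all)
      ultimately show False using False insert_DiffM[OF j(2)] by simp
    qed
    then have "koszul_bd (klift n x) (\<sigma>, m) = 0"
      unfolding koszul_bd_def split_conv by (intro sum.neutral) simp
    moreover have "klift n (kcobd x) (\<sigma>, m) = 0" using False by (auto simp: klift_def)
    ultimately show ?thesis by simp
  qed
qed

lemma klift_in_kchains:
  fixes x :: "nat set \<Rightarrow> 'f::comm_ring_1"
  assumes "\<And>A. A \<subseteq> klein_vertices \<Longrightarrow> x A \<noteq> 0 \<Longrightarrow> card A + i = 8"
  shows "klift n x \<in> kchains i UNIV"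
proof -
  have "{y. klift n x y \<noteq> 0} \<subseteq> (\<lambda>\<sigma>. (\<sigma>, kmonomial n (klein_vertices - \<sigma>))) ` Pow klein_vertices"
  proof
    fix y assume y: "y \<in> {y. klift n x y \<noteq> 0}"
    obtain \<sigma> m where sm: "y = (\<sigma>, m)" by (rule prod.exhaust)
    with y have "klift n x (\<sigma>, m) \<noteq> 0" by simp
    from klift_nonzeroD[OF this] show "y \<in> (\<lambda>\<sigma>. (\<sigma>, kmonomial n (klein_vertices - \<sigma>))) ` Pow klein_vertices"
      by (simp add: sm)
  qed
  then have "finite {y. klift n x y \<noteq> 0}" by (rule finite_subset) simp
  moreover have "\<sigma> \<in> klevel i \<and> set_mset m \<subseteq> klein_vertices" if "klift n x (\<sigma>, m) \<noteq> 0" for \<sigma> m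
  proof -
    have s: "\<sigma> \<subseteq> klein_vertices" "m = kmonomial n (klein_vertices - \<sigma>)" "x (klein_vertices - \<sigma>) \<noteq> 0"
      using klift_nonzeroD[OF that] by simp_all
    have "card (klein_vertices - \<sigma>) = 8 - card \<sigma>" "card \<sigma> \<le> 8"
      using s(1) card_mono[OF finite_klein_vertices s(1)]
      by (simp_all add: card_Diff_subset finite_subset klein_vertices_def)
    then have "card \<sigma> = i" using assms[OF _ s(3)] by simp
    then show ?thesis using s kmonomial_vars[of "klein_vertices - \<sigma>" n] by (simp add: klevel_def)
  qed
  ultimately show ?thesis by (simp add: kchains_def)
qed

lemma klift_in_basis:
  fixes x :: "nat set \<Rightarrow> 'f::comm_ring_1"
  assumes "\<And>A. A \<subseteq> klein_vertices \<Longrightarrow> x A \<noteq> 0 \<Longrightarrow> card A + i = 8 \<and> A \<notin> complex_of_facets klein_facets"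
  shows "klift n x \<in> fvec (koszul_basis (Suc n) (kmon (Suc n)) i)"
proof -
  have "(\<sigma>, m) \<in> koszul_basis (Suc n) (kmon (Suc n)) i" if nz: "klift n x (\<sigma>, m) \<noteq> 0" for \<sigma> m
  proof -
    let ?A = "klein_vertices - \<sigma>"
    have s: "\<sigma> \<subseteq> klein_vertices" "m = kmonomial n ?A" "x ?A \<noteq> 0"
      using klift_nonzeroD[OF nz] by simp_all
    have "klift n x \<in> kchains i UNIV" by (rule klift_in_kchains) (use assms in blast)
    then have "\<sigma> \<in> klevel i" "set_mset m \<subseteq> klein_vertices" using nz unfolding kchains_def by blast+
    moreover have "m \<in> kmon (Suc n)"
      using kmonomial_in_kmon_iff[of ?A n] assms[OF _ s(3)] s(2) by simp
    moreover have "kexp \<sigma> m j \<le> Suc n" for j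
      by (auto simp: kexp_def s(2) kmonomial_def count_mset_set')
    ultimately show ?thesis by (simp add: koszul_basis_def)
  qed
  then show ?thesis unfolding fvec_def by auto
qed

lemma ksign_complement:
  assumes "A \<subseteq> klein_vertices" "j \<in> A"
  shows "ksign j (klein_vertices - A) = (- 1) ^ (j + 1) * (ksign j A :: 'f::comm_ring_1)"
proof -
  have j: "1 \<le> j" using assms by (auto simp: klein_vertices_def)
  have "{t \<in> klein_vertices - A. t < j} \<union> {t \<in> A. t < j} = {1..<j}"
    using assms by (auto simp: klein_vertices_def)
  moreover have "card ({t \<in> klein_vertices - A. t < j} \<union> {t \<in> A. t < j}) =
      card {t \<in> klein_vertices - A. t < j} + card {t \<in> A. t < j}"
    using finite_subset[OF assms(1)] by (intro card_Un_disjoint) auto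
  ultimately have c: "card {t \<in> klein_vertices - A. t < j} + card {t \<in> A. t < j} = j - 1" by simp
  let ?a = "card {t \<in> klein_vertices - A. t < j}" and ?b = "card {t \<in> A. t < j}"
  have "(- 1) ^ (j + 1) * (- 1) ^ ?b = ((- 1) ^ ?a :: 'f)"
  proof -
    have "even (j + 1 + ?b) \<longleftrightarrow> even ?a" using c j by presburger
    then have "(- 1) ^ (j + 1 + ?b) = ((- 1) ^ ?a :: 'f)" by (simp only: minus_one_power_iff)
    then show ?thesis by (simp only: power_add)
  qed
  then show ?thesis by (simp add: ksign_def)
qed

lemma kcobd_eq:
  "A \<subseteq> klein_vertices \<Longrightarrow> kcobd x A = (\<Sum>j\<in>A. (- 1) ^ (j + 1) * (ksign j A * x (A - {j})))"
  unfolding kcobd_def by (rule sum.cong) (simp_all add: ksign_complement mult.assoc)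

lemma ksign_empty: "ksign j {} = 1"
  by (simp add: ksign_def)

text \<open>The facet \<open>{2, 5, 7}\<close>, and a cochain on the edges at which the consecutive triangles in the
  Moebius band \<open>{2, 5, 7}\<close>, \<open>{2, 3, 7}\<close>, \<open>{1, 2, 3}\<close>, \<open>{1, 3, 5}\<close>, \<open>{1, 5, 7}\<close> are glued. Its
  signs are such that the coboundary vanishes on all the triangles but the first.\<close>

definition facet_cochain :: "nat set \<Rightarrow> int" where
  "facet_cochain A = (if A = {2, 5, 7} then 1 else 0)"

definition edge_cochain :: "nat set \<Rightarrow> int" where
  "edge_cochain A =
    (if A = {2, 7} \<or> A = {2, 3} \<or> A = {5, 7} then 1
     else if A = {1, 3} \<or> A = {1, 5} then - 1 else 0)"

lemma edge_cochain_nonzero: "edge_cochain A \<noteq> 0 \<Longrightarrow> card A = 2"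
  by (auto simp: edge_cochain_def split: if_splits)

lemma klein_facets_props: "\<forall>T\<in>klein_facets. T \<subseteq> klein_vertices \<and> card T = 3 \<and> finite T"
  unfolding klein_facets_def klein_vertices_eq by simp

lemma edge_cochain_facets:
  "\<forall>T\<in>klein_facets. (\<Sum>j\<in>T. (- 1) ^ (j + 1) * (ksign j T * edge_cochain (T - {j}))) = - 2 * facet_cochain T"
  unfolding klein_facets_def facet_cochain_def edge_cochain_def
  by (simp add: ksign_insert ksign_empty insert_Diff_if set_eq_subset)

subsection \<open>The torsion class\<close>

lemma koszul_bd_in_kchains:
  assumes c: "c \<in> kchains (Suc i) M" and M: "multiples_closed M"
  shows "koszul_bd c \<in> kchains i M"
proof -
  let ?v = "of_kcoeffs c"
  note v = of_kcoeffs_in_fvec[OF c]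
  have "koszul_bd c = kcoeffs (koszul_d ?v)"
    by (simp add: kcoeffs_koszul_d kcoeffs_of_kcoeffs[OF c])
  moreover have "range (koszul_d ?v) \<subseteq> monomial_span M"
    by (rule rlinear_ideal[OF rlinear_koszul_d finite_klevel is_ideal_monomial_span[OF M] v])
  ultimately show ?thesis using kcoeffs_in_kchains[OF koszul_d_in[OF v(1)]] by simp
qed

lemma koszul_bd_in_basis:
  assumes M: "multiples_closed M" and c: "c \<in> fvec (koszul_basis h M (Suc i))"
  shows "koszul_bd c \<in> fvec (koszul_basis h M i)"
proof -
  have "koszul_bd c = koszul_truncate h (koszul_bd c)"
    using koszul_truncate_id[OF c] koszul_bd_truncate[of h c] by simp
  then show ?thesis
    using koszul_truncate_in_fvec[OF koszul_bd_in_kchains[OF fvec_koszul_basis_kchains[OF c] M], of h]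
    by simp
qed

lemma koszul_bd_bd:
  assumes c: "c \<in> kchains (Suc (Suc i)) M"
  shows "koszul_bd (koszul_bd c) = 0"
proof -
  let ?v = "of_kcoeffs c"
  have "koszul_bd (koszul_bd c) = kcoeffs (koszul_d (koszul_d ?v))"
    by (simp add: kcoeffs_koszul_d kcoeffs_of_kcoeffs[OF c])
  also have "koszul_d (koszul_d ?v) = 0"
    by (rule koszul.d_d[OF of_kcoeffs_in_fvec(1)[OF c]])
  finally show ?thesis by (simp add: kcoeffs_0)
qed

lemma koszul_bd_of_int:
  "koszul_bd (\<lambda>x. of_int (c x) :: 'f::comm_ring_1) = (\<lambda>x. of_int (koszul_bd c x))"
proof (rule ext, clarify)
  fix \<sigma> m
  have s: "(of_int (ksign j \<sigma>) :: 'f) = ksign j \<sigma>" for j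
    using ksign_cases[of j \<sigma>, where 'a = int and 'b = 'f] by auto
  show "koszul_bd (\<lambda>x. of_int (c x) :: 'f) (\<sigma>, m) = of_int (koszul_bd c (\<sigma>, m))"
    by (auto simp: koszul_bd_def s intro!: sum.cong)
qed

text \<open>The boundary of the basis vector that belongs to the facet. This vector itself is not a chain
  with entries in the ideal, but twice its boundary is the boundary of such a chain.\<close>

definition torsion_cycle :: "nat \<Rightarrow> nat set \<times> nat multiset \<Rightarrow> int" where
  "torsion_cycle n = koszul_bd (klift n facet_cochain)"

definition torsion_chain :: "nat \<Rightarrow> nat set \<times> nat multiset \<Rightarrow> int" where
  "torsion_chain n = klift n (\<lambda>A. 2 * facet_cochain A + kcobd edge_cochain A)"

lemma torsion_chain_bd: "koszul_bd (torsion_chain n) = scl 2 (torsion_cycle n)"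
proof -
  have "card A + 6 = 8" if "edge_cochain A \<noteq> 0" for A
    using edge_cochain_nonzero[OF that] by simp
  then have e: "klift n edge_cochain \<in> kchains 6 UNIV" by (intro klift_in_kchains)
  have "torsion_chain n = scl 2 (klift n facet_cochain) + klift n (kcobd edge_cochain)"
    by (auto simp: torsion_chain_def klift_def fun_eq_iff fun_ops_apply)
  then have "torsion_chain n = scl 2 (klift n facet_cochain) + koszul_bd (klift n edge_cochain)"
    by (simp only: koszul_bd_klift)
  then have "koszul_bd (torsion_chain n) =
      scl 2 (torsion_cycle n) + koszul_bd (koszul_bd (klift n edge_cochain))"
    by (simp only: rlinear_add[OF rlinear_koszul_bd] rlinear_scl[OF rlinear_koszul_bd] torsion_cycle_def)
  also have "koszul_bd (koszul_bd (klift n edge_cochain)) = 0"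
    by (rule koszul_bd_bd[of _ 4 UNIV]) (use e in \<open>simp add: eval_nat_numeral\<close>)
  finally show ?thesis by simp
qed

lemma torsion_chain_in_basis:
  "(\<lambda>x. of_int (torsion_chain n x) :: 'f::comm_ring_1) \<in> fvec (koszul_basis (Suc n) (kmon (Suc n)) 5)"
proof -
  have "card A + 5 = 8 \<and> A \<notin> complex_of_facets klein_facets"
    if A: "A \<subseteq> klein_vertices" "2 * facet_cochain A + kcobd edge_cochain A \<noteq> 0" for A
  proof
    have finA: "finite A" by (rule finite_subset[OF A(1) finite_klein_vertices])
    show card: "card A + 5 = 8"
    proof (cases "facet_cochain A = 0")
      case True
      then have "kcobd edge_cochain A \<noteq> 0" using A(2) by simp
      then obtain j where j: "j \<in> A" "edge_cochain (A - {j}) \<noteq> 0"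
        unfolding kcobd_def by (metis (no_types, lifting) mult_zero_right sum.neutral)
      have "card (A - {j}) = 2" by (rule edge_cochain_nonzero[OF j(2)])
      then show ?thesis using card_Suc_Diff1[OF finA j(1)] by simp
    next
      case False
      then have "A = {2, 5, 7}" by (simp add: facet_cochain_def split: if_splits)
      then show ?thesis by simp
    qed
    show "A \<notin> complex_of_facets klein_facets"
    proof
      assume "A \<in> complex_of_facets klein_facets"
      then obtain T where T: "T \<in> klein_facets" "A \<subseteq> T" by (auto simp: complex_of_facets_def)
      then have "A = T" using card klein_facets_props by (intro card_subset_eq) auto
      then have "kcobd edge_cochain A = - 2 * facet_cochain A"
        unfolding kcobd_eq[OF A(1)] using edge_cochain_facets T(1) by blast
      then show False using A(2) by simp
    qed
  qed
  then have "torsion_chain n \<in> fvec (koszul_basis (Suc n) (kmon (Suc n)) 5)"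
    unfolding torsion_chain_def by (rule klift_in_basis)
  then show ?thesis by (simp add: fvec_def)
qed

lemma torsion_cycle_rat:
  "(\<lambda>x. of_int (torsion_cycle n x) :: rat) \<in> koszul_bd ` fvec (koszul_basis (Suc n) (kmon (Suc n)) 5)"
proof (rule image_eqI)
  show "scl (1 / 2) (\<lambda>x. of_int (torsion_chain n x) :: rat) \<in> fvec (koszul_basis (Suc n) (kmon (Suc n)) 5)"
    by (intro fvec_scl torsion_chain_in_basis)
  show "(\<lambda>x. of_int (torsion_cycle n x)) =
      koszul_bd (scl (1 / 2) (\<lambda>x. of_int (torsion_chain n x) :: rat))"
    unfolding rlinear_scl[OF rlinear_koszul_bd] koszul_bd_of_int torsion_chain_bd
    by (simp add: scl_def)
qed

text \<open>The sum over the sets \<open>T \<union> {8}\<close> for the facets \<open>T\<close> that do not contain 8. Modulo two it is a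
  functional that vanishes on the coboundary of every cochain that vanishes on the facets: each set
  \<open>{x, y, 8}\<close> that is not a facet occurs once for each of the two facets with the edge \<open>{x, y}\<close>.\<close>

definition cone_sum :: "(nat set \<Rightarrow> 'a::comm_monoid_add) \<Rightarrow> 'a" where
  "cone_sum S = S {3, 4, 7, 8} + S {3, 4, 6, 8} + S {3, 5, 6, 8} + S {2, 5, 7, 8} + S {2, 4, 6, 8} +
    S {1, 2, 6, 8} + S {1, 2, 3, 8} + S {2, 3, 7, 8} + S {1, 3, 5, 8} + S {1, 5, 7, 8} + S {1, 4, 7, 8}"

lemma cone_sum_coboundary:
  fixes G :: "nat set \<Rightarrow> 'a::comm_monoid_add"
  assumes char2: "\<And>a::'a. a + a = 0" and facet: "\<forall>T\<in>klein_facets. G T = 0"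
  shows "cone_sum (\<lambda>A. \<Sum>j\<in>A. G (A - {j})) = 0"
proof -
  have "a + (a + b) = b" for a b :: 'a
    by (simp add: char2 flip: add.assoc)
  then show ?thesis
    using facet unfolding klein_facets_def cone_sum_def
    by (simp add: insert_Diff_if char2 add_ac)
qed

lemma torsion_cycle_bit:
  "(\<lambda>x. of_int (torsion_cycle n x) :: bit) \<notin> koszul_bd ` fvec (koszul_basis (Suc n) (kmon (Suc n)) 5)"
proof
  assume "(\<lambda>x. of_int (torsion_cycle n x) :: bit) \<in> koszul_bd ` fvec (koszul_basis (Suc n) (kmon (Suc n)) 5)"
  then obtain c :: "nat set \<times> nat multiset \<Rightarrow> bit"
    where c: "c \<in> fvec (koszul_basis (Suc n) (kmon (Suc n)) 5)"
      and eq: "(\<lambda>x. of_int (torsion_cycle n x)) = koszul_bd c" by blast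
  have ksign: "ksign j \<sigma> = (1 :: bit)" for j \<sigma>
    by (simp add: ksign_def)
  define G where "G A = c (klein_vertices - A, kmonomial n A)" for A
  define D :: "nat set \<Rightarrow> bit" where "D A = of_int (facet_cochain A)" for A
  have facet: "\<forall>T\<in>klein_facets. G T = 0"
  proof
    fix T assume T: "T \<in> klein_facets"
    then have TV: "T \<subseteq> klein_vertices" using klein_facets_props by blast
    have "T \<in> complex_of_facets klein_facets" using T by (auto simp: complex_of_facets_def)
    then have "kmonomial n T \<notin> kmon (Suc n)" using kmonomial_in_kmon_iff[OF TV] by blast
    then show "G T = 0" unfolding G_def by (intro fvecD[OF c]) (simp add: koszul_basis_def)
  qed
  have sum: "(\<Sum>j\<in>A. G (A - {j})) = (\<Sum>j\<in>A. D (A - {j}))" if A: "A \<subseteq> klein_vertices" for A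
  proof -
    let ?\<sigma> = "klein_vertices - A"
    have finA: "finite A" by (rule finite_subset[OF A finite_klein_vertices])
    have VA: "klein_vertices - ?\<sigma> = A" using A by auto
    have "koszul_bd c (?\<sigma>, kmonomial n A) = (\<Sum>j\<in>A. G (A - {j}))"
      unfolding koszul_bd_def split_conv VA
    proof (rule sum.cong[OF refl])
      fix j assume j: "j \<in> A"
      have "insert j ?\<sigma> = klein_vertices - (A - {j})" using j A by auto
      then show "(if j \<in># kmonomial n A then ksign j ?\<sigma> * c (insert j ?\<sigma>, kmonomial n A - {#j#}) else 0) =
          G (A - {j})"
        using kmonomial_remove[OF finA j, of n] by (simp add: ksign G_def)
    qed
    moreover have "koszul_bd c (?\<sigma>, kmonomial n A) = of_int (kcobd facet_cochain A)"
      unfolding eq[symmetric] torsion_cycle_def koszul_bd_klift by (simp add: klift_def VA)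
    moreover have "of_int (kcobd facet_cochain A) = (\<Sum>j\<in>A. D (A - {j}))"
    proof -
      have "(of_int (ksign j ?\<sigma>) :: bit) = 1" for j
        using ksign_cases[of j ?\<sigma>, where 'a = int and 'b = bit] by auto
      then show ?thesis
        unfolding kcobd_def D_def of_int_sum of_int_mult by (simp only: mult_1)
    qed
    ultimately show ?thesis by simp
  qed
  have "cone_sum (\<lambda>A. \<Sum>j\<in>A. G (A - {j})) = cone_sum (\<lambda>A. \<Sum>j\<in>A. D (A - {j}))"
    unfolding cone_sum_def
    by (simp only: sum klein_vertices_eq insert_subset empty_subsetI insert_iff simp_thms)
  also have "\<dots> = 1"
    by (simp add: cone_sum_def D_def facet_cochain_def insert_Diff_if set_eq_subset)
  finally have "cone_sum (\<lambda>A. \<Sum>j\<in>A. G (A - {j})) = 1" .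
  moreover have "cone_sum (\<lambda>A. \<Sum>j\<in>A. G (A - {j})) = 0"
    by (rule cone_sum_coboundary[OF _ facet]) simp
  ultimately show False by simp
qed

section \<open>Dependence on the field\<close>

text \<open>Only the two ranks depend on the field.\<close>

lemma (in encoded_field) betti_klein_ideal_power:
  "betti K klein_vertices i (klein_ideal_power K h) +
     fs.dim (koszul_bd ` fvec (koszul_basis h (kmon h) i) :: 'f kfun set) +
     fs.dim (koszul_bd ` fvec (koszul_basis h (kmon h) (Suc i)) :: 'f kfun set) =
   card (koszul_basis h (kmon h) i)"
proof -
  let ?B = "koszul_basis h (kmon h)"
  let ?Z = "{c \<in> fvec (?B i). koszul_bd c = 0} :: 'f kfun set"
  let ?U = "koszul_bd ` fvec (?B (Suc i)) :: 'f kfun set"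
  have Z: "is_submodule ?Z" by (rule is_submodule_kernel[OF rlinear_koszul_bd is_submodule_fvec])
  have U: "is_submodule ?U" by (rule is_submodule_image[OF rlinear_koszul_bd is_submodule_fvec])
  have UZ: "?U \<subseteq> ?Z"
  proof (rule image_subsetI)
    fix c :: "nat set \<times> nat multiset \<Rightarrow> 'f" assume c: "c \<in> fvec (?B (Suc i))"
    have in_i: "koszul_bd c \<in> fvec (?B i)" by (rule koszul_bd_in_basis[OF multiples_closed_kmon c])
    have "koszul_bd (koszul_bd c) = 0"
    proof (cases i)
      case 0
      have "koszul_bd c \<in> kchains 0 (kmon h)"
        using fvec_koszul_basis_kchains[OF in_i] 0 by simp
      from kcoeffs_of_kcoeffs[OF this] koszul_bd_level_0[OF of_kcoeffs_in_fvec(1)[OF this]]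
      show ?thesis by simp
    next
      case (Suc j)
      then show ?thesis using koszul_bd_bd[of c j "kmon h"] fvec_koszul_basis_kchains[OF c] by simp
    qed
    then show "koszul_bd c \<in> ?Z" using in_i by simp
  qed
  have ZB: "?Z \<subseteq> fvec (?B i)" by blast
  obtain S where S: "finite S" "S \<subseteq> ?Z" "card S = fs.dim ?Z - fs.dim ?U"
    and indep: "\<forall>a. (\<Sum>s\<in>S. scl (a s) s) \<in> ?U \<longrightarrow> (\<forall>s\<in>S. a s = 0)"
    and span: "\<forall>v\<in>?Z. \<exists>a. v - (\<Sum>s\<in>S. scl (a s) s) \<in> ?U"
    by (rule fs_quotient_basis[OF finite_koszul_basis U UZ Z ZB])
  have "betti K klein_vertices i (klein_ideal_power K h) = card S"
    unfolding klein_ideal_power_eq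
  proof (rule betti_eq_card[OF multiples_closed_kmon exponents_bounded_kmon S(1,2)])
    show "a s = 0" if "(\<Sum>s\<in>S. scl (a s) s) \<in> ?U" "s \<in> S" for a s
      using spec[OF indep, of a] that by simp
    show "\<exists>a. c - (\<Sum>s\<in>S. scl (a s) s) \<in> ?U" if "c \<in> fvec (?B i)" "koszul_bd c = 0" for c
      using bspec[OF span, of c] that by simp
  qed
  moreover have "fs.dim ?U \<le> fs.dim ?Z" by (rule fs_dim_mono[OF finite_koszul_basis U UZ Z ZB])
  moreover have "fs.dim ?Z + fs.dim (koszul_bd ` fvec (?B i) :: 'f kfun set) =
      card (?B i)"
    by (rule fs_rank_nullity[OF finite_koszul_basis rlinear_koszul_bd])
  ultimately show ?thesis using S(3) by simp
qed

lemma koszul_bd_unit_vec: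
  "koszul_bd (unit_vec y :: _ \<Rightarrow> 'f::comm_ring_1) = (\<lambda>x. of_int (koszul_bd (unit_vec y) x))"
proof -
  have "(unit_vec y :: _ \<Rightarrow> 'f) = (\<lambda>x. of_int (unit_vec y x))" by (auto simp: unit_vec_def)
  then show ?thesis by (simp only: koszul_bd_of_int)
qed

lemma koszul_bd_image_basis:
  assumes "multiples_closed M"
  shows "koszul_bd ` fvec (koszul_basis h M (Suc i)) \<subseteq> fvec (koszul_basis h M i)"
  using koszul_bd_in_basis[OF assms] by blast

lemma koszul_rank_le:
  "fs.dim (koszul_bd ` fvec (koszul_basis h (kmon h) (Suc i)) :: (_ \<Rightarrow> bit) set) \<le>
   fs.dim (koszul_bd ` fvec (koszul_basis h (kmon h) (Suc i)) :: (_ \<Rightarrow> rat) set)"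
  by (rule rank_bit_le_rank_rat[OF finite_koszul_basis finite_koszul_basis rlinear_koszul_bd
        rlinear_koszul_bd koszul_bd_image_basis[OF multiples_closed_kmon] koszul_bd_unit_vec
        koszul_bd_unit_vec])

lemma koszul_rank_less:
  "fs.dim (koszul_bd ` fvec (koszul_basis (Suc n) (kmon (Suc n)) 5) :: (_ \<Rightarrow> bit) set) <
   fs.dim (koszul_bd ` fvec (koszul_basis (Suc n) (kmon (Suc n)) 5) :: (_ \<Rightarrow> rat) set)"
proof (rule rank_bit_less_rank_rat[OF finite_koszul_basis finite_koszul_basis rlinear_koszul_bd
        rlinear_koszul_bd _ koszul_bd_unit_vec koszul_bd_unit_vec torsion_cycle_bit torsion_cycle_rat])
  show "(koszul_bd ` fvec (koszul_basis (Suc n) (kmon (Suc n)) 5) :: (_ \<Rightarrow> rat) set) \<subseteq>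
      fvec (koszul_basis (Suc n) (kmon (Suc n)) 4)"
    using koszul_bd_image_basis[OF multiples_closed_kmon, of "Suc n" "Suc n" 4]
    by (simp add: eval_nat_numeral)
qed

text \<open>A field on a given type that is isomorphic to the field type \<open>'f\<close>.\<close>

definition field_record :: "('f::field \<Rightarrow> 'a) \<Rightarrow> 'a ring" where
  "field_record \<phi> =
    \<lparr>carrier = range \<phi>, mult = (\<lambda>x y. \<phi> (inv_into UNIV \<phi> x * inv_into UNIV \<phi> y)), one = \<phi> 1, zero = \<phi> 0,
     add = (\<lambda>x y. \<phi> (inv_into UNIV \<phi> x + inv_into UNIV \<phi> y))\<rparr>"

lemma encoded_field_record: "inj \<phi> \<Longrightarrow> encoded_field (field_record \<phi>) \<phi>"
  unfolding encoded_field_def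
  by unfold_locales (simp_all add: field_record_def inv_f_f)

theorem theorem3p3:
  fixes K :: "'a ring"
  shows "(field K \<longrightarrow>
            klein_ideal K =
              stanley_reisner_ideal K klein_vertices (complex_of_facets klein_facets)) \<and>
         (\<forall>h::nat. h \<ge> 1 \<longrightarrow>
            (\<exists>(i::nat) (k::real ring) (k'::real ring).
               field k \<and> field k' \<and>
               betti k klein_vertices i (klein_ideal_power k h) \<noteq>
               betti k' klein_vertices i (klein_ideal_power k' h)))"
proof (intro conjI impI allI)
  show "klein_ideal K = stanley_reisner_ideal K klein_vertices (complex_of_facets klein_facets)"
    if "field K"
    by (rule klein_ideal_stanley_reisner[OF that])
next
  fix h :: nat assume "h \<ge> 1"
  then obtain n where h: "h = Suc n" by (cases h) auto
  define k where "k = field_record (\<lambda>b :: bit. if b = 1 then 1 else 0 :: real)"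
  define k' where "k' = field_record (of_rat :: rat \<Rightarrow> real)"
  have "inj (\<lambda>b :: bit. if b = 1 then 1 else 0 :: real)"
    by (auto simp: inj_def split: if_splits)
  then interpret F2: encoded_field k "\<lambda>b :: bit. if b = 1 then 1 else 0 :: real"
    unfolding k_def by (rule encoded_field_record)
  interpret Q: encoded_field k' "of_rat :: rat \<Rightarrow> real"
    unfolding k'_def by (rule encoded_field_record) (simp add: inj_def)
  \<comment> \<open>The rank of the differential from degree 5 to degree 4 enters the Betti number with index 4.\<close>
  have F2: "betti k klein_vertices 4 (klein_ideal_power k h) +
      fs.dim (koszul_bd ` fvec (koszul_basis h (kmon h) 4) :: (_ \<Rightarrow> bit) set) +
      fs.dim (koszul_bd ` fvec (koszul_basis h (kmon h) 5) :: (_ \<Rightarrow> bit) set) =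
      card (koszul_basis h (kmon h) 4)"
    using F2.betti_klein_ideal_power[of 4 h] by simp
  have Q: "betti k' klein_vertices 4 (klein_ideal_power k' h) +
      fs.dim (koszul_bd ` fvec (koszul_basis h (kmon h) 4) :: (_ \<Rightarrow> rat) set) +
      fs.dim (koszul_bd ` fvec (koszul_basis h (kmon h) 5) :: (_ \<Rightarrow> rat) set) =
      card (koszul_basis h (kmon h) 4)"
    using Q.betti_klein_ideal_power[of 4 h] by simp
  have "betti k klein_vertices 4 (klein_ideal_power k h) \<noteq>
      betti k' klein_vertices 4 (klein_ideal_power k' h)"
    using F2 Q koszul_rank_le[of h 3] koszul_rank_less[of n] by (simp add: h)
  then show "\<exists>i k k'. field (k :: real ring) \<and> field (k' :: real ring) \<and>
      betti k klein_vertices i (klein_ideal_power k h) \<noteq>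
      betti k' klein_vertices i (klein_ideal_power k' h)"
    using F2.field Q.field by blast
qed

end
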